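(* Let $G=(V,E)\subset\Sigma$ be a graph in a surface (not necessarily cellularly embedded). Then \[ L_{G\subset\Sigma}(x,y,z)=z^{\frac12(\gamma(N(E))-\gamma(\Sigma\setminus E))}\,K_{G\subset\Sigma}(x-1,\,y-1,\,z^{-1},\,z). \]
   Context: $\Sigma$ is a surface (no pinch points), and $G\subset\Sigma$ is a graph drawn on $\Sigma$ with edges meeting only at their ends. For $A\subseteq E$: $c(A)$ is the number of components of the spanning subgraph $(V,A)$; $N(A)$ denotes a regular neighbourhood in $\Sigma$ of $V\cup A$ (a surface with boundary); $\Sigma\setminus A$ denotes the complement in $\Sigma$ of (the interior of) $N(A)$; $k(X)$ is the number of connected components of a space $X$; $\gamma(S)$ is the Euler genus of a surface $S$ (its genus if non-orientable, twice its genus if orientable; for surfaces with boundary and several components, $\gamma(S)=2k(S)-b(S)-\chi(S)$ with $b$ the number of boundary components and $\chi$ the Euler characteristic); $\rho(A)$ is the number of components of $\Sigma\setminus(V\cup A)$. The Las Vergnas polynomial is $L_{G\subset\Sigma}(x,y,z)=\sum_{A\subseteq E}(x-1)^{c(A)-c(E)}(y-1)^{\rho(A)-\rho(\emptyset)}z^{|E|-|A|-\rho(E)+\rho(A)+c(E)-c(A)}$. The Krushkal polynomial is $K_{G\subset\Sigma}(x,y,a,b)=\sum_{A\subseteq E}x^{c(A)-c(E)}y^{k(\Sigma\setminus A)-k(\Sigma)}a^{\frac12\gamma(N(A))}b^{\frac12\gamma(\Sigma\setminus A)}$. *)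

theory Defs
  imports "HOL-Analysis.Analysis" "HOL-Homology.Homology"
begin

section \<open>Surfaces and their Euler genus\<close>

text \<open>Compactness is part of the notion of surface; connectedness is not.\<close>

definition surface_with_boundary :: "'a topology \<Rightarrow> bool" where
  "surface_with_boundary X \<longleftrightarrow>
     compact_space X \<and> Hausdorff_space X \<and> second_countable X \<and>
     (\<forall>x\<in>topspace X. \<exists>U W. openin X U \<and> x \<in> U \<and>
        openin (top_of_set {p :: real \<times> real. 0 \<le> snd p}) W \<and>
        subtopology X U homeomorphic_space top_of_set W)"

definition surface_boundary :: "'a topology \<Rightarrow> 'a set" where
  "surface_boundary X =
     {x \<in> topspace X. \<nexists>U W. openin X U \<and> x \<in> U \<and> open (W :: (real \<times> real) set) \<and>
        subtopology X U homeomorphic_space top_of_set W}"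

definition closed_surface :: "'a topology \<Rightarrow> bool" where
  "closed_surface X \<longleftrightarrow> surface_with_boundary X \<and> surface_boundary X = {}"

definition num_components :: "'a topology \<Rightarrow> nat" where
  "num_components X = card (connected_components_of X)"

text \<open>
  The rank of an abelian group is the largest size of a family that is linearly independent
  over the integers (the group is written multiplicatively). The supremum is meant for groups of
  finite rank, such as the homology groups of compact surfaces.
\<close>

definition int_independent :: "('g, 'm) monoid_scheme \<Rightarrow> 'g set \<Rightarrow> bool" where
  "int_independent G B \<longleftrightarrow>
     finite B \<and> B \<subseteq> carrier G \<and>
     (\<forall>n :: 'g \<Rightarrow> int.
        finprod G (\<lambda>g. g [^]\<^bsub>G\<^esub> n g) B = \<one>\<^bsub>G\<^esub> \<longrightarrow> (\<forall>g\<in>B. n g = 0))"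

definition abelian_rank :: "('g, 'm) monoid_scheme \<Rightarrow> nat" where
  "abelian_rank G = Sup {card B | B. int_independent G B}"

definition betti :: "nat \<Rightarrow> 'a topology \<Rightarrow> nat" where
  "betti p X = abelian_rank (homology_group (int p) X)"

text \<open>Surfaces have no homology above degree 2, so the alternating sum stops there.\<close>

definition surface_euler_char :: "'a topology \<Rightarrow> int" where
  "surface_euler_char X = (\<Sum>p\<le>2. (- 1) ^ p * int (betti p X))"

definition num_boundary_components :: "'a topology \<Rightarrow> nat" where
  "num_boundary_components X = num_components (subtopology X (surface_boundary X))"

definition euler_genus :: "'a topology \<Rightarrow> int" where
  "euler_genus X =
     2 * int (num_components X) - int (num_boundary_components X) - surface_euler_char X"


section \<open>Graphs drawn on a surface\<close>

text \<open>
  An edge is represented by the set of its points, its one or two ends included; both ends of a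
  loop are the same vertex. The ends of an edge \<open>e\<close> are the elements of \<open>e \<inter> V\<close>.
\<close>

definition drawn_edge :: "'a topology \<Rightarrow> 'a set \<Rightarrow> 'a set \<Rightarrow> bool" where
  "drawn_edge S V e \<longleftrightarrow>
     (\<exists>g. pathin S g \<and> e = g ` {0..1} \<and> inj_on g {0<..<1} \<and>
          g 0 \<in> V \<and> g 1 \<in> V \<and> g ` {0<..<1} \<inter> V = {})"

definition drawn_graph :: "'a topology \<Rightarrow> 'a set \<Rightarrow> 'a set set \<Rightarrow> bool" where
  "drawn_graph S V E \<longleftrightarrow>
     finite V \<and> V \<subseteq> topspace S \<and> finite E \<and> (\<forall>e\<in>E. drawn_edge S V e) \<and>
     (\<forall>e\<in>E. \<forall>e'\<in>E. e \<noteq> e' \<longrightarrow> e \<inter> e' \<subseteq> V)"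

definition adjacency :: "'a set \<Rightarrow> 'a set set \<Rightarrow> ('a \<times> 'a) set" where
  "adjacency V A = {(u, v). \<exists>e\<in>A. u \<in> e \<inter> V \<and> v \<in> e \<inter> V}"

text \<open>The number \<open>c(A)\<close> of components of the spanning subgraph \<open>(V, A)\<close>.\<close>

definition graph_components :: "'a set \<Rightarrow> 'a set set \<Rightarrow> nat" where
  "graph_components V A = card (V // (adjacency V A)\<^sup>*)"

text \<open>The number \<open>\<rho>(A)\<close> of components of the complement of \<open>V \<union> A\<close> in the surface.\<close>

definition complement_components :: "'a topology \<Rightarrow> 'a set \<Rightarrow> 'a set set \<Rightarrow> nat" where
  "complement_components S V A =
     num_components (subtopology S (topspace S - (V \<union> \<Union>A)))"


section \<open>Regular neighbourhoods\<close>

text \<open>The complement of the interior of \<open>N\<close>; for \<open>N = N(A)\<close> this is the surface \<open>\<Sigma> \<setminus> A\<close>.\<close>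

definition surface_complement :: "'a topology \<Rightarrow> 'a set \<Rightarrow> 'a topology" where
  "surface_complement S N = subtopology S (topspace S - S interior_of N)"

text \<open>
  A regular neighbourhood \<open>N\<close> of \<open>P\<close> is a subsurface containing \<open>P\<close> in its interior, with
  complementary surface, which collapses onto \<open>P\<close>. In topological terms, \<open>N\<close> is the mapping
  cylinder of a map from its boundary \<open>B\<close> to \<open>P\<close>: there is a map \<open>h\<close> from \<open>B \<times> [0,1]\<close> to \<open>N\<close> that
  is the identity at time 1, sends time 0 onto \<open>P\<close>, and maps \<open>B \<times> (0,1]\<close> homeomorphically
  onto \<open>N - P\<close>.
\<close>

definition regular_neighbourhood :: "'a topology \<Rightarrow> 'a set \<Rightarrow> 'a set \<Rightarrow> bool" where
  "regular_neighbourhood S P N \<longleftrightarrow>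
     N \<subseteq> topspace S \<and> P \<subseteq> S interior_of N \<and>
     surface_with_boundary (subtopology S N) \<and>
     surface_with_boundary (surface_complement S N) \<and>
     (let B = surface_boundary (subtopology S N) in
        \<exists>h. continuous_map (prod_topology (subtopology S B) (top_of_set {0..1::real}))
              (subtopology S N) h \<and>
            (\<forall>x\<in>B. h (x, 1) = x) \<and>
            h ` (B \<times> {0}) = P \<and>
            homeomorphic_map (prod_topology (subtopology S B) (top_of_set {0<..1::real}))
              (subtopology S (N - P)) h)"


section \<open>The Las Vergnas and Krushkal polynomials\<close>

text \<open>All exponents below are integers; those of the Las Vergnas polynomial are in fact
  nonnegative, as are those of \<open>x\<close> and \<open>y\<close> in the Krushkal polynomial.\<close>

definition las_vergnas ::
    "'a topology \<Rightarrow> 'a set \<Rightarrow> 'a set set \<Rightarrow> 'k::field \<Rightarrow> 'k \<Rightarrow> 'k \<Rightarrow> 'k" where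
  "las_vergnas S V E x y z =
     (let c = (\<lambda>A. int (graph_components V A));
          \<rho> = (\<lambda>A. int (complement_components S V A))
      in \<Sum>A\<in>Pow E.
           (x - 1) powi (c A - c E) * (y - 1) powi (\<rho> A - \<rho> {}) *
           z powi (int (card E) - int (card A) - \<rho> E + \<rho> A + c E - c A))"

text \<open>
  \<open>N A\<close> is the chosen regular neighbourhood of \<open>V \<union> A\<close>. As \<open>\<gamma>\<close> may be odd, the Krushkal polynomial
  is a polynomial in \<open>x\<close>, \<open>y\<close> and the square roots of \<open>a\<close> and \<open>b\<close>. These square roots are the
  last two arguments: with \<open>ra\<^sup>2 = a\<close>, the power of \<open>a\<close> with exponent \<open>\<gamma>/2\<close> is \<open>ra powi \<gamma>\<close>.
\<close>

definition krushkal ::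
    "'a topology \<Rightarrow> 'a set \<Rightarrow> 'a set set \<Rightarrow> ('a set set \<Rightarrow> 'a set) \<Rightarrow>
     'k::field \<Rightarrow> 'k \<Rightarrow> 'k \<Rightarrow> 'k \<Rightarrow> 'k" where
  "krushkal S V E N x y ra rb =
     (let c = (\<lambda>A. int (graph_components V A))
      in \<Sum>A\<in>Pow E.
           x powi (c A - c E) *
           y powi (int (num_components (surface_complement S (N A))) - int (num_components S)) *
           ra powi euler_genus (subtopology S (N A)) *
           rb powi euler_genus (surface_complement S (N A)))"

end

theory Submission
  imports Defs
begin

text \<open>
  Both sides are sums over \<open>A \<subseteq> E\<close> and agree term by term. The neighbourhood \<open>N(A)\<close> retracts onto
  \<open>V \<union> A\<close>, and \<open>\<Sigma> - (V \<union> A)\<close> retracts onto \<open>\<Sigma> \<setminus> A\<close>, which gives \<open>k(N(A)) = c(A)\<close> and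
  \<open>k(\<Sigma> \<setminus> A) = \<rho>(A)\<close>. By invariance of domain the two surfaces have the same boundary, so its
  components cancel in \<open>\<gamma>(N(A)) - \<gamma>(\<Sigma> \<setminus> A)\<close>. Since \<open>\<chi>(N(A)) = |V| - |A|\<close> and
  \<open>\<chi>(\<Sigma> \<setminus> A) = \<chi>(\<Sigma> - V) + |A|\<close>, that difference is \<open>2 (c(A) - \<rho>(A) + |A|)\<close> plus a constant.

  No triangulation is available, so the Euler characteristics are computed with singular homology.
  By excision, removing a point or an open arc from a surface changes the Euler characteristic as
  it does in the plane. There the complement of an arc has the homology of the complement of a
  straight segment, however wild the arc is. An edge need not lie in a chart; bisection cuts it into
  arcs that do. The homology of a compact surface has finite rank because, for open sets
  with the closure of \<open>U\<close> contained in \<open>W\<close>, the image of the homology of \<open>U\<close> in that of \<open>W\<close> has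
  finite rank; this is proved by induction on the number of charts that cover \<open>U\<close>.
\<close>

section \<open>Ranks of abelian groups\<close>

text \<open>Edges are arbitrary continuous arcs in a topological surface, so they are handled
  through an invariant blind to the embedding: the homology of a Euclidean space relative to the
  complement of a closed set depends only on the homeomorphism type of that set. An open arc thus
  counts like a straight one, and an open cell of dimension n contributes \<open>(-1)^n\<close>: an
  edge added to \<open>A\<close> lowers the Euler characteristic of \<open>N(A)\<close> by 1 and
  raises that of the complement by 1. This is the origin of the term \<open>2 |A|\<close> in the
  difference of the genera. It also makes that difference change by an even number from
  \<open>A\<close> to \<open>E\<close>, so that half of the change is an integer exponent of
  \<open>z\<close>. Only such changes enter the identity, so the Euler characteristic of the surface
  without \<open>V\<close> appears merely as a constant that cancels. It must be finite, though: an
  alternating sum of ranks says nothing when one of them is infinite. Hence additivity of rank is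
  proved with values in \<open>enat\<close>, and finiteness travels with every later step.\<close>

definition ind_fam :: "('g, 'm) monoid_scheme \<Rightarrow> 'i set \<Rightarrow> ('i \<Rightarrow> 'g) \<Rightarrow> bool" where
  "ind_fam G I v \<longleftrightarrow> finite I \<and> v \<in> I \<rightarrow> carrier G \<and>
     (\<forall>n :: 'i \<Rightarrow> int. finprod G (\<lambda>i. v i [^]\<^bsub>G\<^esub> n i) I = \<one>\<^bsub>G\<^esub> \<longrightarrow> (\<forall>i\<in>I. n i = 0))"

text \<open>Independence is tested in the ambient group \<open>G\<close> for an arbitrary subset
  \<open>S\<close>, so kernels and images of maps have a rank without being made into groups of
  their own.\<close>

definition grank :: "('g, 'm) monoid_scheme \<Rightarrow> 'g set \<Rightarrow> enat" where
  "grank G S = (SUP B\<in>{B. int_independent G B \<and> B \<subseteq> S}. enat (card B))"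

context comm_group
begin

lemma finprod_int_pow:
  assumes "finite I" "v \<in> I \<rightarrow> carrier G"
  shows "finprod G v I [^] (m::int) = finprod G (\<lambda>i. v i [^] m) I"
  using assms by (induction I rule: finite_induct) (auto simp: int_pow_distrib Pi_iff)

lemma finprod_int_pow_sum:
  fixes n :: "'j \<Rightarrow> 'i \<Rightarrow> int"
  assumes "finite C" "finite I" "v \<in> I \<rightarrow> carrier G"
  shows "finprod G (\<lambda>b. finprod G (\<lambda>i. v i [^] n b i) I) C = finprod G (\<lambda>i. v i [^] (\<Sum>b\<in>C. n b i)) I"
  using assms(1)
proof (induction C rule: finite_induct)
  case (insert b C)
  have "finprod G (\<lambda>b. finprod G (\<lambda>i. v i [^] n b i) I) (insert b C)
        = finprod G (\<lambda>i. v i [^] n b i) I \<otimes> finprod G (\<lambda>i. v i [^] (\<Sum>b\<in>C. n b i)) I"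
    using insert assms by (subst finprod_insert) (auto simp: Pi_iff)
  also have "\<dots> = finprod G (\<lambda>i. v i [^] n b i \<otimes> v i [^] (\<Sum>b\<in>C. n b i)) I"
    using assms by (subst finprod_multf) (auto simp: Pi_iff)
  also have "\<dots> = finprod G (\<lambda>i. v i [^] (\<Sum>b\<in>insert b C. n b i)) I"
    using assms insert by (intro finprod_cong') (auto simp: Pi_iff int_pow_mult)
  finally show ?case .
qed simp

lemma ind_fam_subset:
  fixes I :: "'i set"
  assumes "ind_fam G I v" "J \<subseteq> I"
  shows "ind_fam G J v"
  unfolding ind_fam_def
proof (intro conjI allI impI)
  have fin: "finite I" and v: "v \<in> I \<rightarrow> carrier G" using assms by (auto simp: ind_fam_def)
  show "finite J" "v \<in> J \<rightarrow> carrier G" using fin v assms finite_subset by auto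
  fix n :: "'i \<Rightarrow> int" assume n: "finprod G (\<lambda>i. v i [^] n i) J = \<one>"
  define m where "m = (\<lambda>i. if i \<in> J then n i else 0)"
  have "finprod G (\<lambda>i. v i [^] m i) I = finprod G (\<lambda>i. v i [^] n i) J"
    by (rule finprod_mono_neutral_cong_right) (use assms fin v in \<open>auto simp: m_def\<close>)
  then have "\<forall>i\<in>I. m i = 0" using n assms(1) by (auto simp: ind_fam_def)
  then show "\<forall>i\<in>J. n i = 0" using assms(2) by (force simp: m_def)
qed

text \<open>Two indices with the same value would satisfy the relation with exponents 1 and -1. So
  an indexed family, which is what a homomorphism makes of a set, loses no member when it is turned
  back into a set.\<close>

lemma ind_fam_inj:
  assumes "ind_fam G I v" shows "inj_on v I"
proof (rule inj_onI, rule ccontr)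
  fix i j assume ij: "i \<in> I" "j \<in> I" "v i = v j" "i \<noteq> j"
  have "ind_fam G {i,j} v" using assms ij by (auto intro: ind_fam_subset[of I])
  moreover have "v j \<in> carrier G" using assms ij by (auto simp: ind_fam_def)
  then have "finprod G (\<lambda>k. v k [^] (if k = i then 1 else -1::int)) {i,j} = \<one>"
    using ij int_pow_neg[of "v j" 1] by (subst finprod_insert) auto
  ultimately show False by (auto simp: ind_fam_def)
qed

lemma ind_fam_image:
  assumes "ind_fam G I v" shows "int_independent G (v ` I)"
  unfolding int_independent_def
proof (intro conjI allI impI)
  note inj = ind_fam_inj[OF assms]
  show "finite (v ` I)" "v ` I \<subseteq> carrier G" using assms by (auto simp: ind_fam_def)
  fix n :: "'a \<Rightarrow> int" assume "finprod G (\<lambda>g. g [^] n g) (v ` I) = \<one>"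
  moreover have "finprod G (\<lambda>g. g [^] n g) (v ` I) = finprod G (\<lambda>i. v i [^] n (v i)) I"
    by (rule finprod_reindex) (use assms inj in \<open>auto simp: ind_fam_def\<close>)
  ultimately show "\<forall>g\<in>v ` I. n g = 0"
    using assms by (auto simp: ind_fam_def)
qed

lemma int_independent_iff_ind_fam: "int_independent G B \<longleftrightarrow> ind_fam G B (\<lambda>x. x)"
  by (auto simp: int_independent_def ind_fam_def)

text \<open>Subsets of independent sets are independent, so every finite size up to the supremum
  occurs, even when the supremum is infinite.\<close>

lemma enat_le_grank_iff:
  "enat k \<le> grank G S \<longleftrightarrow> (\<exists>B. int_independent G B \<and> B \<subseteq> S \<and> card B = k)"
proof
  assume L: "enat k \<le> grank G S"
  show "\<exists>B. int_independent G B \<and> B \<subseteq> S \<and> card B = k"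
  proof (rule ccontr)
    assume no: "\<nexists>B. int_independent G B \<and> B \<subseteq> S \<and> card B = k"
    have less: "card B < k" if "int_independent G B" "B \<subseteq> S" for B
    proof (rule ccontr)
      assume "\<not> card B < k"
      then obtain C where "C \<subseteq> B" "card C = k"
        by (metis not_less obtain_subset_with_card_n)
      then show False using no that ind_fam_subset[of B "\<lambda>x. x" C] int_independent_iff_ind_fam[of B]
          int_independent_iff_ind_fam[of C]
        by blast
    qed
    \<comment> \<open>The empty set is independent, so \<open>k\<close> is positive and
      \<open>k - 1\<close> is a genuine predecessor.\<close>
    have "int_independent G {}" by (auto simp: int_independent_def)
    then have "k > 0" using less[of "{}"] by auto
    have "grank G S \<le> enat (k - 1)"
      unfolding grank_def by (rule SUP_least) (use less in force)
    then have "enat k \<le> enat (k - 1)" using L order_trans by blast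
    then show False using \<open>k > 0\<close> by simp
  qed
next
  assume "\<exists>B. int_independent G B \<and> B \<subseteq> S \<and> card B = k"
  then show "enat k \<le> grank G S"
    unfolding grank_def by (metis (mono_tags, lifting) SUP_upper mem_Collect_eq)
qed

lemma grank_ge:
  assumes "ind_fam G I v" "v ` I \<subseteq> S" shows "enat (card I) \<le> grank G S"
  using ind_fam_image[OF assms(1)] card_image[OF ind_fam_inj[OF assms(1)]] assms(2)
  unfolding enat_le_grank_iff by metis

lemma grank_le:
  assumes "\<And>B. int_independent G B \<Longrightarrow> B \<subseteq> S \<Longrightarrow> enat (card B) \<le> k"
  shows "grank G S \<le> k"
  unfolding grank_def by (rule SUP_least) (use assms in auto)

lemma grank_mono: "S \<subseteq> T \<Longrightarrow> grank G S \<le> grank G T"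
  unfolding grank_def by (rule SUP_subset_mono) auto

lemma grank_one [simp]: "grank G {\<one>} = 0"
proof -
  have "grank G {\<one>} \<le> 0"
  proof (rule grank_le)
    fix B assume B: "int_independent G B" "B \<subseteq> {\<one>}"
    have "B = {}"
    proof (rule ccontr)
      assume "B \<noteq> {}"
      then have "B = {\<one>}" using B by auto
      \<comment> \<open>The exponent 1 is a nontrivial relation on the neutral element.\<close>
      moreover have "finprod G (\<lambda>g. g [^] (1::int)) {\<one>} = \<one>" by simp
      ultimately show False using B(1) by (auto simp: int_independent_def dest: spec[of _ "\<lambda>_. 1"])
    qed
    then show "enat (card B) \<le> 0" by (simp add: zero_enat_def)
  qed
  then show ?thesis by simp
qed

text \<open>For infinite rank, \<^const>\<open>abelian_rank\<close> is the supremum of an unbounded set of naturals, a junk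
  value; hence the separate rank in \<^typ>\<open>enat\<close>.\<close>

lemma abelian_rank_grank:
  assumes "grank G (carrier G) = enat r"
  shows "abelian_rank G = r"
  unfolding abelian_rank_def
proof (rule cSup_eq_maximum)
  have le: "enat k \<le> enat r \<longleftrightarrow> (\<exists>B. int_independent G B \<and> B \<subseteq> carrier G \<and> card B = k)" for k
    using enat_le_grank_iff[of k "carrier G"] assms by simp
  show "r \<in> {card B |B. int_independent G B}" using le[of r] by auto
  fix x assume "x \<in> {card B |B. int_independent G B}"
  then have "\<exists>B. int_independent G B \<and> B \<subseteq> carrier G \<and> card B = x"
    by (auto simp: int_independent_def)
  then show "x \<le> r" using le[of x] by simp
qed

end

text \<open>If one summand is infinite, pairing each of its finite lower bounds with 0 already
  forces \<open>c\<close> to be infinite.\<close>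

lemma enat_add_leI:
  fixes a b c :: enat
  assumes "\<And>n m. enat n \<le> a \<Longrightarrow> enat m \<le> b \<Longrightarrow> enat (n + m) \<le> c"
  shows "a + b \<le> c"
proof -
  have inf: "c = \<infinity>" if "\<And>n. enat n \<le> c"
    using that[of "Suc (the_enat c)"] by (cases c) auto
  show ?thesis
  proof (cases a)
    case [simp]: (enat n)
    show ?thesis
    proof (cases b)
      case (enat m) then show ?thesis using assms[of n m] by simp
    next
      case infinity
      then have "enat m \<le> c" for m using assms[of 0 m] by (simp add: zero_enat_def[symmetric])
      then show ?thesis using inf by simp
    qed
  next
    case infinity
    then have "enat n \<le> c" for n using assms[of n 0] by (simp add: zero_enat_def[symmetric])
    then show ?thesis using inf by simp
  qed
qed

lemma group_hom_finprod:
  assumes "comm_group G" "comm_group H" "f \<in> hom G H" "finite I" "v \<in> I \<rightarrow> carrier G"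
  shows "f (finprod G v I) = finprod H (\<lambda>i. f (v i)) I"
proof -
  interpret G: comm_group G by fact
  interpret H: comm_group H by fact
  interpret group_hom G H f by unfold_locales fact
  show ?thesis using assms(4,5)
    by (induction I rule: finite_induct) (auto simp: Pi_iff)
qed

text \<open>Rank-nullity over the integers. Torsion excludes bases in general, so independent sets
  are compared directly: in one direction elements are moved into the kernel after passing to
  nonzero multiples, in the other an independent set of the image is lifted and joined to one of the
  kernel. The domain is a subgroup \<open>S\<close> because it will itself be the image of another
  map.\<close>

theorem grank_hom:
  assumes "comm_group G" "comm_group H" "f \<in> hom G H" "subgroup S G"
  shows "grank G S = grank G (S \<inter> kernel G H f) + grank H (f ` S)"
proof (rule antisym)
  interpret G: comm_group G by fact
  interpret H: comm_group H by fact
  interpret f: group_hom G H f by unfold_locales fact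
  interpret S: subgroup S G by fact
  have fpow: "f (x [^]\<^bsub>G\<^esub> (k::int)) = f x [^]\<^bsub>H\<^esub> k" if "x \<in> carrier G" for x k
    using f.hom_int_pow that by blast
  have finprod_S: "finprod G v I \<in> S" if "finite I" "v \<in> I \<rightarrow> S" for v :: "'i \<Rightarrow> 'a" and I
    using that
  proof (induction I rule: finite_induct)
    case (insert i I)
    then show ?case using S.subset by (subst G.finprod_insert) (auto simp: Pi_iff)
  qed auto
  show "grank G S \<le> grank G (S \<inter> kernel G H f) + grank H (f ` S)"
  proof (rule G.grank_le)
    fix B assume B: "int_independent G B" "B \<subseteq> S"
    then have finB: "finite B" and BG: "B \<subseteq> carrier G" by (auto simp: int_independent_def)
    \<comment> \<open>Take a maximal \<open>B1 \<subseteq> B\<close> with independent image; each other element of \<open>B\<close> has a nonzero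
      multiple that \<open>B1\<close> moves into the kernel.\<close>
    define F where "F = {C. C \<subseteq> B \<and> ind_fam H C f}"
    have "finite F" using finB by (auto simp: F_def)
    moreover have "{} \<in> F" by (auto simp: F_def ind_fam_def)
    ultimately obtain B1 where B1: "B1 \<in> F" and max: "\<And>C. C \<in> F \<Longrightarrow> B1 \<subseteq> C \<Longrightarrow> C = B1"
      using finite_has_maximal[of F] by blast
    then have B1B: "B1 \<subseteq> B" and indB1: "ind_fam H B1 f" by (auto simp: F_def)
    have finB1: "finite B1" using B1B finB finite_subset by auto
    define C where "C = B - B1"
    have "\<exists>n::'a \<Rightarrow> int. (\<forall>x. x \<notin> insert b B1 \<longrightarrow> n x = 0) \<and> n b \<noteq> 0 \<and>
            finprod H (\<lambda>x. f x [^]\<^bsub>H\<^esub> n x) B = \<one>\<^bsub>H\<^esub>" if b: "b \<in> C" for b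
    proof -
      have fH: "f \<in> insert b B1 \<rightarrow> carrier H"
        using b BG B1B by (auto simp: C_def)
      have "\<not> ind_fam H (insert b B1) f"
        using max[of "insert b B1"] b B1B by (auto simp: F_def C_def)
      then obtain n :: "'a \<Rightarrow> int" where n: "finprod H (\<lambda>x. f x [^]\<^bsub>H\<^esub> n x) (insert b B1) = \<one>\<^bsub>H\<^esub>"
          "\<exists>i\<in>insert b B1. n i \<noteq> 0"
        using finB1 fH unfolding ind_fam_def by blast
      define m where "m = (\<lambda>x. if x \<in> insert b B1 then n x else 0)"
      have bB: "insert b B1 \<subseteq> B" using b B1B by (auto simp: C_def)
      have "finprod H (\<lambda>x. f x [^]\<^bsub>H\<^esub> m x) B = finprod H (\<lambda>x. f x [^]\<^bsub>H\<^esub> n x) (insert b B1)"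
        by (rule H.finprod_mono_neutral_cong_right) (use finB bB BG in \<open>auto simp: m_def\<close>)
      moreover have "n b \<noteq> 0"
      proof
        assume 0: "n b = 0"
        have "finprod H (\<lambda>x. f x [^]\<^bsub>H\<^esub> n x) (insert b B1) = finprod H (\<lambda>x. f x [^]\<^bsub>H\<^esub> n x) B1"
          by (rule H.finprod_mono_neutral_cong_right) (use finB1 bB BG 0 b in \<open>auto simp: C_def\<close>)
        then have "\<forall>i\<in>B1. n i = 0" using n indB1 by (auto simp: ind_fam_def)
        then show False using n(2) 0 by auto
      qed
      ultimately show ?thesis using n(1) by (intro exI[of _ m]) (auto simp: m_def)
    qed
    then obtain n :: "'a \<Rightarrow> 'a \<Rightarrow> int" where n0: "\<And>b x. b \<in> C \<Longrightarrow> x \<notin> insert b B1 \<Longrightarrow> n b x = 0"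
      and nb: "\<And>b. b \<in> C \<Longrightarrow> n b b \<noteq> 0"
      and n1: "\<And>b. b \<in> C \<Longrightarrow> finprod H (\<lambda>x. f x [^]\<^bsub>H\<^esub> n b x) B = \<one>\<^bsub>H\<^esub>"
      by metis
    define k where "k = (\<lambda>b. finprod G (\<lambda>x. x [^]\<^bsub>G\<^esub> n b x) B)"
    have kS: "k b \<in> S" for b unfolding k_def
      using B(2) G.subgroup_int_pow_closed[OF assms(4)] by (intro finprod_S finB) auto
    have kker: "k b \<in> kernel G H f" if "b \<in> C" for b
    proof -
      have "f (k b) = finprod H (\<lambda>x. f (x [^]\<^bsub>G\<^esub> n b x)) B" unfolding k_def
        using BG by (intro group_hom_finprod assms finB) auto
      also have "\<dots> = finprod H (\<lambda>x. f x [^]\<^bsub>H\<^esub> n b x) B"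
        using BG by (intro H.finprod_cong') (auto simp: fpow)
      finally show ?thesis using n1[OF that] kS S.subset by (auto simp: kernel_def)
    qed
    have finC: "finite C" using finB by (auto simp: C_def)
    have "ind_fam G C k"
      unfolding ind_fam_def
    proof (intro conjI allI impI finC)
      show "k \<in> C \<rightarrow> carrier G" using kS S.subset by auto
      fix m :: "'a \<Rightarrow> int" assume m: "finprod G (\<lambda>b. k b [^]\<^bsub>G\<^esub> m b) C = \<one>\<^bsub>G\<^esub>"
      have "k b [^]\<^bsub>G\<^esub> m b = finprod G (\<lambda>x. x [^]\<^bsub>G\<^esub> (n b x * m b)) B" for b
        unfolding k_def using BG
        by (subst G.finprod_int_pow) (auto simp: finB G.int_pow_pow intro!: G.finprod_cong')
      then have "finprod G (\<lambda>x. x [^]\<^bsub>G\<^esub> (\<Sum>b\<in>C. n b x * m b)) B = \<one>\<^bsub>G\<^esub>"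
        using m G.finprod_int_pow_sum[OF finC finB, of "\<lambda>x. x" "\<lambda>b x. n b x * m b"] BG
        by (simp add: Pi_iff subset_iff)
      then have 0: "(\<Sum>b\<in>C. n b x * m b) = 0" if "x \<in> B" for x
        using B(1) that by (auto simp: int_independent_def)
      show "\<forall>b\<in>C. m b = 0"
      proof
        fix x assume x: "x \<in> C"
        \<comment> \<open>Among the relations indexed by \<open>C\<close>, only the one belonging to
          \<open>x\<close> involves \<open>x\<close>, so the system for \<open>m\<close> is diagonal
          with nonzero entries \<open>n x x\<close>.\<close>
        have "(\<Sum>b\<in>C. n b x * m b) = (\<Sum>b\<in>{x}. n b x * m b)"
          by (rule sum.mono_neutral_right) (use x finC n0 in \<open>auto simp: C_def\<close>)
        then show "m x = 0" using 0[of x] x nb by (auto simp: C_def)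
      qed
    qed
    then have 1: "enat (card C) \<le> grank G (S \<inter> kernel G H f)"
      using kS kker by (intro G.grank_ge[of C k]) auto
    have 2: "enat (card B1) \<le> grank H (f ` S)"
      using indB1 B1B B(2) by (intro H.grank_ge[of B1 f]) auto
    have "card B = card C + card B1"
      using finB B1B finB1 by (simp add: C_def card_Diff_subset card_mono)
    then show "enat (card B) \<le> grank G (S \<inter> kernel G H f) + grank H (f ` S)"
      using add_mono[OF 1 2] by simp
  qed
  show "grank G (S \<inter> kernel G H f) + grank H (f ` S) \<le> grank G S"
  proof (rule enat_add_leI)
    fix p q assume "enat p \<le> grank G (S \<inter> kernel G H f)" "enat q \<le> grank H (f ` S)"
    then obtain A B where A: "int_independent G A" "A \<subseteq> S \<inter> kernel G H f" "card A = p"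
      and B: "int_independent H B" "B \<subseteq> f ` S" "card B = q"
      using G.enat_le_grank_iff H.enat_le_grank_iff by metis
    have fin: "finite A" "finite B" using A B by (auto simp: int_independent_def)
    obtain s where s: "\<And>y. y \<in> B \<Longrightarrow> s y \<in> S \<and> f (s y) = y"
      using B(2) inv_into_into[of _ f S] f_inv_into_f[of _ f S] that[of "inv_into S f"] by blast
    \<comment> \<open>The disjoint sum keeps the two families apart before it is known that no lift
      lies in \<open>A\<close>.\<close>
    define v where "v = case_sum (\<lambda>x. x) s"
    have vS: "v ` (A <+> B) \<subseteq> S" using A s by (auto simp: v_def)
    have AG: "A \<subseteq> carrier G" and sG: "\<And>y. y \<in> B \<Longrightarrow> s y \<in> carrier G" and BH: "B \<subseteq> carrier H"
      using A B s S.subset by (auto simp: int_independent_def)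
    have "ind_fam G (A <+> B) v"
      unfolding ind_fam_def
    proof (intro conjI allI impI)
      show "finite (A <+> B)" using fin by simp
      show "v \<in> A <+> B \<rightarrow> carrier G" using vS S.subset by auto
      fix n :: "'a + 'c \<Rightarrow> int" assume n: "finprod G (\<lambda>i. v i [^]\<^bsub>G\<^esub> n i) (A <+> B) = \<one>\<^bsub>G\<^esub>"
      define a where "a = finprod G (\<lambda>x. x [^]\<^bsub>G\<^esub> n (Inl x)) A"
      define b where "b = finprod G (\<lambda>y. s y [^]\<^bsub>G\<^esub> n (Inr y)) B"
      have aG: "a \<in> carrier G" "b \<in> carrier G" unfolding a_def b_def using AG sG by (intro G.finprod_closed; force)+
      have "finprod G (\<lambda>i. v i [^]\<^bsub>G\<^esub> n i) (A <+> B)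
         = finprod G (\<lambda>i. v i [^]\<^bsub>G\<^esub> n i) (Inl ` A) \<otimes>\<^bsub>G\<^esub> finprod G (\<lambda>i. v i [^]\<^bsub>G\<^esub> n i) (Inr ` B)"
        unfolding Plus_def using fin AG sG
        by (intro G.finprod_Un_disjoint) (auto simp: v_def)
      also have "\<dots> = a \<otimes>\<^bsub>G\<^esub> b"
        using AG sG by (subst (1 2) G.finprod_reindex) (auto simp: v_def a_def b_def inj_on_def)
      finally have ab: "a \<otimes>\<^bsub>G\<^esub> b = \<one>\<^bsub>G\<^esub>" using n by simp
      \<comment> \<open>The part indexed by \<open>A\<close> lies in the kernel, so the image of the
        relation is a relation among the elements of \<open>B\<close> alone.\<close>
      have "f a = finprod H (\<lambda>x. f (x [^]\<^bsub>G\<^esub> n (Inl x))) A"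
        unfolding a_def using AG fin by (intro group_hom_finprod assms) auto
      also have "\<dots> = \<one>\<^bsub>H\<^esub>"
        using A(2) by (intro H.finprod_one_eqI) (auto simp: fpow kernel_def)
      finally have "f b = \<one>\<^bsub>H\<^esub>" using ab aG f.hom_mult[of a b] f.hom_one by simp
      moreover have "f b = finprod H (\<lambda>y. f (s y [^]\<^bsub>G\<^esub> n (Inr y))) B"
        unfolding b_def using sG fin by (intro group_hom_finprod assms) auto
      moreover have "\<dots> = finprod H (\<lambda>y. y [^]\<^bsub>H\<^esub> n (Inr y)) B"
        using BH s sG by (intro H.finprod_cong') (auto simp: fpow)
      ultimately have nB: "\<forall>y\<in>B. n (Inr y) = 0"
        using B(1) unfolding int_independent_def by (auto dest: spec[of _ "\<lambda>y. n (Inr y)"])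
      have "b = \<one>\<^bsub>G\<^esub>" unfolding b_def
        using nB by (intro G.finprod_one_eqI) auto
      then have "a = \<one>\<^bsub>G\<^esub>" using ab aG by simp
      then have "\<forall>x\<in>A. n (Inl x) = 0"
        using A(1) unfolding int_independent_def a_def by (auto dest: spec[of _ "\<lambda>x. n (Inl x)"])
      then show "\<forall>i\<in>A <+> B. n i = 0" using nB by auto
    qed
    from G.grank_ge[OF this vS] show "enat (p + q) \<le> grank G S"
      using A B fin by (simp add: card_Plus)
  qed
qed

lemma grank_iso:
  assumes "comm_group G" "comm_group H" "G \<cong> H"
  shows "grank G (carrier G) = grank H (carrier H)"
proof -
  interpret G: comm_group G by fact
  interpret H: comm_group H by fact
  obtain f where f: "f \<in> iso G H" using assms(3) by (auto simp: is_iso_def)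
  then have hom: "f \<in> hom G H" and bij: "bij_betw f (carrier G) (carrier H)" by (auto simp: iso_def)
  interpret f: group_hom G H f by unfold_locales fact
  have "kernel G H f = {\<one>\<^bsub>G\<^esub>}"
    using f.inj_iff_trivial_ker bij by (auto simp: bij_betw_def)
  then have "grank G (carrier G) = grank G {\<one>\<^bsub>G\<^esub>} + grank H (carrier H)"
    using grank_hom[OF assms(1,2) hom G.subgroup_self] bij
    by (simp add: bij_betw_imp_surj_on)
  then show ?thesis by simp
qed

lemma grank_image_le:
  assumes "comm_group G" "comm_group H" "f \<in> hom G H" "subgroup S G"
  shows "grank H (f ` S) \<le> grank G S"
  using grank_hom[OF assms] by simp

lemma grank_exact:
  assumes "comm_group G" "comm_group H" "g \<in> hom G H" "kernel G H g = A"
  shows "grank G (carrier G) = grank G A + grank H (g ` carrier G)"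
proof -
  have "kernel G H g \<subseteq> carrier G" by (auto simp: kernel_def)
  then show ?thesis
    using grank_hom[OF assms(1-3) group.subgroup_self] assms(1,4)
    by (simp add: comm_group_def Int_absorb1)
qed

lemma grank_trivial: "comm_group G \<Longrightarrow> trivial_group G \<Longrightarrow> grank G (carrier G) = 0"
  by (simp add: trivial_group_def comm_group.grank_one)

text \<open>A finiteness chase. The image of \<open>f\<close> may have infinite rank in
  \<open>B2\<close>, but only what \<open>c\<close> and \<open>g\<close> see of it matters: in the
  product of \<open>C2\<close> and \<open>B3\<close>, its image under the pair of these maps has
  finite rank, because the first coordinates do by assumption and the pairs with trivial first
  coordinate come from \<open>A\<close>. The second projection then gives the claim.\<close>

lemma grank_image_comp_finite:
  assumes "comm_group B1" "comm_group B2" "comm_group B3" "comm_group C2"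
    and f: "f \<in> hom B1 B2" and g: "g \<in> hom B2 B3" and c: "c \<in> hom B2 C2"
    and ker: "kernel B2 C2 c = A"
    and 1: "grank C2 ((c \<circ> f) ` carrier B1) \<noteq> \<infinity>" and 2: "grank B3 (g ` A) \<noteq> \<infinity>"
  shows "grank B3 ((g \<circ> f) ` carrier B1) \<noteq> \<infinity>"
proof -
  interpret B1: comm_group B1 by fact
  interpret B2: comm_group B2 by fact
  interpret B3: comm_group B3 by fact
  interpret C2: comm_group C2 by fact
  interpret f: group_hom B1 B2 f by unfold_locales fact
  interpret g: group_hom B2 B3 g by unfold_locales fact
  interpret c: group_hom B2 C2 c by unfold_locales fact
  let ?S = "f ` carrier B1"
  have S: "subgroup ?S B2" by (rule f.img_is_subgroup)
  let ?T = "?S \<inter> kernel B2 C2 c"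
  let ?P = "C2 \<times>\<times> B3"
  interpret P: comm_group ?P
    by (rule group.group_comm_groupI[OF DirProd_group])
      (auto simp: C2.group_axioms B3.group_axioms C2.m_comm B3.m_comm)
  define k where "k = (\<lambda>x. (c x, g x))"
  have k: "k \<in> hom B2 ?P" using f g c by (auto simp: k_def hom_def DirProd_def)
  interpret k: group_hom B2 ?P k by unfold_locales fact
  have fstP: "fst \<in> hom ?P C2" and sndP: "snd \<in> hom ?P B3"
    by (auto simp: hom_def DirProd_def)
  have inP: "(\<lambda>y. (\<one>\<^bsub>C2\<^esub>, y)) \<in> hom B3 ?P" by (auto simp: hom_def DirProd_def)
  have S: "subgroup ?S B2" by (rule f.img_is_subgroup)
  have M: "subgroup (k ` ?S) ?P" by (rule k.subgroup_img_is_subgroup[OF S])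
  have SK: "subgroup ?T B2" using S c.subgroup_kernel B2.subgroups_Inter_pair by blast
  have gT: "subgroup (g ` ?T) B3" by (rule g.subgroup_img_is_subgroup[OF SK])
  have "grank ?P (k ` ?S \<inter> kernel ?P C2 fst) \<le> grank ?P ((\<lambda>y. (\<one>\<^bsub>C2\<^esub>, y)) ` g ` ?T)"
    by (rule P.grank_mono) (auto simp: k_def kernel_def)
  also have "\<dots> \<le> grank B3 (g ` ?T)"
    by (rule grank_image_le) (use inP gT assms P.comm_group_axioms in auto)
  also have "\<dots> \<le> grank B3 (g ` A)" using ker by (intro B3.grank_mono) auto
  finally have fin1: "grank ?P (k ` ?S \<inter> kernel ?P C2 fst) < \<infinity>"
    using 2 by (metis (no_types) enat_ord_simps(4) le_less_trans)
  have "fst ` k ` ?S = (c \<circ> f) ` carrier B1" by (auto simp: k_def image_image)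
  then have "grank ?P (k ` ?S) = grank ?P (k ` ?S \<inter> kernel ?P C2 fst) + grank C2 ((c \<circ> f) ` carrier B1)"
    using grank_hom[OF P.comm_group_axioms \<open>comm_group C2\<close> fstP M] by (simp only:)
  then have "grank ?P (k ` ?S) \<noteq> \<infinity>"
    using fin1 1 by (metis less_irrefl plus_eq_infty_iff_enat)
  moreover have "snd ` k ` ?S = (g \<circ> f) ` carrier B1" by (auto simp: k_def image_image)
  ultimately show ?thesis
    using grank_image_le[OF P.comm_group_axioms \<open>comm_group B3\<close> sndP M]
    by (metis (no_types) enat_ord_simps(4) le_less_trans)
qed

section \<open>Ranks of homology groups\<close>

definition hrank :: "int \<Rightarrow> 'a topology \<Rightarrow> 'a set \<Rightarrow> enat" where
  "hrank p X S = grank (relative_homology_group p X S) (carrier (relative_homology_group p X S))"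

lemma hrank_iso:
  assumes "relative_homology_group p X S \<cong> relative_homology_group q Y T"
  shows "hrank p X S = hrank q Y T"
  unfolding hrank_def by (rule grank_iso) (use assms in auto)

lemma hrank_trivial: "trivial_group (relative_homology_group p X S) \<Longrightarrow> hrank p X S = 0"
  unfolding hrank_def by (rule grank_trivial) auto

lemma hrank_neg: "p < 0 \<Longrightarrow> hrank p X S = 0"
  by (rule hrank_trivial) auto

lemma hrank_empty: "topspace X = {} \<Longrightarrow> hrank p X S = 0"
  by (rule hrank_trivial) (rule trivial_relative_homology_group_empty)

lemma hrank_homotopy_equivalent: "X homotopy_equivalent_space Y \<Longrightarrow> hrank p X {} = hrank p Y {}"
  by (rule hrank_iso) (rule homotopy_equivalent_space_imp_isomorphic_homology_groups)

lemma hrank_homeomorphic: "X homeomorphic_space Y \<Longrightarrow> hrank p X {} = hrank p Y {}"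
  by (rule hrank_iso) (rule homeomorphic_space_imp_isomorphic_homology_groups)

lemma hrank_homeomorphic_map:
  assumes "homeomorphic_map X Y f" "S \<subseteq> topspace X"
  shows "hrank p X S = hrank p Y (f ` S)"
  using homeomorphic_map_relative_homology_iso[OF assms refl, of p] by (intro hrank_iso is_isoI)

lemma grank_integer_group: "grank integer_group UNIV = 1"
proof (rule antisym)
  interpret comm_group integer_group by (rule abelian_integer_group)
  have fp: "finprod integer_group v A = sum v A" if "finite A" for v :: "'b \<Rightarrow> int" and A
    using that by (induction A rule: finite_induct) auto
  show "grank integer_group UNIV \<le> 1"
  proof (rule grank_le)
    fix B assume B: "int_independent integer_group B"
    then have "finite B" by (auto simp: int_independent_def)
    have "card B \<le> 1"
    proof (rule ccontr)
      assume "\<not> card B \<le> 1"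
      then have "1 < card B" by simp
      then obtain a b where ab: "a \<in> B" "b \<in> B" "a \<noteq> b"
        using \<open>finite B\<close> by (metis One_nat_def card_1_singleton_iff card_le_Suc0_iff_eq leD)
      \<comment> \<open>The relation \<open>b * a - a * b = 0\<close> holds between any two
        integers; one of its coefficients is nonzero because \<open>a\<close> and \<open>b\<close>
        differ.\<close>
      define n where "n = (\<lambda>x. if x = a then b else if x = b then -a else 0)"
      have "(\<Sum>g\<in>B. n g * g) = (\<Sum>g\<in>{a,b}. n g * g)"
        by (rule sum.mono_neutral_right) (use \<open>finite B\<close> ab in \<open>auto simp: n_def\<close>)
      also have "\<dots> = 0" using ab by (simp add: n_def)
      finally have "\<forall>g\<in>B. n g = 0"
        using B \<open>finite B\<close> by (auto simp: int_independent_def fp)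
      then show False using ab by (auto simp: n_def split: if_splits)
    qed
    then show "enat (card B) \<le> 1" by (simp add: one_enat_def)
  qed
  have "int_independent integer_group {1}" by (auto simp: int_independent_def fp)
  then have "enat (card {1::int}) \<le> grank integer_group UNIV"
    unfolding enat_le_grank_iff by blast
  then show "1 \<le> grank integer_group UNIV" by (simp add: one_enat_def)
qed

lemma hrank_0_path_connected:
  assumes "path_connected_space X" "topspace X \<noteq> {}"
  shows "hrank 0 X {} = 1"
  unfolding hrank_def using grank_iso[OF abelian_homology_group abelian_integer_group isomorphic_integer_zeroth_homology_group[OF assms]]
  by (simp add: grank_integer_group)

lemma hrank_contractible:
  assumes "contractible_space X"
  shows "hrank p X {} = (if p = 0 \<and> topspace X \<noteq> {} then 1 else 0)"
proof (cases "p = 0 \<and> topspace X \<noteq> {}")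
  case True
  then show ?thesis using hrank_0_path_connected contractible_imp_path_connected_space assms by auto
next
  case False
  show ?thesis
  proof (cases "topspace X = {}")
    case True then show ?thesis by (simp add: hrank_empty)
  next
    case False
    then have "trivial_group (homology_group p X)"
      using \<open>\<not> (p = 0 \<and> _)\<close> trivial_reduced_homology_group_contractible_space[OF assms, of p]
      by (simp add: un_reduced_homology_group)
    then show ?thesis using \<open>\<not> (p = 0 \<and> _)\<close> by (auto simp: hrank_trivial)
  qed
qed

lemma subtopology_subset: "T \<subseteq> S \<Longrightarrow> subtopology (subtopology X S) T = subtopology X T"
  by (simp add: subtopology_subtopology Int_absorb1)

text \<open>The excised set is \<open>topspace X - W\<close>: it is closed, and contained in the
  open set \<open>U\<close> because the two sets cover the space.\<close>

lemma excision_open: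
  assumes "openin X U" "openin X W" "U \<union> W = topspace X"
  shows "hom_induced p (subtopology X W) (U \<inter> W) X U id
    \<in> iso (relative_homology_group p (subtopology X W) (U \<inter> W)) (relative_homology_group p X U)"
proof -
  have UW: "U \<subseteq> topspace X" "W \<subseteq> topspace X" using assms openin_subset by auto
  have "closedin X (topspace X - W)" using assms by auto
  then have "X closure_of (topspace X - W) \<subseteq> X interior_of U"
    using assms UW by (auto simp: closure_of_closedin interior_of_openin)
  from homology_excision_axiom[OF this UW(1), of p]
  have "hom_induced p (subtopology X (topspace X - (topspace X - W))) (U - (topspace X - W))
      (subtopology X (topspace X)) U id
    \<in> iso (relative_homology_group p (subtopology X (topspace X - (topspace X - W))) (U - (topspace X - W)))
          (relative_homology_group p (subtopology X (topspace X)) U)" .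
  moreover have "topspace X - (topspace X - W) = W" "U - (topspace X - W) = U \<inter> W"
    using UW by auto
  ultimately show ?thesis by simp
qed

lemma hrank_excision:
  assumes "closedin X K" "openin X W" "K \<subseteq> W"
  shows "hrank p X (topspace X - K) = hrank p (subtopology X W) (W - K)"
proof -
  have W: "W \<subseteq> topspace X" using assms openin_subset by auto
  have "hrank p (subtopology X W) ((topspace X - K) \<inter> W) = hrank p X (topspace X - K)"
    by (rule hrank_iso, rule is_isoI, rule excision_open) (use assms W in auto)
  moreover have "(topspace X - K) \<inter> W = W - K" using W by auto
  ultimately show ?thesis by simp
qed

section \<open>Exact sequences and the Euler characteristic of pairs\<close>

lemma enat_add_not_infinity: "(a + b :: enat) \<noteq> \<infinity> \<longleftrightarrow> a \<noteq> \<infinity> \<and> b \<noteq> \<infinity>"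
  by (simp only: plus_eq_infty_iff_enat de_Morgan_disj)

text \<open>Here \<open>i p\<close>, \<open>j p\<close> and \<open>k p\<close> are the ranks of the
  images of the three maps H_p(S) -> H_p(X) -> H_p(X,S) -> H_(p-1)(S). By exactness each image is
  the kernel of the next map, so rank-nullity splits every term into two neighbours.\<close>

lemma long_exact_ranks:
  fixes X :: "'a topology" and S :: "'a set"
  obtains i j k :: "int \<Rightarrow> enat" where
    "\<And>p. hrank p X {} = i p + j p" "\<And>p. hrank p X S = j p + k p"
    "\<And>p. hrank p (subtopology X S) {} = k (p + 1) + i p"
proof -
  define i where "i = (\<lambda>p. grank (homology_group p X)
      (hom_induced p (subtopology X S) {} X {} id ` carrier (homology_group p (subtopology X S))))"
  define j where "j = (\<lambda>p. grank (relative_homology_group p X S)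
      (hom_induced p X {} X S id ` carrier (homology_group p X)))"
  define k where "k = (\<lambda>p. grank (homology_group (p - 1) (subtopology X S))
      (hom_boundary p X S ` carrier (relative_homology_group p X S)))"
  show ?thesis
  proof
    fix p
    show "hrank p X {} = i p + j p"
      unfolding hrank_def i_def j_def
      by (rule grank_exact) (use homology_exactness_axiom_3[of p X S] in \<open>auto simp: hom_induced_hom\<close>)
    show "hrank p X S = j p + k p"
      unfolding hrank_def k_def j_def
      by (rule grank_exact) (use homology_exactness_axiom_1[of p X S] in \<open>auto simp: hom_boundary_hom\<close>)
    show "hrank p (subtopology X S) {} = k (p + 1) + i p"
      unfolding hrank_def k_def i_def
      by (simp, rule grank_exact) (use homology_exactness_axiom_2[of "p + 1" X S] in \<open>auto simp: hom_induced_hom\<close>)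
  qed
qed

definition fin_hom :: "'a topology \<Rightarrow> 'a set \<Rightarrow> bool" where
  "fin_hom X S \<longleftrightarrow> hrank 0 X S \<noteq> \<infinity> \<and> hrank 1 X S \<noteq> \<infinity> \<and> hrank 2 X S \<noteq> \<infinity>"

text \<open>Meaningful only together with \<open>fin_hom\<close>, since \<open>the_enat\<close> is
  unspecified at infinity.\<close>

definition echar :: "'a topology \<Rightarrow> 'a set \<Rightarrow> int" where
  "echar X S = int (the_enat (hrank 0 X S)) - int (the_enat (hrank 1 X S)) + int (the_enat (hrank 2 X S))"

lemma surface_euler_char_echar:
  assumes "fin_hom X {}"
  shows "surface_euler_char X = echar X {}"
proof -
  have "betti p X = the_enat (hrank (int p) X {})" if "hrank (int p) X {} \<noteq> \<infinity>" for p
    using that comm_group.abelian_rank_grank[OF abelian_homology_group[of "int p" X]]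
    unfolding betti_def hrank_def by force
  from this[of 0] this[of 1] this[of 2] assms
  show ?thesis
    by (simp add: surface_euler_char_def echar_def fin_hom_def numeral_2_eq_2)
qed

text \<open>The ranks of the images telescope in the alternating sum. Cutting it off at degree 2
  leaves over \<open>k 3\<close>, the rank of the boundary map out of degree 3, which the second
  hypothesis kills.\<close>

lemma long_exact_euler:
  assumes "fin_hom X S" "hrank 3 X S = 0"
  shows "fin_hom X {} \<longleftrightarrow> fin_hom (subtopology X S) {}"
    and "fin_hom X {} \<Longrightarrow> echar X {} = echar (subtopology X S) {} + echar X S"
proof -
  obtain i j k :: "int \<Rightarrow> enat" where
    ijk: "\<And>p. hrank p X {} = i p + j p" "\<And>p. hrank p X S = j p + k p"
    "\<And>p. hrank p (subtopology X S) {} = k (p + 1) + i p" by (rule long_exact_ranks[of X S]) blast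
  have k3: "k 3 = 0" using ijk(2)[of 3] assms by simp
  \<comment> \<open>At the other end of the sum the boundary map lands in degree -1.\<close>
  have k0: "k 0 = 0" using ijk(3)[of "-1"] hrank_neg[of "-1" "subtopology X S" "{}"] by simp
  have jk: "j p \<noteq> \<infinity> \<and> k p \<noteq> \<infinity>" if "p \<in> {0,1,2}" for p
    using assms(1) that unfolding fin_hom_def ijk(2) enat_add_not_infinity by blast
  have fin: "j 0 \<noteq> \<infinity>" "j 1 \<noteq> \<infinity>" "j 2 \<noteq> \<infinity>" "k 1 \<noteq> \<infinity>" "k 2 \<noteq> \<infinity>" using jk by auto
  have eq: "hrank 0 X {} = i 0 + j 0" "hrank 1 X {} = i 1 + j 1" "hrank 2 X {} = i 2 + j 2"
    "hrank 0 X S = j 0" "hrank 1 X S = j 1 + k 1" "hrank 2 X S = j 2 + k 2"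
    "hrank 0 (subtopology X S) {} = k 1 + i 0" "hrank 1 (subtopology X S) {} = k 2 + i 1"
    "hrank 2 (subtopology X S) {} = i 2"
    using ijk(1)[of 0] ijk(1)[of 1] ijk(1)[of 2] ijk(2)[of 0] ijk(2)[of 1] ijk(2)[of 2]
      ijk(3)[of 0] ijk(3)[of 1] ijk(3)[of 2] k0 k3 by auto
  have iff: "fin_hom X {} \<longleftrightarrow> i 0 \<noteq> \<infinity> \<and> i 1 \<noteq> \<infinity> \<and> i 2 \<noteq> \<infinity>"
    "fin_hom (subtopology X S) {} \<longleftrightarrow> i 0 \<noteq> \<infinity> \<and> i 1 \<noteq> \<infinity> \<and> i 2 \<noteq> \<infinity>"
    unfolding fin_hom_def eq plus_eq_infty_iff_enat using fin by auto
  then show "fin_hom X {} \<longleftrightarrow> fin_hom (subtopology X S) {}" by simp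
  assume "fin_hom X {}"
  then obtain i0 i1 i2 j0 j1 j2 k1 k2 where
    "i 0 = enat i0" "i 1 = enat i1" "i 2 = enat i2" "j 0 = enat j0" "j 1 = enat j1" "j 2 = enat j2"
    "k 1 = enat k1" "k 2 = enat k2"
    using iff fin by (metis enat.exhaust)
  then show "echar X {} = echar (subtopology X S) {} + echar X S"
    unfolding echar_def eq by simp
qed

text \<open>Supplies the hypotheses of \<open>long_exact_euler\<close>. Degree 3 of the pair lies
  between degree 3 of the space and degree 2 of the subspace, hence the two vanishing
  conditions.\<close>

lemma fin_hom_pair:
  assumes "fin_hom X {}" "fin_hom (subtopology X S) {}" "hrank 3 X {} = 0" "hrank 2 (subtopology X S) {} = 0"
  shows "fin_hom X S" "hrank 3 X S = 0"
proof -
  obtain i j k :: "int \<Rightarrow> enat" where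
    ijk: "\<And>p. hrank p X {} = i p + j p" "\<And>p. hrank p X S = j p + k p"
    "\<And>p. hrank p (subtopology X S) {} = k (p + 1) + i p" by (rule long_exact_ranks[of X S]) blast
  have j: "j p \<noteq> \<infinity>" if "p \<in> {0,1,2}" for p
    using assms(1) that unfolding fin_hom_def ijk(1) enat_add_not_infinity by blast
  have "k (0 + 1) \<noteq> \<infinity>" "k (1 + 1) \<noteq> \<infinity>"
    using assms(2) unfolding fin_hom_def ijk(3) enat_add_not_infinity by blast+
  then have k: "k 1 \<noteq> \<infinity>" "k 2 \<noteq> \<infinity>" by simp_all
  have k0: "k 0 = 0" using ijk(3)[of "-1"] hrank_neg[of "-1" "subtopology X S" "{}"] by simp
  show "fin_hom X S"
    unfolding fin_hom_def ijk(2) plus_eq_infty_iff_enat using j k k0 by simp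
  show "hrank 3 X S = 0"
    using ijk(1)[of 3] ijk(2)[of 3] ijk(3)[of 2] assms by simp
qed

section \<open>Euclidean spaces relative to the complement of a point or an arc\<close>

lemma homeomorphic_maps_real_Euclidean_space:
  "homeomorphic_maps euclideanreal (Euclidean_space 1) (\<lambda>t i. if i < 1 then t else 0) (\<lambda>x. x 0)"
  unfolding homeomorphic_maps_def
proof (intro conjI)
  show "continuous_map euclideanreal (Euclidean_space 1) (\<lambda>t i. if i < 1 then t else 0)"
    using continuous_map_componentwise_Euclidean_space[of euclideanreal 1 "\<lambda>t i. t"] by simp
  show "continuous_map (Euclidean_space 1) euclideanreal (\<lambda>x. x 0)"
    unfolding Euclidean_space_def by (intro continuous_map_from_subtopology continuous_map_product_projection) auto
  show "\<forall>y\<in>topspace (Euclidean_space 1). (\<lambda>i. if i < 1 then y 0 else 0) = y"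
  proof (intro ballI ext)
    fix y i assume "y \<in> topspace (Euclidean_space 1)"
    then show "(if i < 1 then y 0 else 0) = y i"
      by (cases "i < 1") (simp_all add: topspace_Euclidean_space)
  qed
qed simp

lemma homeomorphic_maps_plane_Euclidean_space:
  "homeomorphic_maps (euclidean :: (real \<times> real) topology) (Euclidean_space 2)
     (\<lambda>p i. if i < 2 then (if i = 0 then fst p else snd p) else 0) (\<lambda>x. (x 0, x 1))"
  unfolding homeomorphic_maps_def
proof (intro conjI)
  have "continuous_map (euclidean :: (real \<times> real) topology) euclideanreal (\<lambda>x. if i = 0 then fst x else snd x)" for i :: nat
    by (cases "i = 0") (auto simp: continuous_on_fst continuous_on_snd continuous_on_id)
  then show "continuous_map (euclidean :: (real \<times> real) topology) (Euclidean_space 2)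
      (\<lambda>p i. if i < 2 then (if i = 0 then fst p else snd p) else 0)"
    using continuous_map_componentwise_Euclidean_space[of "euclidean :: (real \<times> real) topology" 2 "\<lambda>p i. if i = 0 then fst p else snd p"]
    by blast
  have "continuous_map (Euclidean_space 2) euclideanreal (\<lambda>x. x i)" for i :: nat
    unfolding Euclidean_space_def by (intro continuous_map_from_subtopology continuous_map_product_projection) auto
  then have "continuous_map (Euclidean_space 2) (prod_topology euclideanreal euclideanreal) (\<lambda>x. (x 0, x 1))"
    unfolding continuous_map_paired by blast
  then show "continuous_map (Euclidean_space 2) euclidean (\<lambda>x. (x 0, x 1))"
    by (simp only: prod_topology_euclidean)
next
  show "\<forall>y\<in>topspace (Euclidean_space 2).
       (\<lambda>i. if i < 2 then if i = 0 then fst (y 0, y 1) else snd (y 0, y 1) else 0) = y"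
  proof (intro ballI ext)
    fix y :: "nat \<Rightarrow> real" and i :: nat assume y: "y \<in> topspace (Euclidean_space 2)"
    consider "i = 0" | "i = 1" | "i \<ge> 2" by linarith
    then show "(if i < 2 then if i = 0 then fst (y 0, y 1) else snd (y 0, y 1) else 0) = y i"
      by cases (use y in \<open>simp_all add: topspace_Euclidean_space\<close>)
  qed
qed simp

text \<open>The step lemma for Euclidean complements lowers dimension and degree together by
  \<open>n\<close>, ending in a one-point space. The point is first moved to the origin, which
  belongs to all the nested spaces \<open>Euclidean_space m\<close>.\<close>

lemma hrank_Euclidean_point:
  assumes "a \<in> topspace (Euclidean_space n)"
  shows "hrank p (Euclidean_space n) (topspace (Euclidean_space n) - {a}) = (if p = int n then 1 else 0)"
proof -
  let ?E = Euclidean_space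
  define z where "z = (\<lambda>i::nat. 0::real)"
  have top0: "topspace (?E 0) = {z}" by (auto simp: topspace_Euclidean_space z_def)
  have z: "z \<in> topspace (?E m)" for m by (auto simp: topspace_Euclidean_space z_def)
  have closed: "closedin (?E m) {b}" if "b \<in> topspace (?E m)" for b m
    using closedin_Hausdorff_singleton[OF Hausdorff_Euclidean_space that] .
  have "homeomorphic_maps (subtopology (?E n) {a}) (subtopology (?E n) {z}) (\<lambda>x. z) (\<lambda>x. a)"
    using assms z by (auto simp: homeomorphic_maps_def continuous_map_in_subtopology)
  then have hs: "subtopology (?E n) {a} homeomorphic_space subtopology (?E n) {z}"
    unfolding homeomorphic_space_def by blast
  have "hrank p (?E n) (topspace (?E n) - {a})
      = hrank p (?E n) (topspace (?E n) - {z})"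
    by (intro hrank_iso isomorphic_relative_homology_groups_Euclidean_complements closed assms z hs)
  also have "\<dots> = hrank (p - int n) (?E 0) (topspace (?E 0) - {z})"
    using hrank_iso[OF relative_homology_group_Euclidean_complement_step[OF closed[OF z[of 0]], of "p - int n" n]]
    by simp
  also have "\<dots> = hrank (p - int n) (?E 0) {}" by (simp add: top0)
  also have "\<dots> = (if p = int n then 1 else 0)"
    by (subst hrank_contractible) (auto simp: top0)
  finally show ?thesis .
qed

lemma abelian_reduced_homology_group: "comm_group (reduced_homology_group p X)"
  unfolding reduced_homology_group_def
  by (intro group.abelian_subgroup_generated) auto

text \<open>The arc \<open>S\<close> may be replaced by the segment \<open>T\<close> on the first
  axis, since only the homeomorphism type of the closed set matters. Lowering the dimension by one
  leaves an interval in the line, and there collapsing the interval to a point does not change the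
  complement up to homeomorphism.\<close>

lemma hrank_Euclidean_interval:
  assumes S: "closedin (Euclidean_space 2) S"
    and hom: "subtopology (Euclidean_space 2) S homeomorphic_space top_of_set {-1..1::real}"
  shows "hrank p (Euclidean_space 2) (topspace (Euclidean_space 2) - S) = (if p = 2 then 1 else 0)"
proof -
  let ?E = Euclidean_space
  let ?R = "\<lambda>T::real set. reduced_homology_group (p - 2) (top_of_set (- T))"
  let ?r = "\<lambda>T. grank (?R T) (carrier (?R T))"
  \<comment> \<open>The number 2 is a witness that the complement is nonempty, which the isomorphism
    for subsets of a contractible space requires.\<close>
  have red: "hrank (p - 1) euclideanreal (- T) = ?r T" if "2 \<notin> T" for T
  proof -
    have "topspace euclideanreal \<inter> - T \<noteq> {}" using that by auto
    then have iso: "relative_homology_group (p - 1) euclideanreal (- T) \<cong> reduced_homology_group (p - 1 - 1) (top_of_set (- T))"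
      by (rule isomorphic_group_relative_homology_of_contractible[OF contractible_space_euclideanreal])
    have "p - 1 - 1 = p - 2" by simp
    with grank_iso[OF abelian_relative_homology_group abelian_reduced_homology_group iso] show ?thesis
      unfolding hrank_def by (simp only:)
  qed
  let ?f = "\<lambda>t::real. \<lambda>i::nat. if i < 1 then t else 0"
  note hm = homeomorphic_maps_real_Euclidean_space
  have f: "homeomorphic_map euclideanreal (?E 1) ?f"
    using hm homeomorphic_map_maps by blast
  have injf: "inj ?f" and fim: "range ?f = topspace (?E 1)"
    using homeomorphic_imp_surjective_map[OF f] homeomorphic_imp_injective_map[OF f]
    by (simp_all only: topspace_euclidean)
  define T where "T = ?f ` {-1..1}"
  have T1: "closedin (?E 1) T" unfolding T_def
    using homeomorphic_map_closedness_eq[OF f, of "{-1..1}"] by simp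
  then have "closedin (?E 2) T"
    by (metis closedin_Euclidean_space_iff one_le_numeral order_trans subset_Euclidean_space)
  \<comment> \<open>The segment carries the same topology inside the line and inside the plane, both
    being cut out of one function space by vanishing coordinates.\<close>
  have sub12: "subtopology (?E 1) T = subtopology (?E 2) T"
  proof -
    have "T \<subseteq> {x. \<forall>i\<ge>1. x i = 0}" using closedin_subset[OF T1] by (simp add: topspace_Euclidean_space)
    then have "{x. \<forall>i\<ge>1. x i = 0} \<inter> T = {x. \<forall>i\<ge>2. x i = 0} \<inter> T" by auto
    then show ?thesis unfolding Euclidean_space_def subtopology_subtopology by (simp only:)
  qed
  have "homeomorphic_map (top_of_set {-1..1::real}) (subtopology (?E 1) T) ?f"
    by (rule homeomorphic_map_subtopologies[OF f])
      (use closedin_subset[OF T1] in \<open>simp add: T_def Int_absorb1\<close>)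
  then have "top_of_set {-1..1::real} homeomorphic_space subtopology (?E 2) T"
    unfolding sub12 using homeomorphic_map_imp_homeomorphic_space by blast
  then have "subtopology (?E 2) S homeomorphic_space subtopology (?E 2) T"
    using hom homeomorphic_space_trans by blast
  then have "hrank p (?E 2) (topspace (?E 2) - S)
      = hrank p (?E 2) (topspace (?E 2) - T)"
    by (intro hrank_iso isomorphic_relative_homology_groups_Euclidean_complements S
       \<open>closedin (?E 2) T\<close>)
  also have "\<dots> = hrank (p - 1) (?E 1) (topspace (?E 1) - T)"
    using hrank_iso[OF relative_homology_group_Euclidean_complement_step[OF T1, of "p - 1" 1]]
    by (simp add: numeral_2_eq_2)
  also have "topspace (?E 1) - T = ?f ` (- {-1..1})"
    unfolding T_def fim[symmetric] Compl_eq_Diff_UNIV by (rule image_set_diff[OF injf, symmetric])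
  also have "hrank (p - 1) (?E 1) (?f ` (- {-1..1})) = hrank (p - 1) euclideanreal (- {-1..1})"
    by (rule hrank_homeomorphic_map[OF f, symmetric]) auto
  also have "\<dots> = ?r {-1..1}" by (rule red) simp
  also have "\<dots> = ?r {0}"
  proof (intro grank_iso abelian_reduced_homology_group homeomorphic_space_imp_isomorphic_reduced_homology_groups)
    \<comment> \<open>Pushing both rays one unit towards 0 closes the gap to a single point.\<close>
    have "homeomorphic_maps (top_of_set (- {-1..1::real})) (top_of_set (- {0::real}))
      (\<lambda>x. x - sgn x) (\<lambda>x. x + sgn x)"
      unfolding homeomorphic_maps_def
    proof (intro conjI)
      show "continuous_map (top_of_set (- {-1..1::real})) (top_of_set (- {0::real})) (\<lambda>x. x - sgn x)"
        unfolding continuous_map_subtopology_eu by (intro conjI continuous_intros) (auto simp: sgn_if)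
      show "continuous_map (top_of_set (- {0::real})) (top_of_set (- {-1..1::real})) (\<lambda>x. x + sgn x)"
        unfolding continuous_map_subtopology_eu by (intro conjI continuous_intros) (auto simp: sgn_if)
    qed (auto simp: sgn_if)
    then show "top_of_set (- {-1..1::real}) homeomorphic_space top_of_set (- {0::real})"
      unfolding homeomorphic_space_def by blast
  qed
  also have "\<dots> = hrank (p - 1) euclideanreal (- {0})" by (rule red[symmetric]) simp
  also have "\<dots> = hrank (p - 1) (?E 1) (?f ` (- {0}))"
    by (rule hrank_homeomorphic_map[OF f]) auto
  also have "?f ` (- {0}) = topspace (?E 1) - {?f 0}"
    unfolding fim[symmetric] Compl_eq_Diff_UNIV image_set_diff[OF injf] by simp
  also have "hrank (p - 1) (?E 1) (topspace (?E 1) - {?f 0}) = (if p = 2 then 1 else 0)"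
    by (subst hrank_Euclidean_point) (auto simp: topspace_Euclidean_space)
  finally show ?thesis .
qed

section \<open>Finiteness of the homology of compact surfaces\<close>

lemma
  shows hrank_pair_finite: "hrank p X {} \<noteq> \<infinity> \<Longrightarrow> hrank (p - 1) (subtopology X S) {} \<noteq> \<infinity> \<Longrightarrow> hrank p X S \<noteq> \<infinity>"
    and hrank_total_finite: "hrank p (subtopology X S) {} \<noteq> \<infinity> \<Longrightarrow> hrank p X S \<noteq> \<infinity> \<Longrightarrow> hrank p X {} \<noteq> \<infinity>"
    and hrank_sub_zero: "hrank p X {} = 0 \<Longrightarrow> hrank (p + 1) X S = 0 \<Longrightarrow> hrank p (subtopology X S) {} = 0"
proof -
  obtain i j k :: "int \<Rightarrow> enat" where
    ijk: "\<And>p. hrank p X {} = i p + j p" "\<And>p. hrank p X S = j p + k p"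
    "\<And>p. hrank p (subtopology X S) {} = k (p + 1) + i p" by (rule long_exact_ranks[of X S]) blast
  have "hrank (p - 1) (subtopology X S) {} = k p + i (p - 1)" using ijk(3)[of "p - 1"] by simp
  then show "hrank p X {} \<noteq> \<infinity> \<Longrightarrow> hrank (p - 1) (subtopology X S) {} \<noteq> \<infinity> \<Longrightarrow> hrank p X S \<noteq> \<infinity>"
    unfolding ijk(1,2) by (simp only: enat_add_not_infinity simp_thms)
  show "hrank p (subtopology X S) {} \<noteq> \<infinity> \<Longrightarrow> hrank p X S \<noteq> \<infinity> \<Longrightarrow> hrank p X {} \<noteq> \<infinity>"
    unfolding ijk enat_add_not_infinity by blast
  show "hrank p X {} = 0 \<Longrightarrow> hrank (p + 1) X S = 0 \<Longrightarrow> hrank p (subtopology X S) {} = 0"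
    unfolding ijk by simp
qed

text \<open>Mayer-Vietoris in the form of excision: when \<open>C\<close> is added to the union of
  the others, the relative groups are those of \<open>C\<close> modulo its intersection with that
  union, which is again a union of open convex sets, and no more of them.\<close>

lemma hrank_finite_Union_convex:
  fixes F :: "'a::real_normed_vector set set"
  assumes "finite F" "\<And>C. C \<in> F \<Longrightarrow> open C \<and> convex C"
  shows "hrank p (top_of_set (\<Union>F)) {} \<noteq> \<infinity>"
proof -
  \<comment> \<open>The number of sets is only bounded, since distinct sets may have the same
    intersection with \<open>C\<close>. All degrees are treated at once because the pair in degree
    \<open>p\<close> involves its subspace in degree \<open>p - 1\<close>.\<close>
  have "\<forall>F p. finite F \<and> card F \<le> n \<and> (\<forall>C\<in>F. open C \<and> convex C) \<longrightarrow>
          hrank p (top_of_set (\<Union>F :: 'a set)) {} \<noteq> \<infinity>" for n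
  proof (induction n)
    case 0
    show ?case
    proof (intro allI impI)
      fix F :: "'a set set" and p assume "finite F \<and> card F \<le> 0 \<and> (\<forall>C\<in>F. open C \<and> convex C)"
      then have "F = {}" by auto
      then have "hrank p (top_of_set (\<Union>F)) {} = 0" by (intro hrank_empty) simp
      then show "hrank p (top_of_set (\<Union>F)) {} \<noteq> \<infinity>" by simp
    qed
  next
    case (Suc n)
    show ?case
    proof (intro allI impI)
      fix F :: "'a set set" and p
      assume F: "finite F \<and> card F \<le> Suc n \<and> (\<forall>C\<in>F. open C \<and> convex C)"
      show "hrank p (top_of_set (\<Union>F)) {} \<noteq> \<infinity>"
      proof (cases "F = {}")
        case True
        then have "hrank p (top_of_set (\<Union>F)) {} = 0" by (intro hrank_empty) simp
        then show ?thesis by simp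
      next
        case False
        then obtain C where C: "C \<in> F" by blast
        define D where "D = F - {C}"
        have D: "finite D" "card D \<le> n" "\<And>A. A \<in> D \<Longrightarrow> open A \<and> convex A"
          using F C by (auto simp: D_def)
        have FD: "\<Union>F = C \<union> \<Union>D" using C by (auto simp: D_def)
        have oC: "open C" "convex C" using F C by auto
        have oD: "open (\<Union>D)" using D by auto
        have 1: "hrank p (top_of_set (\<Union>D)) {} \<noteq> \<infinity>" for p
          using Suc.IH D by blast
        have 2: "hrank p (top_of_set (C \<inter> \<Union>D)) {} \<noteq> \<infinity>" for p
        proof -
          have "card ((\<inter>) C ` D) \<le> n" using card_image_le[OF D(1), of "(\<inter>) C"] D(2) by linarith
          moreover have "\<forall>A\<in>(\<inter>) C ` D. open A \<and> convex A" using D(3) oC by (auto intro: convex_Int)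
          moreover have "\<Union>((\<inter>) C ` D) = C \<inter> \<Union>D" by blast
          ultimately show ?thesis using Suc.IH D(1) by (metis finite_imageI)
        qed
        have 3: "hrank p (top_of_set C) {} \<noteq> \<infinity>" for p
        proof -
          have "contractible_space (top_of_set C)"
            using convex_imp_contractible[OF oC(2)] contractible_space_top_of_set by blast
          from hrank_contractible[OF this] show ?thesis
            by (metis i0_ne_infinity infinity_ne_i1)
        qed
        let ?X = "top_of_set (\<Union>F)"
        have iso: "hom_induced p (subtopology ?X C) (\<Union>D \<inter> C) ?X (\<Union>D) id
            \<in> iso (relative_homology_group p (subtopology ?X C) (\<Union>D \<inter> C)) (relative_homology_group p ?X (\<Union>D))"
          by (rule excision_open) (use oC oD FD in \<open>auto simp: openin_open_eq open_Un\<close>)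
        have sub: "subtopology ?X C = top_of_set C" "subtopology ?X (\<Union>D) = top_of_set (\<Union>D)"
          by (simp_all add: subtopology_subtopology FD Int_absorb1)
        have "hrank p (top_of_set C) (\<Union>D \<inter> C) = hrank p ?X (\<Union>D)"
          using hrank_iso[OF is_isoI[OF iso]] sub by simp
        moreover have "hrank p (top_of_set C) (\<Union>D \<inter> C) \<noteq> \<infinity>"
        proof (rule hrank_pair_finite[OF 3])
          have "subtopology (top_of_set C) (\<Union>D \<inter> C) = top_of_set (C \<inter> \<Union>D)"
            by (simp add: subtopology_subtopology Int_commute Int_left_commute)
          then show "hrank (p - 1) (subtopology (top_of_set C) (\<Union>D \<inter> C)) {} \<noteq> \<infinity>"
            using 2 by metis
        qed
        ultimately have "hrank p ?X (\<Union>D) \<noteq> \<infinity>" by metis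
        moreover have "hrank p (subtopology ?X (\<Union>D)) {} \<noteq> \<infinity>" using 1 sub(2) by metis
        ultimately show ?thesis by (rule hrank_total_finite[rotated])
      qed
    qed
  qed
  then show ?thesis using assms by blast
qed

section \<open>Maps induced by inclusions\<close>

abbreviation rel_homology :: "int \<Rightarrow> 'a topology \<Rightarrow> 'a set \<Rightarrow> 'a set \<Rightarrow> 'a chain set monoid" where
  "rel_homology p X U S \<equiv> relative_homology_group p (subtopology X U) S"

definition incl :: "int \<Rightarrow> 'a topology \<Rightarrow> 'a set \<Rightarrow> 'a set \<Rightarrow> 'a set \<Rightarrow> 'a set \<Rightarrow> 'a chain set \<Rightarrow> 'a chain set" where
  "incl p X U S V T = hom_induced p (subtopology X U) S (subtopology X V) T id"

abbreviation incl_image :: "int \<Rightarrow> 'a topology \<Rightarrow> 'a set \<Rightarrow> 'a set \<Rightarrow> 'a set \<Rightarrow> 'a set \<Rightarrow> 'a chain set set" where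
  "incl_image p X U S V T \<equiv> incl p X U S V T ` carrier (rel_homology p X U S)"

lemma incl_hom: "incl p X U S V T \<in> hom (rel_homology p X U S) (rel_homology p X V T)"
  unfolding incl_def by (rule hom_induced_hom)

lemma incl_comp:
  assumes "U \<subseteq> V" "V \<subseteq> W" "S \<subseteq> T" "T \<subseteq> R"
  shows "incl p X V T W R (incl p X U S V T c) = incl p X U S W R c"
proof -
  have "hom_induced p (subtopology X V) T (subtopology X W) R id (hom_induced p (subtopology X U) S (subtopology X V) T id c)
    = hom_induced p (subtopology X U) S (subtopology X W) R (id \<circ> id) c"
    by (rule hom_induced_compose') (use assms in \<open>auto intro: continuous_map_id_subt simp: continuous_map_in_subtopology\<close>)
  then show ?thesis by (simp add: incl_def)
qed

lemma incl_boundary: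
  assumes "U \<subseteq> V" "S \<subseteq> U" "T \<subseteq> V" "S \<subseteq> T"
  shows "hom_boundary p (subtopology X V) T (incl p X U S V T c)
      = incl (p - 1) X S {} T {} (hom_boundary p (subtopology X U) S c)"
proof -
  have "(hom_boundary p (subtopology X V) T \<circ> hom_induced p (subtopology X U) S (subtopology X V) T id) c
      = (hom_induced (p - 1) (subtopology (subtopology X U) S) {} (subtopology (subtopology X V) T) {} id
         \<circ> hom_boundary p (subtopology X U) S) c"
    by (subst naturality_hom_induced) (use assms in \<open>auto simp: continuous_map_in_subtopology\<close>)
  moreover have "subtopology (subtopology X U) S = subtopology X S" "subtopology (subtopology X V) T = subtopology X T"
    using assms by (simp_all add: subtopology_subtopology Int_absorb1)
  ultimately show ?thesis by (simp add: incl_def)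
qed

text \<open>An open subset of a compact surface, such as the complement of a Cantor set, may have
  homology of infinite rank. So finiteness is asked only of the classes that survive in a larger
  set.\<close>

definition fin_incl :: "'a topology \<Rightarrow> 'a set \<Rightarrow> 'a set \<Rightarrow> bool" where
  "fin_incl X U V \<longleftrightarrow> (\<forall>p. grank (rel_homology p X V {})
     (incl_image p X U {} V {}) \<noteq> \<infinity>)"

lemma grank_image_subset_finite:
  assumes "comm_group G" "B \<subseteq> C" "grank G C \<noteq> \<infinity>"
  shows "grank G B \<noteq> \<infinity>"
  using comm_group.grank_mono[OF assms(1,2)] assms(3) by (metis enat_ord_simps(5))

lemma grank_hom_image_finite:
  assumes "comm_group G" "comm_group H" "f \<in> hom G H" "subgroup S G" "grank G S \<noteq> \<infinity>"
  shows "grank H (f ` S) \<noteq> \<infinity>"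
  using grank_image_le[OF assms(1-4)] assms(5) by (metis enat_ord_simps(5))

lemma incl_image_subgroup:
  "subgroup (incl_image p X U S V T) (rel_homology p X V T)"
  using incl_hom[of p X U S V T]
  by (intro group_hom.img_is_subgroup) (simp add: group_hom_def group_hom_axioms_def)

lemma incl_carrier: "incl p X U S V T c \<in> carrier (rel_homology p X V T)"
  unfolding incl_def by (rule hom_induced_carrier)

text \<open>A homomorphism that factors through a group of finite rank has an image of finite
  rank.\<close>

lemma fin_incl_factor:
  assumes "U \<subseteq> Q" "Q \<subseteq> V" "\<And>p. hrank p (subtopology X Q) {} \<noteq> \<infinity>"
  shows "fin_incl X U V"
  unfolding fin_incl_def
proof
  fix p
  have fin: "grank (rel_homology p X V {}) (incl_image p X Q {} V {}) \<noteq> \<infinity>"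
    by (rule grank_hom_image_finite[OF abelian_homology_group abelian_homology_group incl_hom group.subgroup_self])
      (use assms(3) in \<open>simp_all only: hrank_def group_relative_homology_group not_False_eq_True\<close>)
  have "incl_image p X U {} V {}
     \<subseteq> incl_image p X Q {} V {}"
  proof
    fix y assume "y \<in> incl_image p X U {} V {}"
    then obtain c where "y = incl p X U {} V {} c" by blast
    then have "y = incl p X Q {} V {} (incl p X U {} Q {} c)" using assms by (simp add: incl_comp)
    then show "y \<in> incl_image p X Q {} V {}" using incl_carrier by blast
  qed
  from grank_image_subset_finite[OF abelian_homology_group this fin]
  show "grank (rel_homology p X V {}) (incl_image p X U {} V {}) \<noteq> \<infinity>" .
qed

lemma fin_incl_mono:
  assumes "fin_incl X U V" "U' \<subseteq> U" "U \<subseteq> V" "V \<subseteq> V'"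
  shows "fin_incl X U' V'"
  unfolding fin_incl_def
proof
  fix p
  let ?I = "incl_image p X U {} V {}"
  have fin: "grank (rel_homology p X V' {}) (incl p X V {} V' {} ` ?I) \<noteq> \<infinity>"
    by (rule grank_hom_image_finite[OF abelian_homology_group abelian_homology_group incl_hom incl_image_subgroup])
      (use assms(1) in \<open>simp add: fin_incl_def del: not_infinity_eq\<close>)
  have "incl_image p X U' {} V' {} \<subseteq> incl p X V {} V' {} ` ?I"
  proof
    fix y assume "y \<in> incl_image p X U' {} V' {}"
    then obtain c where "y = incl p X U' {} V' {} c" by blast
    then have "y = incl p X V {} V' {} (incl p X U {} V {} (incl p X U' {} U {} c))"
      using assms by (simp add: incl_comp)
    then show "y \<in> incl p X V {} V' {} ` ?I" using incl_carrier by blast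
  qed
  from grank_image_subset_finite[OF abelian_homology_group this fin]
  show "grank (rel_homology p X V' {}) (incl_image p X U' {} V' {}) \<noteq> \<infinity>" .
qed

lemma kernel_boundary:
  assumes "S \<subseteq> U"
  shows "kernel (rel_homology p X U S) (rel_homology (p - 1) X S {})
      (hom_boundary p (subtopology X U) S) = incl_image p X U {} U S"
proof -
  have "subtopology (subtopology X U) S = subtopology X S"
    using assms by (simp add: subtopology_subset)
  then show ?thesis using homology_exactness_axiom_1[of p "subtopology X U" S] by (simp add: incl_def)
qed

lemma kernel_relativization:
  assumes "S \<subseteq> U"
  shows "kernel (rel_homology p X U {}) (rel_homology p X U S)
      (incl p X U {} U S) = incl_image p X S {} U {}"
proof -
  have "subtopology (subtopology X U) S = subtopology X S"
    using assms by (simp add: subtopology_subset)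
  then show ?thesis using homology_exactness_axiom_3[of p "subtopology X U" S] by (simp add: incl_def)
qed

lemma boundary_hom:
  assumes "S \<subseteq> U"
  shows "hom_boundary p (subtopology X U) S \<in> hom (rel_homology p X U S) (rel_homology (p - 1) X S {})"
proof -
  have "subtopology (subtopology X U) S = subtopology X S"
    using assms by (simp add: subtopology_subset)
  then show ?thesis using hom_boundary_hom[of p "subtopology X U" S] by simp
qed

text \<open>A class from (\<open>B1\<close>, \<open>C1\<close>) is controlled by two absolute ones:
  its boundary, which comes from \<open>C1\<close> and so ranges over a group of finite rank in the
  homology of \<open>C2\<close>; and, if that boundary vanishes, a class of \<open>B2\<close>, which
  contributes finite rank in \<open>B3\<close>.\<close>

lemma fin_incl_relative:
  assumes sub: "B1 \<subseteq> B2" "B2 \<subseteq> B3" "C1 \<subseteq> C2" "C2 \<subseteq> C3" "C1 \<subseteq> B1" "C2 \<subseteq> B2" "C3 \<subseteq> B3"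
    and B: "fin_incl X B2 B3" and C: "fin_incl X C1 C2"
  shows "grank (rel_homology p X B3 C3)
     (incl_image p X B1 C1 B3 C3) \<noteq> \<infinity>"
proof -
  let ?R1 = "rel_homology p X B1 C1"
  let ?R2 = "rel_homology p X B2 C2"
  let ?R3 = "rel_homology p X B3 C3"
  let ?H = "rel_homology (p - 1) X C2 {}"
  let ?A = "incl_image p X B2 {} B2 C2"
  have "grank ?R3 ((incl p X B2 C2 B3 C3 \<circ> incl p X B1 C1 B2 C2) ` carrier ?R1) \<noteq> \<infinity>"
  proof (rule grank_image_comp_finite[OF _ _ _ _ incl_hom incl_hom boundary_hom[OF sub(6)] kernel_boundary[OF sub(6)]])
    show "grank ?H ((hom_boundary p (subtopology X B2) C2 \<circ> incl p X B1 C1 B2 C2) ` carrier ?R1) \<noteq> \<infinity>"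
    proof (rule grank_image_subset_finite[OF abelian_homology_group])
      show "grank ?H (incl_image (p - 1) X C1 {} C2 {}) \<noteq> \<infinity>"
        using C unfolding fin_incl_def by blast
      show "(hom_boundary p (subtopology X B2) C2 \<circ> incl p X B1 C1 B2 C2) ` carrier ?R1
         \<subseteq> incl_image (p - 1) X C1 {} C2 {}"
      proof
        fix y assume "y \<in> (hom_boundary p (subtopology X B2) C2 \<circ> incl p X B1 C1 B2 C2) ` carrier ?R1"
        then obtain c where c: "c \<in> carrier ?R1" "y = hom_boundary p (subtopology X B2) C2 (incl p X B1 C1 B2 C2 c)" by auto
        then have "y = incl (p - 1) X C1 {} C2 {} (hom_boundary p (subtopology X B1) C1 c)"
          using sub by (simp add: incl_boundary)
        then show "y \<in> incl_image (p - 1) X C1 {} C2 {}"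
          using boundary_hom[OF sub(5), of p X] c(1) by (auto simp: hom_def)
      qed
    qed
    let ?I = "incl_image p X B2 {} B3 {}"
    show "grank ?R3 (incl p X B2 C2 B3 C3 ` ?A) \<noteq> \<infinity>"
    proof (rule grank_image_subset_finite[OF abelian_relative_homology_group])
      show "grank ?R3 (incl p X B3 {} B3 C3 ` ?I) \<noteq> \<infinity>"
        by (rule grank_hom_image_finite[OF abelian_homology_group abelian_relative_homology_group incl_hom incl_image_subgroup])
          (use B in \<open>simp add: fin_incl_def del: not_infinity_eq\<close>)
      show "incl p X B2 C2 B3 C3 ` ?A \<subseteq> incl p X B3 {} B3 C3 ` ?I"
        using sub by (auto simp: incl_comp image_iff intro!: bexI)
    qed
  qed auto
  moreover have "(incl p X B2 C2 B3 C3 \<circ> incl p X B1 C1 B2 C2) ` carrier ?R1 = incl p X B1 C1 B3 C3 ` carrier ?R1"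
    using sub by (auto simp: incl_comp image_iff)
  ultimately show ?thesis by metis
qed

text \<open>Each of the two exact sequences involved costs enlargements, hence the four nested levels.\<close>

lemma fin_incl_Un:
  assumes op: "openin X A1" "openin X A2" "openin X A3" "openin X B1" "openin X B2" "openin X B3"
    and sub: "A1 \<subseteq> A2" "A2 \<subseteq> A3" "A3 \<subseteq> A4" "B1 \<subseteq> B2" "B2 \<subseteq> B3" "B3 \<subseteq> B4"
    and A: "fin_incl X A3 A4" and B: "fin_incl X B2 B3" and C: "fin_incl X (A1 \<inter> B1) (A2 \<inter> B2)"
  shows "fin_incl X (A1 \<union> B1) (A4 \<union> B4)"
  unfolding fin_incl_def
proof
  fix p
  let ?U1 = "A1 \<union> B1" and ?U3 = "A3 \<union> B3" and ?U4 = "A4 \<union> B4"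
  let ?H1 = "rel_homology p X ?U1 {}"
  let ?H3 = "rel_homology p X ?U3 {}"
  let ?H4 = "rel_homology p X ?U4 {}"
  let ?Q = "rel_homology p X ?U3 A3"
  let ?R1 = "rel_homology p X B1 (A1 \<inter> B1)"
  let ?R3 = "rel_homology p X B3 (A3 \<inter> B3)"
  let ?A = "incl_image p X A3 {} ?U3 {}"
  have sA: "A3 \<subseteq> ?U3" by blast
  \<comment> \<open>Excision: relative to \<open>A1\<close>, every class of the union comes from
    \<open>B1\<close>.\<close>
  have exc: "carrier (rel_homology p X ?U1 A1) \<subseteq> incl p X B1 (A1 \<inter> B1) ?U1 A1 ` carrier ?R1"
  proof -
    have ss: "subtopology (subtopology X ?U1) B1 = subtopology X B1"
      by (simp add: subtopology_subset)
    have "hom_induced p (subtopology (subtopology X ?U1) B1) (A1 \<inter> B1) (subtopology X ?U1) A1 id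
      \<in> iso (relative_homology_group p (subtopology (subtopology X ?U1) B1) (A1 \<inter> B1)) (rel_homology p X ?U1 A1)"
      by (rule excision_open) (use op openin_subset in \<open>auto simp: openin_open_subtopology openin_Un\<close>)
    then show ?thesis unfolding ss incl_def by (auto simp: iso_def bij_betw_def)
  qed
  \<comment> \<open>The map \<open>c\<close> of the chase makes classes relative to
    \<open>A3\<close>. What it kills comes from \<open>A3\<close> and has finite rank in
    \<open>A4\<close>; what it keeps comes from the pair on the side of \<open>B1\<close>.\<close>
  have "grank ?H4 ((incl p X ?U3 {} ?U4 {} \<circ> incl p X ?U1 {} ?U3 {}) ` carrier ?H1) \<noteq> \<infinity>"
  proof (rule grank_image_comp_finite[OF _ _ _ _ incl_hom incl_hom incl_hom kernel_relativization[OF sA]])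
    let ?I = "incl p X B1 (A1 \<inter> B1) B3 (A3 \<inter> B3) ` carrier ?R1"
    show "grank ?Q ((incl p X ?U3 {} ?U3 A3 \<circ> incl p X ?U1 {} ?U3 {}) ` carrier ?H1) \<noteq> \<infinity>"
    proof (rule grank_image_subset_finite[OF abelian_relative_homology_group])
      show "grank ?Q (incl p X B3 (A3 \<inter> B3) ?U3 A3 ` ?I) \<noteq> \<infinity>"
      proof (rule grank_hom_image_finite[OF abelian_relative_homology_group abelian_relative_homology_group incl_hom incl_image_subgroup])
        show "grank ?R3 ?I \<noteq> \<infinity>"
        proof (rule fin_incl_relative[where ?B2.0=B2 and ?C2.0="A2 \<inter> B2"])
          show "A1 \<inter> B1 \<subseteq> A2 \<inter> B2" "A2 \<inter> B2 \<subseteq> A3 \<inter> B3" using sub by blast+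
        qed (use sub B C in \<open>simp_all only: Int_lower2\<close>)
      qed
      show "(incl p X ?U3 {} ?U3 A3 \<circ> incl p X ?U1 {} ?U3 {}) ` carrier ?H1
          \<subseteq> incl p X B3 (A3 \<inter> B3) ?U3 A3 ` ?I"
      proof
        fix y assume "y \<in> (incl p X ?U3 {} ?U3 A3 \<circ> incl p X ?U1 {} ?U3 {}) ` carrier ?H1"
        then obtain c where "y = incl p X ?U3 {} ?U3 A3 (incl p X ?U1 {} ?U3 {} c)" by auto
        also have "\<dots> = incl p X ?U1 {} ?U3 A3 c"
          by (rule incl_comp) (use sub in auto)
        also have "\<dots> = incl p X ?U1 A1 ?U3 A3 (incl p X ?U1 {} ?U1 A1 c)"
          by (rule incl_comp[symmetric]) (use sub in auto)
        finally have y: "y = incl p X ?U1 A1 ?U3 A3 (incl p X ?U1 {} ?U1 A1 c)" .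
        obtain d where d: "d \<in> carrier ?R1" "incl p X ?U1 {} ?U1 A1 c = incl p X B1 (A1 \<inter> B1) ?U1 A1 d"
          using subsetD[OF exc incl_carrier[of p X "A1 \<union> B1" "{}" "A1 \<union> B1" A1 c]] by (elim imageE)
        have "y = incl p X B1 (A1 \<inter> B1) ?U3 A3 d"
          unfolding y d(2) by (rule incl_comp) (use sub in auto)
        also have "\<dots> = incl p X B3 (A3 \<inter> B3) ?U3 A3 (incl p X B1 (A1 \<inter> B1) B3 (A3 \<inter> B3) d)"
          by (rule incl_comp[symmetric]) (use sub in auto)
        finally show "y \<in> incl p X B3 (A3 \<inter> B3) ?U3 A3 ` ?I" using d(1) by blast
      qed
    qed
    let ?J = "incl_image p X A3 {} A4 {}"
    show "grank ?H4 (incl p X ?U3 {} ?U4 {} ` ?A) \<noteq> \<infinity>"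
    proof (rule grank_image_subset_finite[OF abelian_homology_group])
      show "grank ?H4 (incl p X A4 {} ?U4 {} ` ?J) \<noteq> \<infinity>"
        by (rule grank_hom_image_finite[OF abelian_homology_group abelian_homology_group incl_hom incl_image_subgroup])
          (use A in \<open>simp add: fin_incl_def del: not_infinity_eq\<close>)
      show "incl p X ?U3 {} ?U4 {} ` ?A \<subseteq> incl p X A4 {} ?U4 {} ` ?J"
      proof
        fix y assume "y \<in> incl p X ?U3 {} ?U4 {} ` ?A"
        then obtain c where c: "c \<in> carrier (rel_homology p X A3 {})"
          "y = incl p X ?U3 {} ?U4 {} (incl p X A3 {} ?U3 {} c)" by auto
        have "y = incl p X A3 {} ?U4 {} c"
          unfolding c(2) by (rule incl_comp) (use sub in auto)
        also have "\<dots> = incl p X A4 {} ?U4 {} (incl p X A3 {} A4 {} c)"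
          by (rule incl_comp[symmetric]) (use sub in auto)
        finally show "y \<in> incl p X A4 {} ?U4 {} ` ?J" using c(1) by blast
      qed
    qed
  qed auto
  moreover have "(incl p X ?U3 {} ?U4 {} \<circ> incl p X ?U1 {} ?U3 {}) ` carrier ?H1
     = incl p X ?U1 {} ?U4 {} ` carrier ?H1"
  proof (rule image_cong[OF refl])
    fix c show "(incl p X ?U3 {} ?U4 {} \<circ> incl p X ?U1 {} ?U3 {}) c = incl p X ?U1 {} ?U4 {} c"
      unfolding o_apply by (rule incl_comp) (use sub in auto)
  qed
  ultimately show "grank ?H4 (incl p X ?U1 {} ?U4 {} ` carrier ?H1) \<noteq> \<infinity>" by metis
qed

section \<open>Charts and the covering induction\<close>

abbreviation plane :: "(real \<times> real) topology" where "plane \<equiv> euclidean"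

text \<open>A chart is homeomorphic to the entire plane, and not just to an open part of it, so that
  the chart itself has the homology of a point.\<close>

definition planar_open :: "'a topology \<Rightarrow> 'a set \<Rightarrow> bool" where
  "planar_open X D \<longleftrightarrow> openin X D \<and> subtopology X D homeomorphic_space plane"

lemma planar_open_obtain:
  assumes "planar_open X D"
  obtains f g where "homeomorphic_maps (subtopology X D) plane f g"
    "homeomorphic_map (subtopology X D) plane f"
    "homeomorphic_map plane (subtopology X D) g"
    "D \<subseteq> topspace X" "topspace (subtopology X D) = D"
  using assms openin_subset unfolding planar_open_def homeomorphic_space_def
  by (metis homeomorphic_map_maps homeomorphic_maps_sym topspace_subtopology_subset)

text \<open>In the plane, the compact set \<open>K\<close> is covered by finitely many balls that
  stay inside the image of \<open>V \<inter> D\<close>. Their union has homology of finite rank, and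
  the inclusion of \<open>U\<close> factors through it.\<close>

lemma fin_incl_chart:
  assumes D: "planar_open X D" and V: "openin X V" and cpt: "compactin X K" and sub: "U \<subseteq> K" "K \<subseteq> V \<inter> D"
  shows "fin_incl X U V"
proof -
  obtain f g where fg: "homeomorphic_maps (subtopology X D) plane f g"
    and f: "homeomorphic_map (subtopology X D) plane f"
    and g: "homeomorphic_map plane (subtopology X D) g"
    and top: "topspace (subtopology X D) = D"
    by (rule planar_open_obtain[OF D])
  have gf: "\<And>x. x \<in> D \<Longrightarrow> g (f x) = x" and fg': "\<And>y. f (g y) = y" and gD: "\<And>y. g y \<in> D"
    using fg top by (auto simp: homeomorphic_maps_def continuous_map_def)
  have "openin (subtopology X D) (V \<inter> D)" using V by (simp add: openin_subtopology_Int)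
  then have op: "open (f ` (V \<inter> D))"
    using homeomorphic_map_openness_eq[OF f] by simp
  have "compactin (subtopology X D) K" using cpt sub by (simp add: compactin_subtopology)
  then have cK: "compact (f ` K)"
    using homeomorphic_map_compactness_eq[OF f] by simp
  have "\<forall>y\<in>f ` K. \<exists>e>0. ball y e \<subseteq> f ` (V \<inter> D)"
    using op sub by (meson image_mono open_contains_ball subsetD)
  then obtain e where e: "\<And>y. y \<in> f ` K \<Longrightarrow> e y > 0 \<and> ball y (e y) \<subseteq> f ` (V \<inter> D)" by metis
  have cover: "f ` K \<subseteq> (\<Union>y\<in>f ` K. ball y (e y))" using e by force
  obtain Y where Y: "Y \<subseteq> f ` K" "finite Y" "f ` K \<subseteq> (\<Union>y\<in>Y. ball y (e y))"
    by (rule compactE_image[OF cK _ cover]) auto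
  define F where "F = (\<lambda>y. ball y (e y)) ` Y"
  have finF: "finite F" "\<And>C. C \<in> F \<Longrightarrow> open C \<and> convex C" using Y by (auto simp: F_def)
  define Q where "Q = g ` \<Union>F"
  show ?thesis
  proof (rule fin_incl_factor)
    show "U \<subseteq> Q"
    proof
      fix x assume x: "x \<in> U"
      then have "f x \<in> \<Union>F" using Y(3) sub unfolding F_def by blast
      then show "x \<in> Q" unfolding Q_def using gf[of x] x sub by (metis IntE image_eqI subsetD)
    qed
    show "Q \<subseteq> V"
    proof
      fix x assume "x \<in> Q"
      then obtain z where z: "z \<in> \<Union>F" "x = g z" by (auto simp: Q_def)
      then have "z \<in> f ` (V \<inter> D)" using e Y(1) unfolding F_def by blast
      then show "x \<in> V" using z(2) gf by auto
    qed
    have QD: "Q \<subseteq> D" using gD by (auto simp: Q_def)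
    have "homeomorphic_map (subtopology euclidean (\<Union>F)) (subtopology (subtopology X D) Q) g"
      by (rule homeomorphic_map_subtopologies[OF g]) (use QD top in \<open>auto simp: Q_def\<close>)
    moreover have "subtopology (subtopology X D) Q = subtopology X Q"
      using QD by (simp add: subtopology_subset)
    ultimately have "top_of_set (\<Union>F) homeomorphic_space subtopology X Q"
      using homeomorphic_map_imp_homeomorphic_space by metis
    from hrank_homeomorphic[OF this] hrank_finite_Union_convex[OF finF]
    show "hrank p (subtopology X Q) {} \<noteq> \<infinity>" for p by metis
  qed
qed

text \<open>Normality is applied first to \<open>K - Q\<close> inside \<open>P\<close>, then to the
  part of \<open>K\<close> that \<open>P'\<close> leaves uncovered.\<close>

lemma shrink_cover:
  assumes "normal_space X" "closedin X K" "openin X P" "openin X Q" "K \<subseteq> P \<union> Q"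
  obtains P' Q' where "openin X P'" "openin X Q'" "X closure_of P' \<subseteq> P" "X closure_of Q' \<subseteq> Q" "K \<subseteq> P' \<union> Q'"
proof -
  have "closedin X (K - Q)" "K - Q \<subseteq> P" using assms(2,4,5) by (blast intro: closedin_diff)+
  then obtain P' where P': "openin X P'" "K - Q \<subseteq> P'" "X closure_of P' \<subseteq> P"
    using assms(1,3) unfolding normal_space_alt by metis
  have "closedin X (K - P')" "K - P' \<subseteq> Q" using assms(2,4,5) P' by (blast intro: closedin_diff)+
  then obtain Q' where Q': "openin X Q'" "K - P' \<subseteq> Q'" "X closure_of Q' \<subseteq> Q"
    using assms(1,4) unfolding normal_space_alt by metis
  have "K \<subseteq> P' \<union> Q'" using Q'(2) by blast
  then show ?thesis using that P' Q' by blast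
qed

lemma fin_incl_cover:
  assumes X: "compact_space X" "Hausdorff_space X" and "finite \<O>"
  shows "(\<And>D. D \<in> \<O> \<Longrightarrow> planar_open X D) \<Longrightarrow> openin X U \<Longrightarrow> openin X V \<Longrightarrow>
    X closure_of U \<subseteq> V \<inter> \<Union>\<O> \<Longrightarrow> fin_incl X U V"
  using assms(3)
proof (induction \<O> arbitrary: U V rule: finite_induct)
  case empty
  have "U \<subseteq> X closure_of U" using closure_of_subset[OF openin_subset[OF empty.prems(2)]] .
  then have U: "U = {}" using empty.prems(4) by blast
  show ?case
  proof (rule fin_incl_factor[of U "{}" V])
    show "hrank p (subtopology X {}) {} \<noteq> \<infinity>" for p
    proof -
      have "hrank p (subtopology X {}) {} = 0" by (rule hrank_empty) auto
      then show ?thesis by (simp only: i0_ne_infinity not_False_eq_True)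
    qed
  qed (auto simp: U)
next
  case (insert D \<O>)
  have norm: "normal_space X" using X compact_Hausdorff_or_regular_imp_normal_space by blast
  have cpt: "compactin X (X closure_of W)" for W
    using X closedin_compact_space closedin_closure_of by blast
  have cls: "W \<subseteq> X closure_of W" if "openin X W" for W
    using that by (simp add: closure_of_subset openin_subset)
  have D: "planar_open X D" "openin X D" using insert.prems by (auto simp: planar_open_def)
  \<comment> \<open>This is the outermost level. Three shrinkings produce the nested sets that
    \<open>fin_incl_Un\<close> asks for, each pair still covering the closure of
    \<open>U\<close>.\<close>
  define A4 B4 where "A4 = V \<inter> \<Union>\<O>" and "B4 = V \<inter> D"
  have op4: "openin X A4" "openin X B4"
    using insert.prems unfolding A4_def B4_def by (auto simp: planar_open_def intro!: openin_Int openin_Union)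
  have K4: "X closure_of U \<subseteq> A4 \<union> B4" using insert.prems by (auto simp: A4_def B4_def)
  obtain A3 B3 where 3: "openin X A3" "openin X B3" "X closure_of A3 \<subseteq> A4" "X closure_of B3 \<subseteq> B4" "X closure_of U \<subseteq> A3 \<union> B3"
    by (rule shrink_cover[OF norm closedin_closure_of op4 K4])
  obtain A2 B2 where 2: "openin X A2" "openin X B2" "X closure_of A2 \<subseteq> A3" "X closure_of B2 \<subseteq> B3" "X closure_of U \<subseteq> A2 \<union> B2"
    by (rule shrink_cover[OF norm closedin_closure_of 3(1,2,5)])
  obtain A1 B1 where 1: "openin X A1" "openin X B1" "X closure_of A1 \<subseteq> A2" "X closure_of B1 \<subseteq> B2" "X closure_of U \<subseteq> A1 \<union> B1"
    by (rule shrink_cover[OF norm closedin_closure_of 2(1,2,5)])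
  have "fin_incl X (A1 \<union> B1) (A4 \<union> B4)"
  proof (rule fin_incl_Un[OF 1(1) 2(1) 3(1) 1(2) 2(2) 3(2)])
    show "A1 \<subseteq> A2" "A2 \<subseteq> A3" "A3 \<subseteq> A4" "B1 \<subseteq> B2" "B2 \<subseteq> B3" "B3 \<subseteq> B4"
      using 1 2 3 cls by (meson order_trans)+
    show "fin_incl X A3 A4"
      by (rule insert.IH) (use insert.prems 3 op4 in \<open>auto simp: A4_def\<close>)
    show "fin_incl X B2 B3"
      by (rule fin_incl_chart[OF D(1) 3(2) cpt[of B2] cls[OF 2(2)]])
        (use 2 3 cls[OF 3(2)] in \<open>auto simp: B4_def\<close>)
    \<comment> \<open>The intersections lie in the chart \<open>D\<close>, so the case of a single
      chart applies to them as it does to \<open>B2\<close> and \<open>B3\<close>.\<close>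
    show "fin_incl X (A1 \<inter> B1) (A2 \<inter> B2)"
    proof (rule fin_incl_chart[OF D(1) _ cpt[of "A1 \<inter> B1"] cls])
      have "X closure_of (A1 \<inter> B1) \<subseteq> X closure_of A1" "X closure_of (A1 \<inter> B1) \<subseteq> X closure_of B1"
        by (intro closure_of_mono; blast)+
      moreover have "B2 \<subseteq> D" using 2(4) 3(4) cls[OF 2(2)] cls[OF 3(2)] unfolding B4_def by blast
      ultimately show "X closure_of (A1 \<inter> B1) \<subseteq> A2 \<inter> B2 \<inter> D" using 1 by blast
    qed (use 1 2 in auto)
  qed
  then show ?case
  proof (rule fin_incl_mono)
    show "U \<subseteq> A1 \<union> B1" using 1(5) cls insert.prems by blast
    show "A1 \<union> B1 \<subseteq> A4 \<union> B4" using 1 2 3 cls by (meson Un_mono order_trans)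
  qed (auto simp: A4_def B4_def)
qed

theorem hrank_compact_surface_finite:
  assumes X: "compact_space X" "Hausdorff_space X"
    and charts: "\<And>x. x \<in> topspace X \<Longrightarrow> \<exists>D. planar_open X D \<and> x \<in> D"
  shows "hrank p X {} \<noteq> \<infinity>"
proof -
  have "\<forall>D \<in> {D. planar_open X D}. openin X D" by (auto simp: planar_open_def)
  moreover have "topspace X \<subseteq> \<Union>{D. planar_open X D}" using charts by blast
  ultimately obtain \<O> where \<O>: "finite \<O>" "\<O> \<subseteq> {D. planar_open X D}" "topspace X \<subseteq> \<Union>\<O>"
    using X(1) unfolding compact_space_alt by metis
  \<comment> \<open>The whole space is its own closure, so it may be both source and target; the
    induced map is then the identity.\<close>
  have "fin_incl X (topspace X) (topspace X)"
    by (rule fin_incl_cover[OF X \<O>(1)]) (use \<O> in \<open>auto simp: closure_of_subset_topspace\<close>)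
  moreover have "incl p X (topspace X) {} (topspace X) {} ` carrier (homology_group p X) = carrier (homology_group p X)"
    unfolding incl_def using hom_induced_id[of _ p X "{}"] by simp
  ultimately show ?thesis unfolding fin_incl_def hrank_def by (metis subtopology_topspace)
qed

section \<open>Removing points and arcs\<close>

text \<open>Both pairs excise to the intersection of \<open>U1\<close> and \<open>U2\<close>, so the
  relative homology at \<open>K\<close> is local. Closedness is asked relative to the open sets,
  which lets \<open>K\<close> be an open arc.\<close>

lemma hrank_excision_open2:
  assumes "openin X U1" "openin X U2" "closedin (subtopology X U1) K" "closedin (subtopology X U2) K"
  shows "hrank p (subtopology X U1) (U1 - K) = hrank p (subtopology X U2) (U2 - K)"
proof -
  define O' where "O' = U1 \<inter> U2"
  have KO: "K \<subseteq> O'" using assms closedin_subset by (fastforce simp: O'_def)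
  have *: "hrank p (subtopology X U) (U - K) = hrank p (subtopology X O') (O' - K)"
    if "openin X U" "closedin (subtopology X U) K" "O' \<subseteq> U" for U
  proof -
    have "openin (subtopology X U) O'"
      using that assms by (auto simp: openin_open_subtopology O'_def)
    moreover have "topspace (subtopology X U) = U" using that openin_subset by fastforce
    moreover have "subtopology (subtopology X U) O' = subtopology X O'"
      using that by (simp add: subtopology_subset)
    ultimately show ?thesis using hrank_excision[OF that(2) _ KO, of p] by simp
  qed
  show ?thesis using *[OF assms(1,3)] *[OF assms(2,4)] by (simp add: O'_def)
qed

text \<open>Finiteness enters as an equivalence because it is used in both directions: from the
  compact surface down to complements, and from a smaller graph up to a larger one.\<close>

definition euler_shift :: "'a topology \<Rightarrow> 'a set \<Rightarrow> 'a set \<Rightarrow> int \<Rightarrow> bool" where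
  "euler_shift X U W c \<longleftrightarrow> (fin_hom (subtopology X U) {} \<longleftrightarrow> fin_hom (subtopology X W) {}) \<and>
     (fin_hom (subtopology X U) {} \<longrightarrow> echar (subtopology X W) {} = echar (subtopology X U) {} + c)"

lemma euler_shift_trans: "euler_shift X U V c \<Longrightarrow> euler_shift X V W d \<Longrightarrow> euler_shift X U W (c + d)"
  unfolding euler_shift_def by auto

lemma euler_shift_pair:
  assumes "W \<subseteq> U" "fin_hom (subtopology X U) W" "hrank 3 (subtopology X U) W = 0"
  shows "euler_shift X U W (- echar (subtopology X U) W)"
proof -
  have "subtopology (subtopology X U) W = subtopology X W"
    using assms by (simp add: subtopology_subset)
  then show ?thesis using long_exact_euler[OF assms(2,3)] unfolding euler_shift_def by auto
qed

lemma hrank_chart: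
  assumes f: "homeomorphic_map (subtopology X D) Y f" and D: "D \<subseteq> topspace X" and "K \<subseteq> D"
  shows "hrank p (subtopology X D) (D - K) = hrank p Y (topspace Y - f ` K)"
proof -
  have top: "topspace (subtopology X D) = D" using D by auto
  have "inj_on f D" "f ` D = topspace Y"
    using homeomorphic_imp_injective_map[OF f] homeomorphic_imp_surjective_map[OF f] top by auto
  then have "f ` (D - K) = topspace Y - f ` K" using assms(3) by (simp add: inj_on_image_set_diff)
  moreover have "hrank p (subtopology X D) (D - K) = hrank p Y (f ` (D - K))"
    by (rule hrank_homeomorphic_map[OF f]) (use top in auto)
  ultimately show ?thesis by simp
qed

text \<open>Local homology at \<open>a\<close>: excision moves the pair into the chart
  \<open>D\<close>, where it becomes Euclidean.\<close>

lemma hrank_remove_point: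
  assumes X: "Hausdorff_space X" and U: "openin X U" "a \<in> U" and D: "openin X D" "a \<in> D"
    and hom: "subtopology X D homeomorphic_space Euclidean_space n"
  shows "hrank p (subtopology X U) (U - {a}) = (if p = int n then 1 else 0)"
proof -
  obtain f where f: "homeomorphic_map (subtopology X D) (Euclidean_space n) f"
    using hom homeomorphic_space by blast
  have DX: "D \<subseteq> topspace X" using D openin_subset by auto
  then have "closedin X {a}" using X D(2) closedin_Hausdorff_singleton by (metis subsetD)
  then have cl: "closedin (subtopology X W) {a}" if "a \<in> W" for W
    using that by (metis closedin_subset_topspace empty_subsetI insert_subset)
  have "hrank p (subtopology X U) (U - {a}) = hrank p (subtopology X D) (D - {a})"
    by (rule hrank_excision_open2) (use U D cl in auto)
  also have "\<dots> = hrank p (Euclidean_space n) (topspace (Euclidean_space n) - f ` {a})"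
    by (rule hrank_chart[OF f DX]) (use D in auto)
  also have "\<dots> = (if p = int n then 1 else 0)"
  proof -
    have "f a \<in> topspace (Euclidean_space n)"
      using homeomorphic_imp_surjective_map[OF f] D DX by auto
    then show ?thesis using hrank_Euclidean_point[of "f a" n p] by simp
  qed
  finally show ?thesis .
qed

text \<open>The relative Euler characteristic is \<open>(-1)^n\<close>, and the shift is its
  negative. Dimension 0 serves the points of a finite set, 1 the midpoint of an edge within the
  graph, and 2 the points of the surface.\<close>

lemma euler_shift_remove_point:
  assumes "Hausdorff_space X" "openin X U" "a \<in> U" "openin X D" "a \<in> D"
    and "subtopology X D homeomorphic_space Euclidean_space n" "n \<in> {0, 1, 2}"
  shows "euler_shift X U (U - {a}) (if n = 1 then 1 else - 1)"
proof -
  note hrank = hrank_remove_point[OF assms(1-6)]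
  have "fin_hom (subtopology X U) (U - {a})" "hrank 3 (subtopology X U) (U - {a}) = 0"
    using assms(7) unfolding fin_hom_def hrank by (auto simp: one_enat_def zero_enat_def)
  from euler_shift_pair[OF _ this]
  have "euler_shift X U (U - {a}) (- echar (subtopology X U) (U - {a}))" by simp
  moreover have "- echar (subtopology X U) (U - {a}) = (if n = 1 then 1 else - 1)"
    using assms(7) unfolding echar_def hrank by (auto simp: one_enat_def zero_enat_def)
  ultimately show ?thesis by simp
qed

lemma planar_open_Euclidean:
  "planar_open X D \<longleftrightarrow> openin X D \<and> subtopology X D homeomorphic_space Euclidean_space 2"
proof -
  have "plane homeomorphic_space Euclidean_space 2"
    unfolding homeomorphic_space_def by (intro exI) (rule homeomorphic_maps_plane_Euclidean_space)
  then have "Y homeomorphic_space plane \<longleftrightarrow> Y homeomorphic_space Euclidean_space 2"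
    for Y :: "'a topology"
    by (metis homeomorphic_space_trans homeomorphic_space_sym)
  then show ?thesis unfolding planar_open_def by simp
qed

lemma hrank_plane:
  assumes "subtopology X D homeomorphic_space Euclidean_space n"
  shows "hrank p (subtopology X D) {} = (if p = 0 then 1 else 0)"
  using hrank_homeomorphic[OF assms, of p] nontrivial_Euclidean_space[of n]
  by (simp add: hrank_contractible)

text \<open>The chart \<open>D\<close> without the two points of \<open>P\<close> on the arc has
  Euler characteristic -1, and \<open>D\<close> without the whole arc has 0. The relative Euler
  characteristic is therefore -1, and the shift is +1.\<close>

lemma arc_in_chart:
  assumes X: "Hausdorff_space X" and D: "openin X D" "subtopology X D homeomorphic_space Euclidean_space 2"
    and K: "K \<subseteq> D" "subtopology X K homeomorphic_space top_of_set {-1..1::real}"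
    and ab: "a \<in> K" "b \<in> K" "a \<noteq> b"
    and P: "closedin X P" "K \<inter> P = {a, b}"
  shows "euler_shift X (topspace X - P) (topspace X - P - K) 1"
proof -
  have DX: "D \<subseteq> topspace X" using D openin_subset by auto
  obtain f where f: "homeomorphic_map (subtopology X D) (Euclidean_space 2) f"
    using D homeomorphic_space by blast
  have top: "topspace (subtopology X D) = D" using DX by auto
  have "compact_space (subtopology X K)"
    using homeomorphic_compact_space[OF K(2)] by (simp add: compact_space_subtopology)
  then have cptK: "compactin X K" using K DX by (simp add: compactin_subspace)
  then have clK: "closedin X K" using X compactin_imp_closedin by blast
  have clX: "closedin X {a}" "closedin X {b}"
    using X ab K DX closedin_Hausdorff_singleton by (metis subsetD)+
  have oD: "openin X (D - {a})" "openin X (D - {a} - {b})" using clX D by auto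
  have hrK: "hrank p (subtopology X D) (D - K) = (if p = 2 then 1 else 0)" for p
  proof -
    have fK: "compactin (Euclidean_space 2) (f ` K)"
      using homeomorphic_map_compactness_eq[OF f, of K] cptK K top by (simp add: compactin_subtopology)
    have "homeomorphic_map (subtopology (subtopology X D) K) (subtopology (Euclidean_space 2) (f ` K)) f"
    proof (rule homeomorphic_map_subtopologies[OF f])
      have "f ` K \<subseteq> topspace (Euclidean_space 2)" using fK compactin_subset_topspace by blast
      then show "f ` (topspace (subtopology X D) \<inter> K) = topspace (Euclidean_space 2) \<inter> f ` K"
        using K top by (simp add: Int_absorb1)
    qed
    moreover have "subtopology (subtopology X D) K = subtopology X K"
      using K by (simp add: subtopology_subset)
    ultimately have "subtopology (Euclidean_space 2) (f ` K) homeomorphic_space subtopology X K"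
      using homeomorphic_map_imp_homeomorphic_space homeomorphic_space_sym by metis
    then have "subtopology (Euclidean_space 2) (f ` K) homeomorphic_space top_of_set {-1..1::real}"
      using K(2) homeomorphic_space_trans by blast
    moreover have "closedin (Euclidean_space 2) (f ` K)"
      using fK Hausdorff_Euclidean_space compactin_imp_closedin by blast
    ultimately show ?thesis
      using hrank_chart[OF f DX K(1)] hrank_Euclidean_interval by simp
  qed
  \<comment> \<open>By excision the pair in question is equivalent to the chart without \<open>a\<close> and \<open>b\<close>, relative to the
    chart without the whole arc.\<close>
  note hrD = hrank_plane[OF D(2)]
  have ss: "subtopology (subtopology X A) B = subtopology X B" if "B \<subseteq> A" for A B
    using that by (simp add: subtopology_subset)
  have finD: "fin_hom (subtopology X D) {}" "echar (subtopology X D) {} = 1"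
    unfolding fin_hom_def echar_def hrD by (auto simp: one_enat_def zero_enat_def)
  have finDK: "fin_hom (subtopology X D) (D - K)" "hrank 3 (subtopology X D) (D - K) = 0"
      "echar (subtopology X D) (D - K) = 1"
    unfolding fin_hom_def echar_def hrK by (auto simp: one_enat_def zero_enat_def)
  have DK: "fin_hom (subtopology X (D - K)) {}" "echar (subtopology X (D - K)) {} = 0"
    using euler_shift_pair[OF _ finDK(1,2)] finD finDK(3) unfolding euler_shift_def by auto
  \<comment> \<open>Degree 2 here and degree 3 in \<open>D3\<close> are what
    \<open>fin_hom_pair\<close> asks for besides finiteness.\<close>
  have DK2: "hrank 2 (subtopology X (D - K)) {} = 0"
    using hrank_sub_zero[of 2 "subtopology X D" "D - K"] hrD hrK ss by simp
  have hra: "hrank p (subtopology X D) (D - {a}) = (if p = int 2 then 1 else 0)" for p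
    by (rule hrank_remove_point[OF X D(1) _ D(1) _ D(2)]) (use ab K in auto)
  have hrb: "hrank p (subtopology X (D - {a})) (D - {a} - {b}) = (if p = int 2 then 1 else 0)" for p
    by (rule hrank_remove_point[OF X oD(1) _ D(1) _ D(2)]) (use ab K in auto)
  have "hrank 3 (subtopology X (D - {a})) {} = 0"
    using hrank_sub_zero[of 3 "subtopology X D" "D - {a}"] hrD hra ss by simp
  then have D3: "hrank 3 (subtopology X (D - {a} - {b})) {} = 0"
    using hrank_sub_zero[of 3 "subtopology X (D - {a})" "D - {a} - {b}"] hrb ss by simp
  have "euler_shift X D (D - {a}) (- 1)"
    using euler_shift_remove_point[OF X D(1) _ D(1) _ D(2)] ab K by auto
  moreover have "euler_shift X (D - {a}) (D - {a} - {b}) (- 1)"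
    using euler_shift_remove_point[OF X oD(1) _ D(1) _ D(2)] ab K by auto
  ultimately have Dab: "fin_hom (subtopology X (D - {a} - {b})) {}" "echar (subtopology X (D - {a} - {b})) {} = - 1"
    using finD unfolding euler_shift_def by auto
  \<comment> \<open>The set \<open>e\<close> is not closed in \<open>X\<close>, but it is closed
    both in the complement of \<open>P\<close> and in \<open>D\<close> without \<open>a\<close> and
    \<open>b\<close>, so these two surroundings can be exchanged by excision.\<close>
  define e where "e = K - {a, b}"
  have De: "D - {a} - {b} - e = D - K" using ab K by (auto simp: e_def)
  have sub: "D - K \<subseteq> D - {a} - {b}" using ab by auto
  have fin: "fin_hom (subtopology X (D - {a} - {b})) (D - K)" "hrank 3 (subtopology X (D - {a} - {b})) (D - K) = 0"
    using fin_hom_pair[OF Dab(1) _ D3] DK(1) DK2 ss[OF sub] by auto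
  have echar: "echar (subtopology X (D - {a} - {b})) (D - K) = - 1"
    using euler_shift_pair[OF sub fin] Dab DK unfolding euler_shift_def by auto
  define U where "U = topspace X - P"
  have Ue: "U - e = U - K" "K \<inter> U = e" using P(2) K DX by (auto simp: U_def e_def)
  have oU: "openin X U" using P by (auto simp: U_def)
  have "closedin (subtopology X U) e"
    using clK Ue(2) by (metis closedin_subtopology_Int_closed inf_commute)
  moreover have "closedin (subtopology X (D - {a} - {b})) e"
  proof -
    have "(D - {a} - {b}) \<inter> K = e" using K by (auto simp: e_def)
    then show ?thesis using clK by (metis closedin_subtopology_Int_closed)
  qed
  ultimately have eq: "hrank p (subtopology X U) (U - e) = hrank p (subtopology X (D - {a} - {b})) (D - {a} - {b} - e)" for p
    by (intro hrank_excision_open2 oU oD(2))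
  have "fin_hom (subtopology X U) (U - e)" "hrank 3 (subtopology X U) (U - e) = 0" "echar (subtopology X U) (U - e) = - 1"
    using fin echar unfolding fin_hom_def echar_def eq De by auto
  from euler_shift_pair[OF _ this(1,2)] this(3) have "euler_shift X U (U - e) 1" by simp
  then show ?thesis by (metis U_def Ue(1))
qed

section \<open>Cutting an edge into arcs that lie in charts\<close>

abbreviation unit_interval :: "real topology" where "unit_interval \<equiv> top_of_set {0..1}"

lemma homeomorphic_imp_homeomorphic_space:
  assumes "S homeomorphic T" shows "top_of_set S homeomorphic_space top_of_set T"
proof -
  obtain f g where "homeomorphism S T f g" using assms by (auto simp: homeomorphic_def)
  then have "homeomorphic_maps (top_of_set S) (top_of_set T) f g"
    by (auto simp: homeomorphism_def homeomorphic_maps_def continuous_map_in_subtopology)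
  then show ?thesis by (auto simp: homeomorphic_space_def)
qed

lemma path_arc_homeomorphic:
  assumes X: "Hausdorff_space X" and g: "continuous_map unit_interval X g"
    and st: "0 \<le> s" "s < t" "t \<le> (1::real)" and inj: "inj_on g {s..t}"
  shows "homeomorphic_map (top_of_set {s..t}) (subtopology X (g ` {s..t})) g"
    "subtopology X (g ` {s..t}) homeomorphic_space top_of_set {-1..1::real}"
proof -
  have gX: "g ` {s..t} \<subseteq> topspace X" using g st by (auto simp: continuous_map_def Pi_iff)
  have "continuous_map (top_of_set {s..t}) X g"
    using continuous_map_from_subtopology_mono[OF g, of "{s..t}"] st by auto
  then have cg: "continuous_map (top_of_set {s..t}) (subtopology X (g ` {s..t})) g"
    by (auto simp: continuous_map_in_subtopology)
  show hom: "homeomorphic_map (top_of_set {s..t}) (subtopology X (g ` {s..t})) g"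
  proof (rule continuous_imp_homeomorphic_map[OF cg])
    show "compact_space (top_of_set {s..t})" by (simp add: compact_space_subtopology)
    show "Hausdorff_space (subtopology X (g ` {s..t}))" using X Hausdorff_space_subtopology by blast
    show "g ` topspace (top_of_set {s..t}) = topspace (subtopology X (g ` {s..t}))" using gX by auto
    show "inj_on g (topspace (top_of_set {s..t}))" using inj by simp
  qed
  have "{s..t} homeomorphic {-1..1::real}"
    using homeomorphic_closed_intervals_real[of s t "-1" 1] st by simp
  then have "top_of_set {s..t} homeomorphic_space top_of_set {-1..1::real}"
    by (rule homeomorphic_imp_homeomorphic_space)
  then show "subtopology X (g ` {s..t}) homeomorphic_space top_of_set {-1..1::real}"
    using homeomorphic_map_imp_homeomorphic_space[OF hom] homeomorphic_space_sym homeomorphic_space_trans by blast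
qed

lemma path_segment_closed:
  assumes X: "Hausdorff_space X" and g: "continuous_map unit_interval X g" and "0 \<le> s" "t \<le> 1"
  shows "closedin X (g ` {s..t})"
proof -
  have "compactin unit_interval {s..t}" using assms(3,4) by (auto simp: compactin_subtopology)
  then show ?thesis using image_compactin[OF _ g] compactin_imp_closedin[OF X] by blast
qed

text \<open>The count is compatible with cutting: removing an inner point gives -1 and each of the
  two open pieces +1, again +1 in total. The hypotheses admit a loop, with
  \<open>g 0 = g 1\<close>.\<close>

lemma euler_shift_edge:
  assumes X: "Hausdorff_space X" and charts: "\<And>x. x \<in> topspace X \<Longrightarrow> \<exists>D. planar_open X D \<and> x \<in> D"
    and g: "continuous_map unit_interval X g" and inj: "inj_on g {0<..<1}"
    and ends: "g 0 \<notin> g ` {0<..<1}" "g 1 \<notin> g ` {0<..<1}"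
    and P: "closedin X P" "g 0 \<in> P" "g 1 \<in> P" "P \<inter> g ` {0<..<1} = {}"
  shows "euler_shift X (topspace X - P) (topspace X - P - g ` {0<..<1}) 1"
proof -
  have gX: "g u \<in> topspace X" if "0 \<le> u" "u \<le> 1" for u
    using g that by (auto simp: continuous_map_def Pi_iff)
  \<comment> \<open>Only the two ends of the edge can coincide, as they do for a loop, and an
    interval of length below 1 does not contain both parameters.\<close>
  have injg: "inj_on g {s..t}" if "0 \<le> s" "t \<le> 1" "t - s < 1" for s t
  proof (rule inj_onI)
    fix u v assume uv: "u \<in> {s..t}" "v \<in> {s..t}" "g u = g v"
    show "u = v"
    proof (cases "u \<in> {0<..<1} \<and> v \<in> {0<..<1}")
      case True then show ?thesis using inj_onD[OF inj uv(3)] by simp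
    next
      case False
      show ?thesis
      proof (rule ccontr)
        assume "u \<noteq> v"
        have "u \<in> {0, 1} \<or> u \<in> {0<..<1}" "v \<in> {0, 1} \<or> v \<in> {0<..<1}" using uv that by auto
        moreover have "\<not> (u \<in> {0,1} \<and> v \<in> {0,1})" using uv that \<open>u \<noteq> v\<close> by auto
        ultimately have "g 0 \<in> g ` {0<..<1} \<or> g 1 \<in> g ` {0<..<1}"
          using False uv(3) by (metis imageI insertE singletonD)
        then show False using ends by simp
      qed
    qed
  qed
  note gcl = path_segment_closed[OF X g]
  \<comment> \<open>The closed set is quantified inside \<open>Q\<close> because the two pieces are
    removed one after the other, with \<open>P\<close> enlarged by the cut point and then also by
    the first piece.\<close>
  define Q where "Q s t \<longleftrightarrow> (0 \<le> s \<longrightarrow> s < t \<longrightarrow> t \<le> 1 \<longrightarrow> (\<forall>P. closedin X P \<longrightarrow> g s \<in> P \<longrightarrow> g t \<in> P \<longrightarrow>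
       P \<inter> g ` {s<..<t} = {} \<longrightarrow> euler_shift X (topspace X - P) (topspace X - P - g ` {s<..<t}) 1))" for s t
  have "Q 0 1"
  proof (rule Bolzano[of 0 1 Q])
    fix s m t assume Q: "Q s m" "Q m t" and le: "s \<le> m" "m \<le> t"
    show "Q s t"
    proof (cases "s = m \<or> m = t")
      case True then show ?thesis using Q by auto
    next
      case False
      then have lt: "s < m" "m < t" using le by auto
      show ?thesis unfolding Q_def
      proof (intro impI allI)
        fix P assume st: "0 \<le> s" "s < t" "t \<le> 1" and P: "closedin X P" "g s \<in> P" "g t \<in> P" "P \<inter> g ` {s<..<t} = {}"
        have m: "m \<in> {0<..<1}" using lt st by auto
        have split: "{s<..<t} = {s<..<m} \<union> {m} \<union> {m<..<t}" using lt by auto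
        have gm: "g m \<in> topspace X" "g m \<notin> P" using gX m P(4) split by auto
        obtain D where D: "planar_open X D" "g m \<in> D" using charts gm by blast
        have s1: "euler_shift X (topspace X - P) (topspace X - P - {g m}) (- 1)"
          using euler_shift_remove_point[OF X _ _ _ D(2), where n=2 and U="topspace X - P"] D P(1) gm
          by (auto simp: planar_open_Euclidean)
        define P' where "P' = insert (g m) P"
        have "closedin X {g m}" by (rule closedin_Hausdorff_singleton[OF X gm(1)])
        then have P': "closedin X P'" using P(1) closedin_Un unfolding P'_def by (metis insert_is_Un)
        have injm: "g u \<noteq> g m" if "u \<in> {s<..<t}" "u \<noteq> m" for u
          using inj_onD[OF inj, of u m] m that st by auto
        have "P \<inter> g ` {s<..<m} = {}" using P(4) split by blast
        moreover have "g m \<notin> g ` {s<..<m}"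
        proof
          assume "g m \<in> g ` {s<..<m}"
          then obtain u where "u \<in> {s<..<m}" "g u = g m" by (metis imageE)
          then show False using injm[of u] lt by simp
        qed
        ultimately have "P' \<inter> g ` {s<..<m} = {}" unfolding P'_def by blast
        then have s2: "euler_shift X (topspace X - P') (topspace X - P' - g ` {s<..<m}) 1"
          using Q(1) P' P st lt unfolding Q_def P'_def by auto
        define P2 where "P2 = P' \<union> g ` {s<..<m}"
        \<comment> \<open>Both ends of the first piece already lie in \<open>P'\<close>, so the open
          piece may be replaced by the compact segment; this makes \<open>P2\<close> closed.\<close>
        have "P2 = P' \<union> g ` {s..m}"
        proof -
          have "{s..m} = {s<..<m} \<union> {s, m}" using lt by auto
          then show ?thesis using P(2) by (auto simp: P2_def P'_def)
        qed
        then have P2: "closedin X P2" using P' gcl[of s m] st lt by (auto intro!: closedin_Un)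
        have "P2 \<inter> g ` {m<..<t} = {}"
        proof -
          have "g ` {s<..<m} \<inter> g ` {m<..<t} = {}"
          proof -
            have "{s<..<m} \<subseteq> {0<..<1}" "{m<..<t} \<subseteq> {0<..<1}" "{s<..<m} \<inter> {m<..<t} = {}"
              using st lt by auto
            then show ?thesis by (metis inj_on_image_Int[OF inj] image_empty)
          qed
          moreover have "P \<inter> g ` {m<..<t} = {}" using P(4) split by blast
          moreover have "g m \<notin> g ` {m<..<t}"
          proof
            assume "g m \<in> g ` {m<..<t}"
            then obtain u where "u \<in> {m<..<t}" "g u = g m" by (metis imageE)
            then show False using injm[of u] lt by simp
          qed
          ultimately show ?thesis unfolding P2_def P'_def by blast
        qed
        then have s3: "euler_shift X (topspace X - P2) (topspace X - P2 - g ` {m<..<t}) 1"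
          using Q(2) P2 P st lt unfolding Q_def P2_def P'_def by auto
        have e: "topspace X - P - {g m} = topspace X - P'" "topspace X - P' - g ` {s<..<m} = topspace X - P2"
            "topspace X - P2 - g ` {m<..<t} = topspace X - P - g ` {s<..<t}"
          unfolding P2_def P'_def split by auto
        show "euler_shift X (topspace X - P) (topspace X - P - g ` {s<..<t}) 1"
          using euler_shift_trans[OF euler_shift_trans[OF s1[unfolded e(1)] s2[unfolded e(2)]] s3[unfolded e(3)]]
          by simp
      qed
    qed
  next
    fix x :: real assume x: "0 \<le> x" "x \<le> 1"
    obtain D where D: "planar_open X D" "g x \<in> D" using charts gX x by blast
    have "openin unit_interval {u \<in> topspace unit_interval. g u \<in> D}"
      using openin_continuous_map_preimage[OF g] D by (auto simp: planar_open_def)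
    then obtain d where d: "d > 0" "\<And>u. u \<in> {0..1} \<Longrightarrow> dist u x < d \<Longrightarrow> g u \<in> D"
      using x D(2) unfolding openin_euclidean_subtopology_iff by auto
    show "\<exists>d>0. \<forall>s t. s \<le> x \<and> x \<le> t \<and> t - s < d \<longrightarrow> Q s t"
    proof (intro exI conjI allI impI)
      \<comment> \<open>The bound 1 keeps the interval shorter than the whole edge, so that the
        segment is an embedded arc even if the edge is a loop.\<close>
      show "min d 1 > 0" using d by simp
      fix s t assume st: "s \<le> x \<and> x \<le> t \<and> t - s < min d 1"
      show "Q s t" unfolding Q_def
      proof (intro impI allI)
        fix P assume st': "0 \<le> s" "s < t" "t \<le> 1" and P: "closedin X P" "g s \<in> P" "g t \<in> P" "P \<inter> g ` {s<..<t} = {}"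
        have i: "inj_on g {s..t}" using injg st st' by auto
        have split: "{s..t} = {s<..<t} \<union> {s, t}" using st' by auto
        have "euler_shift X (topspace X - P) (topspace X - P - g ` {s..t}) 1"
        proof (rule arc_in_chart[OF X _ _ _ path_arc_homeomorphic(2)[OF X g st' i]])
          show "openin X D" "subtopology X D homeomorphic_space Euclidean_space 2"
            using D by (auto simp: planar_open_Euclidean)
          show "g ` {s..t} \<subseteq> D" using d(2) st st' by (auto simp: dist_real_def)
          show "g s \<noteq> g t" using i st' by (auto dest: inj_onD)
          show "g ` {s..t} \<inter> P = {g s, g t}" unfolding split using P by auto
        qed (use st' P in auto)
        moreover have "topspace X - P - g ` {s..t} = topspace X - P - g ` {s<..<t}"
          unfolding split using P by auto
        ultimately show "euler_shift X (topspace X - P) (topspace X - P - g ` {s<..<t}) 1" by simp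
      qed
    qed
  qed simp
  then show ?thesis unfolding Q_def using P by auto
qed

lemma drawn_graph_edgeE:
  assumes "drawn_graph S V E" "e \<in> E"
  obtains g where "continuous_map unit_interval S g" "e = g ` {0..1}" "inj_on g {0<..<1}"
    "g 0 \<in> V" "g 1 \<in> V" "g ` {0<..<1} \<inter> V = {}" "e = g ` {0<..<1} \<union> {g 0, g 1}" "e - V = g ` {0<..<1}"
proof -
  have "drawn_edge S V e" using assms by (simp add: drawn_graph_def)
  then obtain g where g: "pathin S g" "e = g ` {0..1}" "inj_on g {0<..<1}"
    "g 0 \<in> V" "g 1 \<in> V" "g ` {0<..<1} \<inter> V = {}"
    unfolding drawn_edge_def by (elim exE conjE)
  have "{0..1::real} = {0<..<1} \<union> {0, 1}" by auto
  then have e: "e = g ` {0<..<1} \<union> {g 0, g 1}" unfolding g(2) by (simp add: image_Un)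
  have eV: "e - V = g ` {0<..<1}" using g(4-6) unfolding e by blast
  show ?thesis by (rule that[OF g(1)[unfolded pathin_def] g(2-6) e eV])
qed

lemma drawn_edge_compact:
  assumes "drawn_graph S V E" "e \<in> E" shows "compactin S e"
proof -
  obtain g where g: "continuous_map unit_interval S g" "e = g ` {0..1}"
    by (rule drawn_graph_edgeE[OF assms])
  have "compactin unit_interval {0..1}" by (auto simp: compactin_subtopology)
  then show ?thesis using image_compactin g by blast
qed

lemma drawn_set_compact:
  assumes "drawn_graph S V E" "A \<subseteq> E" shows "compactin S (V \<union> \<Union>A)"
proof -
  have "finite A" "finite V" "V \<subseteq> topspace S" using assms finite_subset by (auto simp: drawn_graph_def)
  then have "compactin S V" by (simp add: finite_imp_compactin)
  moreover have "compactin S (\<Union>A)"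
    by (rule compactin_Union) (use \<open>finite A\<close> drawn_edge_compact[OF assms(1)] assms(2) in auto)
  ultimately show ?thesis by (rule compactin_Un)
qed

text \<open>Finiteness starts from the compact surface. All vertices are removed before any edge,
  since \<open>euler_shift_edge\<close> wants the ends of the edge inside the closed set that is
  already missing.\<close>

theorem surface_graph_complement:
  assumes X: "compact_space S" "Hausdorff_space S"
    and charts: "\<And>x. x \<in> topspace S \<Longrightarrow> \<exists>D. planar_open S D \<and> x \<in> D"
    and G: "drawn_graph S V E" and A: "A \<subseteq> E"
  shows "fin_hom (subtopology S (topspace S - (V \<union> \<Union>A))) {}"
    "echar (subtopology S (topspace S - (V \<union> \<Union>A))) {} = echar (subtopology S (topspace S - V)) {} + int (card A)"
proof -
  have V: "finite V" "V \<subseteq> topspace S" and E: "finite E"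
    and disj: "\<And>e e'. e \<in> E \<Longrightarrow> e' \<in> E \<Longrightarrow> e \<noteq> e' \<Longrightarrow> e \<inter> e' \<subseteq> V"
    using G by (auto simp: drawn_graph_def)
  have fin0: "fin_hom (subtopology S (topspace S)) {}"
    using hrank_compact_surface_finite[OF X charts] by (simp add: fin_hom_def del: not_infinity_eq)
  have finV: "fin_hom (subtopology S (topspace S - W)) {}" if "finite W" "W \<subseteq> V" for W
    using that
  proof (induction W rule: finite_induct)
    case empty then show ?case using fin0 by simp
  next
    case (insert a W)
    have a: "a \<in> topspace S" using insert V by auto
    obtain D where D: "planar_open S D" "a \<in> D" using charts a by blast
    have "closedin S W" using insert V X(2)
      by (intro compactin_imp_closedin finite_imp_compactin) auto
    then have "euler_shift S (topspace S - W) (topspace S - W - {a}) (- 1)"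
      using euler_shift_remove_point[OF X(2) _ _ _ D(2), where n=2 and U="topspace S - W"] D a insert
      by (auto simp: planar_open_Euclidean)
    moreover have "topspace S - W - {a} = topspace S - insert a W" by auto
    ultimately show ?case using insert unfolding euler_shift_def by auto
  qed
  have "finite A" using A E finite_subset by auto
  then have "A \<subseteq> E \<Longrightarrow> euler_shift S (topspace S - V) (topspace S - (V \<union> \<Union>A)) (int (card A))"
  proof (induction A rule: finite_induct)
    case empty then show ?case by (simp add: euler_shift_def)
  next
    case (insert e A)
    let ?P = "V \<union> \<Union>A"
    have eE: "e \<in> E" using insert.prems by auto
    obtain g where g: "continuous_map unit_interval S g" "inj_on g {0<..<1}"
      "g 0 \<in> V" "g 1 \<in> V" "g ` {0<..<1} \<inter> V = {}" "e = g ` {0<..<1} \<union> {g 0, g 1}" "e - V = g ` {0<..<1}"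
      by (rule drawn_graph_edgeE[OF G eE])
    have "e \<inter> \<Union>A \<subseteq> V" using disj insert by blast
    then have "?P \<inter> g ` {0<..<1} = {}" using g(6,5) by auto
    moreover have "closedin S ?P"
      using drawn_set_compact[OF G, of A] insert.prems X compactin_imp_closedin by auto
    ultimately have "euler_shift S (topspace S - ?P) (topspace S - ?P - g ` {0<..<1}) 1"
      using g by (intro euler_shift_edge X charts) auto
    moreover have "topspace S - ?P - g ` {0<..<1} = topspace S - (V \<union> \<Union>(insert e A))"
      using g(3-6) by auto
    ultimately have step: "euler_shift S (topspace S - ?P) (topspace S - (V \<union> \<Union>(insert e A))) 1"
      by (simp only:)
    have "euler_shift S (topspace S - V) (topspace S - ?P) (int (card A))"
      using insert.IH insert.prems by simp
    from euler_shift_trans[OF this step] show ?case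
      using insert.hyps by (simp add: add.commute)
  qed
  then show "fin_hom (subtopology S (topspace S - (V \<union> \<Union>A))) {}"
    "echar (subtopology S (topspace S - (V \<union> \<Union>A))) {} = echar (subtopology S (topspace S - V)) {} + int (card A)"
    using A finV[of V] V unfolding euler_shift_def by auto
qed

section \<open>Homotopy equivalence and the Euler characteristic of graphs\<close>

text \<open>A deformation retraction in the weak sense: points of \<open>P\<close> may move in
  between and are back in place at time 1.\<close>

lemma deformation_homotopy_equivalent:
  assumes H: "continuous_map (prod_topology unit_interval X) X H"
    and 0: "\<And>x. x \<in> topspace X \<Longrightarrow> H (0, x) = x"
    and 1: "\<And>x. x \<in> topspace X \<Longrightarrow> H (1, x) \<in> P"
    and P: "\<And>x. x \<in> P \<Longrightarrow> H (1, x) = x" "P \<subseteq> topspace X"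
  shows "X homotopy_equivalent_space subtopology X P"
proof -
  let ?r = "\<lambda>x. H (1, x)"
  have hom: "homotopic_with (\<lambda>h. True) X X id ?r"
    by (subst homotopic_with) (auto intro!: exI[of _ H] simp: H 0)
  then have "continuous_map X X ?r" using homotopic_with_imp_continuous_maps by blast
  then have r: "continuous_map X (subtopology X P) ?r"
    using 1 by (auto simp: continuous_map_in_subtopology)
  have i: "continuous_map (subtopology X P) X id" by (simp add: continuous_map_from_subtopology)
  have "homotopic_with (\<lambda>h. True) (subtopology X P) (subtopology X P) (?r \<circ> id) id"
    by (rule homotopic_with_equal) (use P(1) continuous_map_compose[OF i r] in auto)
  moreover have "homotopic_with (\<lambda>h. True) X X (id \<circ> ?r) id"
    using hom homotopic_with_sym by (simp add: homotopic_with_sym)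
  ultimately show ?thesis
    unfolding homotopy_equivalent_space_def using r i by blast
qed

text \<open>The track of the point \<open>x\<close> under the homotopy is a connected set.\<close>

lemma homotopic_connected_component:
  assumes "homotopic_with (\<lambda>h. True) X Y f g" "x \<in> topspace X"
  shows "connected_component_of Y (f x) (g x)"
proof -
  obtain h where h: "continuous_map (prod_topology unit_interval X) Y h"
    "\<And>x. h (0, x) = f x" "\<And>x. h (1, x) = g x"
    using assms(1) unfolding homotopic_with_def by auto
  have "connectedin unit_interval {0..1}"
    by (simp add: connectedin_subtopology)
  then have "connectedin (prod_topology unit_interval X) ({0..1} \<times> {x})"
    using assms(2) by (simp add: connectedin_Times connectedin_sing)
  then have "connectedin Y (h ` ({0..1} \<times> {x}))" using connectedin_continuous_map_image h(1) by blast
  moreover have "f x \<in> h ` ({0..1} \<times> {x})" "g x \<in> h ` ({0..1} \<times> {x})"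
    using image_eqI[of "f x" h "(0, x)"] image_eqI[of "g x" h "(1, x)"] h(2)[of x] h(3)[of x] by auto
  ultimately show ?thesis unfolding connected_component_of_def by blast
qed

text \<open>Continuous maps act on components through chosen representatives, and homotopic maps act
  equally, so the two actions are mutually inverse.\<close>

lemma num_components_homotopy_equivalent:
  assumes "X homotopy_equivalent_space Y"
  shows "num_components X = num_components Y"
proof -
  obtain f g where f: "continuous_map X Y f" and g: "continuous_map Y X g"
    and gf: "homotopic_with (\<lambda>x. True) X X (g \<circ> f) id"
    and fg: "homotopic_with (\<lambda>x. True) Y Y (f \<circ> g) id"
    using assms unfolding homotopy_equivalent_space_def by blast
  let ?cX = "connected_component_of_set X" and ?cY = "connected_component_of_set Y"
  define F where "F C = ?cY (f (SOME x. x \<in> C))" for C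
  define G where "G C = ?cX (g (SOME y. y \<in> C))" for C
  have some: "connected_component_of Z x (SOME z. z \<in> connected_component_of_set Z x)" if "x \<in> topspace Z" for Z :: "'z topology" and x
    using someI[of "\<lambda>z. z \<in> connected_component_of_set Z x" x] that by (simp add: connected_component_of_refl)
  have F: "F (?cX x) = ?cY (f x)" if "x \<in> topspace X" for x
    using connected_component_of_continuous_image[OF f some[OF that]] connected_component_of_equiv
    unfolding F_def by metis
  have G: "G (?cY y) = ?cX (g y)" if "y \<in> topspace Y" for y
    using connected_component_of_continuous_image[OF g some[OF that]] connected_component_of_equiv
    unfolding G_def by metis
  have fY: "f x \<in> topspace Y" if "x \<in> topspace X" for x using f that by (auto simp: continuous_map_def)
  have gX: "g y \<in> topspace X" if "y \<in> topspace Y" for y using g that by (auto simp: continuous_map_def)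
  have GF: "?cX (g (f x)) = ?cX x" if "x \<in> topspace X" for x
    using iffD1[OF connected_component_of_equiv homotopic_connected_component[OF gf that]] by simp
  have FG: "?cY (f (g y)) = ?cY y" if "y \<in> topspace Y" for y
    using iffD1[OF connected_component_of_equiv homotopic_connected_component[OF fg that]] by simp
  have "bij_betw F (connected_components_of X) (connected_components_of Y)"
    by (rule bij_betw_byWitness[where f'=G])
      (auto simp: connected_components_of_def F G fY gX GF FG)
  then show ?thesis unfolding num_components_def by (rule bij_betw_same_card)
qed

text \<open>A half-open arc hanging on \<open>Q\<close> shrinks to its foot
  \<open>\<gamma> 0\<close> by scaling the parameter. Injectivity on the closed interval, missing
  end included, makes the parameter a continuous function of the point.\<close>

lemma whisker_homotopy_equivalent:
  assumes X: "Hausdorff_space X" and c: "continuous_map unit_interval X \<gamma>" and inj: "inj_on \<gamma> {0..1}"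
    and Q: "Q \<subseteq> topspace X" "Q \<inter> \<gamma> ` {0..<1} = {\<gamma> 0}" and Z: "Z = Q \<union> \<gamma> ` {0..<1}"
    and cl: "closedin (subtopology X Z) Q" "closedin (subtopology X Z) (\<gamma> ` {0..<1})"
  shows "subtopology X Z homotopy_equivalent_space subtopology X Q"
proof -
  let ?I = "unit_interval" and ?Z = "subtopology X Z" and ?L = "\<gamma> ` {0..<1}"
  have "homeomorphic_map ?I (subtopology X (\<gamma> ` {0..1})) \<gamma>"
    using path_arc_homeomorphic(1)[OF X c _ _ _ inj] by simp
  then obtain \<phi> where "homeomorphic_maps ?I (subtopology X (\<gamma> ` {0..1})) \<gamma> \<phi>"
    using homeomorphic_map_maps by blast
  then have phi: "continuous_map (subtopology X (\<gamma> ` {0..1})) ?I \<phi>" "\<And>u. u \<in> {0..1} \<Longrightarrow> \<phi> (\<gamma> u) = u"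
    by (auto simp: homeomorphic_maps_def)
  have LX: "?L \<subseteq> topspace X" using c by (auto simp: continuous_map_def Pi_iff)
  have ZX: "topspace ?Z = Z" using Q(1) LX Z by auto
  define H where "H = (\<lambda>(s, x). if x \<in> ?L then \<gamma> ((1 - s) * \<phi> x) else x)"
  have inL: "\<gamma> ((1 - s) * u) \<in> ?L" if "s \<in> {0..1}" "u \<in> {0..<1}" for s u
  proof -
    have "(1 - s) * u \<le> 1 * u" using that by (intro mult_right_mono) auto
    then show ?thesis using that by (intro imageI) auto
  qed
  \<comment> \<open>The two relatively closed pieces meet only in the foot, which stays fixed
    throughout the homotopy.\<close>
  have H: "continuous_map (prod_topology ?I ?Z) ?Z H"
  proof (rule pasting_lemma_closed[where I="UNIV :: bool set" and T="\<lambda>b. {0..1} \<times> (if b then ?L else Q)"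
          and f="\<lambda>b. if b then (\<lambda>(s, x). \<gamma> ((1 - s) * \<phi> x)) else snd"])
    show "closedin (prod_topology ?I ?Z) ({0..1} \<times> (if b then ?L else Q))" for b
      using cl by (simp add: closedin_prod_Times_iff)
    show "continuous_map (subtopology (prod_topology ?I ?Z) ({0..1} \<times> (if b then ?L else Q))) ?Z
        (if b then (\<lambda>(s, x). \<gamma> ((1 - s) * \<phi> x)) else snd)" for b
    proof (cases b)
      case True
      have sub: "subtopology (prod_topology ?I ?Z) ({0..1} \<times> ?L) = prod_topology ?I (subtopology X ?L)"
        using Z by (simp add: subtopology_Times subtopology_subtopology Int_absorb1 del: prod_topology_subtopology_eu)
      have "continuous_map (subtopology X ?L) ?I \<phi>"
        by (rule continuous_map_from_subtopology_mono[OF phi(1)]) auto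
      then have "continuous_map (prod_topology ?I (subtopology X ?L)) ?I (\<phi> \<circ> snd)"
        by (rule continuous_map_compose[OF continuous_map_snd])
      then have c1: "continuous_map (prod_topology ?I (subtopology X ?L)) euclideanreal (\<lambda>z. \<phi> (snd z))"
        by (simp add: continuous_map_in_subtopology o_def)
      have c2: "continuous_map (prod_topology ?I (subtopology X ?L)) euclideanreal fst"
        using continuous_map_fst[of ?I "subtopology X ?L"] by (simp add: continuous_map_in_subtopology)
      have c3: "continuous_map (prod_topology ?I (subtopology X ?L)) euclideanreal (\<lambda>z. (1 - fst z) * \<phi> (snd z))"
        by (intro continuous_map_real_mult continuous_map_diff c1 c2) simp
      have "continuous_map (prod_topology ?I (subtopology X ?L)) ?I (\<lambda>z. (1 - fst z) * \<phi> (snd z))"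
        unfolding continuous_map_in_subtopology
      proof (intro conjI c3)
        show "(\<lambda>z. (1 - fst z) * \<phi> (snd z)) \<in> topspace (prod_topology ?I (subtopology X ?L)) \<rightarrow> {0..1}"
          using phi(2) by (auto intro!: mult_le_one)
      qed
      from continuous_map_compose[OF this c]
      have "continuous_map (prod_topology ?I (subtopology X ?L)) X (\<lambda>(s, x). \<gamma> ((1 - s) * \<phi> x))"
        by (simp add: o_def case_prod_unfold)
      moreover have "(\<lambda>(s, x). \<gamma> ((1 - s) * \<phi> x)) \<in> topspace (prod_topology ?I (subtopology X ?L)) \<rightarrow> Z"
      proof
        fix z assume z: "z \<in> topspace (prod_topology ?I (subtopology X ?L))"
        then obtain s u where "z = (s, \<gamma> u)" "s \<in> {0..1}" "u \<in> {0..<1}" by auto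
        then show "(case z of (s, x) \<Rightarrow> \<gamma> ((1 - s) * \<phi> x)) \<in> Z"
          using inL[of s u] phi(2)[of u] Z by auto
      qed
      ultimately show ?thesis using True unfolding sub by (simp add: sub continuous_map_in_subtopology)
    next
      case False
      then show ?thesis
        using continuous_map_from_subtopology[OF continuous_map_snd[of ?I ?Z]] by simp
    qed
    have eq: "\<gamma> ((1 - s) * \<phi> x) = x" if "x \<in> Q" "x \<in> ?L" for s x
    proof -
      have "x = \<gamma> 0" using that Q(2) by blast
      then show ?thesis using phi(2)[of 0] by simp
    qed
    show "(if i then (\<lambda>(s, x). \<gamma> ((1 - s) * \<phi> x)) else snd) z = (if j then (\<lambda>(s, x). \<gamma> ((1 - s) * \<phi> x)) else snd) z"
      if z: "z \<in> topspace (prod_topology ?I ?Z) \<inter> ({0..1} \<times> (if i then ?L else Q)) \<inter> ({0..1} \<times> (if j then ?L else Q))" for i j z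
    proof (cases "i = j")
      case False
      obtain s x where sx: "z = (s, x)" by (cases z)
      have "x \<in> Q" "x \<in> ?L" using z False unfolding sx by (auto split: if_splits)
      from eq[OF this] show ?thesis using False unfolding sx by auto
    qed simp
    show "\<exists>j. j \<in> UNIV \<and> z \<in> {0..1} \<times> (if j then ?L else Q) \<and>
        H z = (if j then (\<lambda>(s, x). \<gamma> ((1 - s) * \<phi> x)) else snd) z"
      if "z \<in> topspace (prod_topology ?I ?Z)" for z
    proof -
      obtain s x where sx: "z = (s, x)" by (cases z)
      have "s \<in> {0..1}" "x \<in> Q \<union> ?L" using that ZX Z unfolding sx by auto
      then show ?thesis unfolding sx H_def by (intro exI[of _ "x \<in> ?L"]) auto
    qed
  qed auto
  have "?Z homotopy_equivalent_space subtopology ?Z Q"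
  proof (rule deformation_homotopy_equivalent[OF H])
    fix x
    show "H (0, x) = x" using phi(2) by (auto simp: H_def)
    show "H (1, x) \<in> Q" if "x \<in> topspace ?Z"
      using that ZX Z Q(2) by (auto simp: H_def)
    show "H (1, x) = x" if x: "x \<in> Q"
    proof (cases "x \<in> ?L")
      case True
      then have "x = \<gamma> 0" using x Q(2) by blast
      then show ?thesis using True by (simp add: H_def)
    qed (simp add: H_def)
    show "Q \<subseteq> topspace ?Z" using ZX Z by auto
  qed
  moreover have "subtopology ?Z Q = subtopology X Q" using Z by (simp add: subtopology_subset)
  ultimately show ?thesis by simp
qed

section \<open>The Euler characteristic of a graph\<close>

lemma echar_homotopy_equivalent:
  assumes "X homotopy_equivalent_space Y"
  shows "fin_hom X {} \<longleftrightarrow> fin_hom Y {}" "echar X {} = echar Y {}"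
  unfolding fin_hom_def echar_def using hrank_homotopy_equivalent[OF assms] by auto

text \<open>For a loop, \<open>g\<close> is not injective on the closed interval. But it is a closed
  map, and stays one when restricted to the full preimage of the open arc, which by
  \<open>ends\<close> is exactly the open interval.\<close>

lemma open_arc_Euclidean:
  assumes X: "Hausdorff_space X" and g: "continuous_map unit_interval X g" and inj: "inj_on g {0<..<1}"
    and ends: "g 0 \<notin> g ` {0<..<1}" "g 1 \<notin> g ` {0<..<1}"
  shows "subtopology X (g ` {0<..<1}) homeomorphic_space Euclidean_space 1"
proof -
  let ?D = "g ` {0<..<1::real}"
  have "compact_space unit_interval" by (simp add: compact_space_subtopology)
  then have cl: "closed_map unit_interval X g" using continuous_imp_closed_map g X by blast
  have pre: "{x \<in> topspace unit_interval. g x \<in> ?D} = {0<..<1}"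
  proof
    show "{x \<in> topspace unit_interval. g x \<in> ?D} \<subseteq> {0<..<1}"
    proof
      fix x assume "x \<in> {x \<in> topspace unit_interval. g x \<in> ?D}"
      then have "0 \<le> x" "x \<le> 1" "x \<noteq> 0" "x \<noteq> 1" using ends by auto
      then show "x \<in> {0<..<1}" by auto
    qed
  qed auto
  have sub: "subtopology unit_interval {0<..<1} = top_of_set {0<..<1}"
    by (simp add: subtopology_subtopology Int_absorb1 greaterThanLessThan_subseteq_atLeastAtMost_iff)
  have DX: "?D \<subseteq> topspace X" using g by (auto simp: continuous_map_def Pi_iff)
  have "homeomorphic_map (top_of_set {0<..<1::real}) (subtopology X ?D) g"
  proof (rule bijective_closed_imp_homeomorphic_map)
    show "continuous_map (top_of_set {0<..<1}) (subtopology X ?D) g"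
      using continuous_map_from_subtopology[OF g, of "{0<..<1}"] unfolding sub
      by (auto simp: continuous_map_in_subtopology)
    show "closed_map (top_of_set {0<..<1}) (subtopology X ?D) g"
      using closed_map_restriction[OF cl pre] unfolding sub .
    show "g ` topspace (top_of_set {0<..<1}) = topspace (subtopology X ?D)" using DX by auto
    show "inj_on g (topspace (top_of_set {0<..<1}))" using inj by simp
  qed
  then have 1: "subtopology X ?D homeomorphic_space top_of_set {0<..<1::real}"
    using homeomorphic_map_imp_homeomorphic_space homeomorphic_space_sym by blast
  have 2: "top_of_set {0<..<1::real} homeomorphic_space euclideanreal"
    using homeomorphic_imp_homeomorphic_space[OF homeomorphic_open_interval_UNIV[of 0 1]] by simp
  have 3: "euclideanreal homeomorphic_space Euclidean_space 1"
    unfolding homeomorphic_space_def by (intro exI) (rule homeomorphic_maps_real_Euclidean_space)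
  show ?thesis by (rule homeomorphic_space_trans[OF homeomorphic_space_trans[OF 1 2] 3])
qed

text \<open>The inside of the edge is open in the graph and one-dimensional, so removing its
  midpoint shifts by +1. The two half-open remnants then retract one after the other onto
  \<open>P\<close>.\<close>

lemma euler_shift_graph_edge:
  assumes X: "Hausdorff_space X" and g: "continuous_map unit_interval X g" and inj: "inj_on g {0<..<1}"
    and P: "closedin X P" "g 0 \<in> P" "g 1 \<in> P" "P \<inter> g ` {0<..<1} = {}"
  shows "euler_shift X (P \<union> g ` {0<..<1}) P 1"
proof -
  let ?D = "g ` {0<..<1::real}"
  define P' where "P' = P \<union> ?D"
  define m where "m = g (1/2)"
  have ends: "g 0 \<notin> ?D" "g 1 \<notin> ?D" using P by blast+
  have gX: "g u \<in> topspace X" if "0 \<le> u" "u \<le> 1" for u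
    using g that by (auto simp: continuous_map_def Pi_iff)
  have PX: "P \<subseteq> topspace X" using P closedin_subset by blast
  have P'X: "P' \<subseteq> topspace X" using PX gX by (auto simp: P'_def)
  have mD: "m \<in> ?D" by (auto simp: m_def)
  let ?X = "subtopology X P'"
  have top: "topspace ?X = P'" using P'X by auto
  have DP: "?D = P' - P" using P(4) by (auto simp: P'_def)
  have subD: "subtopology ?X ?D = subtopology X ?D"
    by (simp add: subtopology_subtopology Int_absorb1 P'_def)
  have "closedin ?X P" using P(1) by (simp add: P'_def closedin_subset_topspace)
  then have "openin ?X (topspace ?X - P)" by blast
  then have oD: "openin ?X ?D" unfolding DP top .
  have hD: "subtopology ?X ?D homeomorphic_space Euclidean_space 1"
    unfolding subD by (rule open_arc_Euclidean[OF X g inj ends])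
  have "openin ?X P'" using openin_topspace[of ?X] top by simp
  then have "euler_shift ?X P' (P' - {m}) (if (1::nat) = 1 then 1 else - 1)"
    by (rule euler_shift_remove_point[OF Hausdorff_space_subtopology[OF X] _ _ oD mD hD])
      (use mD in \<open>auto simp: P'_def\<close>)
  then have s: "euler_shift X P' (P' - {m}) 1"
    by (simp add: euler_shift_def subtopology_subtopology Int_absorb1)
  have injh: "g u \<noteq> g v" if "u \<in> {0<..<1}" "v \<in> {0..1}" "u \<noteq> v" for u v
  proof
    assume "g u = g v"
    then have "v \<noteq> 0" "v \<noteq> 1" using ends that(1) by (metis imageI)+
    then have "v \<in> {0<..<1}" using that by auto
    then show False using inj_onD[OF inj \<open>g u = g v\<close>] that by blast
  qed
  define L where "L = g ` {0..<1/2}"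
  define R where "R = g ` {1/2<..1}"
  note gcl = path_segment_closed[OF X g]
  have Leq: "g ` {0..1/2} = insert m L" and Req: "g ` {1/2..1} = insert m R"
  proof -
    have "{0..1/2::real} = insert (1/2) {0..<1/2}" "{1/2..1::real} = insert (1/2) {1/2<..1}" by auto
    then show "g ` {0..1/2} = insert m L" "g ` {1/2..1} = insert m R"
      unfolding L_def R_def m_def by (metis image_insert)+
  qed
  have mP: "m \<notin> P" using mD P(4) by blast
  have mA: "m \<notin> g ` A" if "A \<subseteq> {0..1} - {1/2}" for A
  proof
    assume "m \<in> g ` A"
    then obtain v where v: "v \<in> A" "m = g v" by blast
    have "v \<in> {0..1}" "1/2 \<noteq> v" using subsetD[OF that v(1)] by auto
    then show False using injh[of "1/2" v] v(2) unfolding m_def by simp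
  qed
  have mL: "m \<notin> L" and mR: "m \<notin> R" unfolding L_def R_def by (rule mA; force)+
  \<comment> \<open>For a loop the two halves share their foot \<open>g 0 = g 1\<close>.\<close>
  have LR: "L \<inter> R \<subseteq> {g 0}"
  proof
    fix x assume "x \<in> L \<inter> R"
    then obtain u v where uv: "u \<in> {0..<1/2}" "x = g u" "v \<in> {1/2<..1}" "x = g v"
      unfolding L_def R_def by (metis IntE imageE)
    then have "u = 0" using injh[of u v] by force
    then show "x \<in> {g 0}" using uv by simp
  qed
  have PL: "P \<inter> L = {g 0}"
  proof -
    have "{0..<1/2::real} \<subseteq> insert 0 {0<..<1}" by auto
    then have "L \<subseteq> insert (g 0) ?D" unfolding L_def by (metis image_insert image_mono)
    moreover have "g 0 \<in> L" unfolding L_def by auto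
    ultimately show ?thesis using P(2,4) by blast
  qed
  have PR: "P \<inter> R = {g 1}"
  proof -
    have "{1/2<..1::real} \<subseteq> insert 1 {0<..<1}" by auto
    then have "R \<subseteq> insert (g 1) ?D" unfolding R_def by (metis image_insert image_mono)
    moreover have "g 1 \<in> R" unfolding R_def by auto
    ultimately show ?thesis using P(3,4) by blast
  qed
  have Z: "P' - {m} = P \<union> R \<union> L"
  proof -
    have "{0<..<1::real} = insert (1/2) ({0..<1/2} - {0} \<union> ({1/2<..1} - {1}))" by auto
    then have "?D = insert m (g ` ({0..<1/2} - {0}) \<union> g ` ({1/2<..1} - {1}))"
      unfolding m_def by (simp only: image_insert image_Un)
    then have "?D \<subseteq> insert m (L \<union> R)" unfolding L_def R_def by auto
    moreover have "{0..<1/2::real} \<subseteq> insert 0 {0<..<1}" "{1/2<..1::real} \<subseteq> insert 1 {0<..<1}" by auto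
    then have "L \<subseteq> insert (g 0) ?D" "R \<subseteq> insert (g 1) ?D" unfolding L_def R_def by (metis image_insert image_mono)+
    ultimately show ?thesis unfolding P'_def using P(2,3) mP mL mR by blast
  qed
  have aff: "continuous_map unit_interval X (\<lambda>u. g (a u))"
    if "continuous_on {0..1} a" "a ` {0..1} \<subseteq> {0..1}" for a :: "real \<Rightarrow> real"
  proof -
    have "continuous_map unit_interval unit_interval a"
      using that by (auto simp: continuous_map_in_subtopology)
    from continuous_map_compose[OF this g] show ?thesis by (simp add: o_def)
  qed
  have s1: "subtopology X (P \<union> R \<union> L) homotopy_equivalent_space subtopology X (P \<union> R)"
  proof (rule whisker_homotopy_equivalent[where \<gamma>="\<lambda>u. g (u / 2)"])
    have im: "(\<lambda>u. g (u / 2)) ` {0..<1} = L"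
    proof -
      have "(\<lambda>u::real. u / 2) ` {0..<1} = {0..<1/2}"
      proof (intro equalityI subsetI)
        fix x :: real assume "x \<in> {0..<1/2}"
        then show "x \<in> (\<lambda>u. u / 2) ` {0..<1}"
          by (intro image_eqI[of _ _ "2 * x"]) auto
      qed auto
      then show ?thesis unfolding L_def by (metis image_image)
    qed
    show "continuous_map unit_interval X (\<lambda>u. g (u / 2))"
      by (rule aff) (auto intro!: continuous_intros)
    show "inj_on (\<lambda>u. g (u / 2)) {0..1}"
    proof (rule inj_onI)
      fix u v :: real assume uv: "u \<in> {0..1}" "v \<in> {0..1}" "g (u / 2) = g (v / 2)"
      show "u = v"
      proof (rule ccontr)
        assume "u \<noteq> v"
        then have "u > 0 \<or> v > 0" using uv by auto
        then show False using injh[of "u/2" "v/2"] injh[of "v/2" "u/2"] uv \<open>u \<noteq> v\<close> by auto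
      qed
    qed
    show "P \<union> R \<subseteq> topspace X" "P \<union> R \<union> L = P \<union> R \<union> (\<lambda>u. g (u / 2)) ` {0..<1}"
      using Z P'X im by auto
    show "(P \<union> R) \<inter> (\<lambda>u. g (u / 2)) ` {0..<1} = {g (0 / 2)}" unfolding im using PL LR by auto
    \<comment> \<open>Up to the deleted point \<open>m\<close> the half-open pieces are compact
      segments, hence they are closed in the space without \<open>m\<close>.\<close>
    have "P \<union> R = (P \<union> R \<union> L) \<inter> (P \<union> g ` {1/2..1})" unfolding Req using mL mR mP by blast
    moreover have "closedin X (P \<union> g ` {1/2..1})" by (intro closedin_Un P gcl) auto
    ultimately show "closedin (subtopology X (P \<union> R \<union> L)) (P \<union> R)"
      by (metis closedin_subtopology_Int_closed)
    have "L = (P \<union> R \<union> L) \<inter> g ` {0..1/2}" unfolding Leq using mL mR mP by blast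
    moreover have "closedin X (g ` {0..1/2})" by (intro gcl) auto
    ultimately show "closedin (subtopology X (P \<union> R \<union> L)) ((\<lambda>u. g (u / 2)) ` {0..<1})"
      unfolding im by (metis closedin_subtopology_Int_closed)
  qed (rule X)
  have s2: "subtopology X (P \<union> R) homotopy_equivalent_space subtopology X P"
  proof (rule whisker_homotopy_equivalent[where \<gamma>="\<lambda>u. g (1 - u / 2)"])
    have im: "(\<lambda>u. g (1 - u / 2)) ` {0..<1} = R"
    proof -
      have "(\<lambda>u::real. 1 - u / 2) ` {0..<1} = {1/2<..1}"
      proof (intro equalityI subsetI)
        fix x :: real assume "x \<in> {1/2<..1}"
        then show "x \<in> (\<lambda>u. 1 - u / 2) ` {0..<1}"
          by (intro image_eqI[of _ _ "2 * (1 - x)"]) (auto simp: field_simps)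
      qed auto
      then show ?thesis unfolding R_def by (metis image_image)
    qed
    show "continuous_map unit_interval X (\<lambda>u. g (1 - u / 2))"
      by (rule aff) (auto intro!: continuous_intros)
    show "inj_on (\<lambda>u. g (1 - u / 2)) {0..1}"
    proof (rule inj_onI)
      fix u v :: real assume uv: "u \<in> {0..1}" "v \<in> {0..1}" "g (1 - u / 2) = g (1 - v / 2)"
      show "u = v"
      proof (rule ccontr)
        assume "u \<noteq> v"
        then have "u > 0 \<or> v > 0" using uv by auto
        then show False using injh[of "1-u/2" "1-v/2"] injh[of "1-v/2" "1-u/2"] uv \<open>u \<noteq> v\<close> by auto
      qed
    qed
    show "P \<subseteq> topspace X" "P \<union> R = P \<union> (\<lambda>u. g (1 - u / 2)) ` {0..<1}"
      using PX im by auto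
    show "P \<inter> (\<lambda>u. g (1 - u / 2)) ` {0..<1} = {g (1 - 0 / 2)}" unfolding im using PR by auto
    show "closedin (subtopology X (P \<union> R)) P" using P(1) by (simp add: closedin_subset_topspace)
    have "R = (P \<union> R) \<inter> g ` {1/2..1}" unfolding Req using mL mR mP by blast
    moreover have "closedin X (g ` {1/2..1})" by (intro gcl) auto
    ultimately show "closedin (subtopology X (P \<union> R)) ((\<lambda>u. g (1 - u / 2)) ` {0..<1})"
      unfolding im by (metis closedin_subtopology_Int_closed)
  qed (rule X)
  show ?thesis
    using s echar_homotopy_equivalent[OF s1] echar_homotopy_equivalent[OF s2]
    unfolding euler_shift_def Z P'_def[symmetric] by simp
qed

text \<open>Each point of a finite Hausdorff space is open, hence has a Euclidean neighbourhood of
  dimension 0.\<close>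

lemma finite_set_euler:
  assumes X: "Hausdorff_space X" and "finite W" "W \<subseteq> topspace X"
  shows "fin_hom (subtopology X W) {} \<and> echar (subtopology X W) {} = int (card W)"
  using assms(2,3)
proof (induction W rule: finite_induct)
  case empty
  have "hrank p (subtopology X {}) {} = 0" for p by (rule hrank_empty) auto
  then show ?case unfolding fin_hom_def echar_def by (simp add: zero_enat_def)
next
  case (insert a W)
  let ?X = "subtopology X (insert a W)"
  have top: "topspace ?X = insert a W" using insert by auto
  have H: "Hausdorff_space ?X" by (rule Hausdorff_space_subtopology[OF X])
  have "closedin ?X W"
    using insert top H by (intro compactin_imp_closedin finite_imp_compactin) auto
  then have "openin ?X (topspace ?X - W)" by blast
  then have oa: "openin ?X {a}" using insert.hyps top by (simp add: insert_Diff_if)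
  have hom: "subtopology ?X {a} homeomorphic_space Euclidean_space 0"
  proof -
    have "homeomorphic_maps (subtopology ?X {a}) (Euclidean_space 0) (\<lambda>x i. 0) (\<lambda>x. a)"
      using insert.prems by (auto simp: homeomorphic_maps_def continuous_map_in_subtopology topspace_Euclidean_space)
    then show ?thesis unfolding homeomorphic_space_def by blast
  qed
  have "euler_shift ?X (insert a W) (insert a W - {a}) (if (0::nat) = 1 then 1 else - 1)"
    by (rule euler_shift_remove_point[OF H _ _ oa _ hom])
      (use top openin_topspace[of ?X] in auto)
  moreover have "subtopology ?X W = subtopology X W" "subtopology ?X (insert a W) = ?X"
    by (auto simp: subtopology_subtopology Int_absorb1 subset_insertI)
  moreover have "insert a W - {a} = W" using insert.hyps by auto
  ultimately have "fin_hom ?X {} \<longleftrightarrow> fin_hom (subtopology X W) {}"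
    "fin_hom ?X {} \<Longrightarrow> echar (subtopology X W) {} = echar ?X {} - 1"
    unfolding euler_shift_def by auto
  then show ?case using insert by simp
qed

theorem graph_euler:
  assumes X: "Hausdorff_space S" and G: "drawn_graph S V E" and A: "A \<subseteq> E"
  shows "fin_hom (subtopology S (V \<union> \<Union>A)) {}"
    "echar (subtopology S (V \<union> \<Union>A)) {} = int (card V) - int (card A)"
proof -
  have V: "finite V" "V \<subseteq> topspace S" and E: "finite E"
    and disj: "\<And>e e'. e \<in> E \<Longrightarrow> e' \<in> E \<Longrightarrow> e \<noteq> e' \<Longrightarrow> e \<inter> e' \<subseteq> V"
    using G by (auto simp: drawn_graph_def)
  have "finite A" using A E finite_subset by auto
  then have "A \<subseteq> E \<Longrightarrow> fin_hom (subtopology S (V \<union> \<Union>A)) {} \<and> echar (subtopology S (V \<union> \<Union>A)) {} = int (card V) - int (card A)"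
  proof (induction A rule: finite_induct)
    case empty then show ?case using finite_set_euler[OF X V] by simp
  next
    case (insert e A)
    let ?P = "V \<union> \<Union>A"
    have eE: "e \<in> E" using insert.prems by auto
    obtain g where g: "continuous_map unit_interval S g" "inj_on g {0<..<1}"
      "g 0 \<in> V" "g 1 \<in> V" "g ` {0<..<1} \<inter> V = {}" "e = g ` {0<..<1} \<union> {g 0, g 1}" "e - V = g ` {0<..<1}"
      by (rule drawn_graph_edgeE[OF G eE])
    have "e \<inter> \<Union>A \<subseteq> V" using disj insert by blast
    then have "?P \<inter> g ` {0<..<1} = {}" using g(6,5) by auto
    moreover have "closedin S ?P"
      using drawn_set_compact[OF G, of A] insert.prems X compactin_imp_closedin by auto
    ultimately have "euler_shift S (?P \<union> g ` {0<..<1}) ?P 1"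
      using g by (intro euler_shift_graph_edge X) auto
    moreover have "?P \<union> g ` {0<..<1} = V \<union> \<Union>(insert e A)"
      using g(3-6) by auto
    ultimately have step: "euler_shift S (V \<union> \<Union>(insert e A)) ?P 1" by (simp only:)
    have "fin_hom (subtopology S ?P) {}" "echar (subtopology S ?P) {} = int (card V) - int (card A)"
      using insert.IH insert.prems by simp_all
    with step show ?case using insert.hyps unfolding euler_shift_def by auto
  qed
  then show "fin_hom (subtopology S (V \<union> \<Union>A)) {}"
    "echar (subtopology S (V \<union> \<Union>A)) {} = int (card V) - int (card A)" using A by auto
qed

section \<open>Connected components\<close>

text \<open>Functions with the same fibres on \<open>V\<close> have equally many values; this is how
  components are counted through representatives.\<close>

lemma card_image_cong_kernel:
  assumes "\<And>u v. u \<in> V \<Longrightarrow> v \<in> V \<Longrightarrow> h u = h v \<longleftrightarrow> k u = k v"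
  shows "card (h ` V) = card (k ` V)"
proof -
  define F where "F = (\<lambda>c. k (inv_into V h c))"
  define G where "G = (\<lambda>c. h (inv_into V k c))"
  have F: "F (h v) = k v" if "v \<in> V" for v
    unfolding F_def using that assms[of "inv_into V h (h v)" v]
    by (metis f_inv_into_f imageI inv_into_into)
  have G: "G (k v) = h v" if "v \<in> V" for v
    unfolding G_def using that assms[of "inv_into V k (k v)" v]
    by (metis f_inv_into_f imageI inv_into_into)
  have "bij_betw F (h ` V) (k ` V)"
    by (rule bij_betw_byWitness[where f'=G]) (auto simp: F G)
  then show ?thesis by (rule bij_betw_same_card)
qed

lemma connected_component_of_setD:
  "connected_component_of X x y \<Longrightarrow> connected_component_of_set X x = connected_component_of_set X y"
  using iffD1[OF connected_component_of_equiv] by metis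

lemma connected_component_of_set_eq_iff:
  assumes "x \<in> topspace X" "y \<in> topspace X"
  shows "connected_component_of_set X x = connected_component_of_set X y \<longleftrightarrow> connected_component_of X x y"
  using assms connected_component_of_setD[of X x y] connected_component_of_refl[of X y] by auto

text \<open>If a component \<open>C\<close> were separated by losing \<open>a\<close>, the connected
  set \<open>D - {a}\<close> would lie on one side, and adding \<open>a\<close> to that side would
  separate \<open>C\<close> itself.\<close>

lemma num_components_remove_point:
  assumes D: "openin X D" "a \<in> D" "connectedin X D" "connectedin X (D - {a})" "D - {a} \<noteq> {}"
    and a: "closedin X {a}"
  shows "num_components (subtopology X (topspace X - {a})) = num_components X"
proof -
  let ?U = "topspace X - {a}"
  let ?Y = "subtopology X ?U"
  have DX: "D \<subseteq> topspace X" using D openin_subset by blast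
  have "connected_component_of ?Y y z \<longleftrightarrow> connected_component_of X y z" if yz: "y \<in> ?U" "z \<in> ?U" for y z
  proof
    assume "connected_component_of ?Y y z"
    then show "connected_component_of X y z"
      unfolding connected_component_of_def connectedin_subtopology by blast
  next
    assume "connected_component_of X y z"
    define C where "C = connected_component_of_set X y"
    have C: "connectedin X C" "z \<in> C" "y \<in> C"
      using \<open>connected_component_of X y z\<close> yz
      by (auto simp: C_def connectedin_connected_component_of connected_component_of_refl)
    have "connectedin X (C - {a})"
    proof (cases "a \<in> C")
      case True
      then have DC: "D \<subseteq> C" using connected_component_of_maximal[OF D(3,2)]
        connected_component_of_setD[of X y a] unfolding C_def by auto
      show ?thesis
      proof (rule ccontr)
        assume "\<not> connectedin X (C - {a})"
        then obtain E1 E2 where E: "openin X E1" "openin X E2" "C - {a} \<subseteq> E1 \<union> E2" "E1 \<inter> E2 \<inter> (C - {a}) = {}"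
            "E1 \<inter> (C - {a}) \<noteq> {}" "E2 \<inter> (C - {a}) \<noteq> {}"
          using connectedin_subset_topspace[OF C(1)] unfolding connectedin by blast
        have main: False
          if E: "openin X E1" "openin X E2" "C - {a} \<subseteq> E1 \<union> E2" "E1 \<inter> E2 \<inter> (C - {a}) = {}"
            "E1 \<inter> (C - {a}) \<noteq> {}" "E2 \<inter> (C - {a}) \<noteq> {}" and DE: "D - {a} \<subseteq> E1" for E1 E2
        proof -
          have "openin X (E1 \<union> D)" "openin X (E2 - {a})" using E D a by auto
          moreover have "C \<subseteq> (E1 \<union> D) \<union> (E2 - {a})" using E(3) D(2) by blast
          moreover have "(E1 \<union> D) \<inter> (E2 - {a}) \<inter> C = {}" using E(4) DE by blast
          moreover have "(E1 \<union> D) \<inter> C \<noteq> {}" "(E2 - {a}) \<inter> C \<noteq> {}" using E(5,6) by blast+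
          ultimately show False using C(1) unfolding connectedin by meson
        qed
        have "D - {a} \<subseteq> E1 \<or> D - {a} \<subseteq> E2"
        proof (rule ccontr)
          assume "\<not> (D - {a} \<subseteq> E1 \<or> D - {a} \<subseteq> E2)"
          moreover have "D - {a} \<subseteq> E1 \<union> E2" "E1 \<inter> E2 \<inter> (D - {a}) = {}" using E DC by blast+
          ultimately have "E1 \<inter> (D - {a}) \<noteq> {}" "E2 \<inter> (D - {a}) \<noteq> {}" by blast+
          then show False using D(4) E(1,2) \<open>D - {a} \<subseteq> E1 \<union> E2\<close> \<open>E1 \<inter> E2 \<inter> (D - {a}) = {}\<close>
            unfolding connectedin by meson
        qed
        then show False
        proof
          assume "D - {a} \<subseteq> E1" then show False using main[OF E] by blast
        next
          assume "D - {a} \<subseteq> E2"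
          moreover have "C - {a} \<subseteq> E2 \<union> E1" "E2 \<inter> E1 \<inter> (C - {a}) = {}" using E(3,4) by blast+
          ultimately show False using main[OF E(2,1) _ _ E(6,5)] by blast
        qed
      qed
    qed (use C in simp)
    then have "connectedin ?Y (C - {a})"
      using connectedin_subset_topspace[OF C(1)] by (auto simp: connectedin_subtopology)
    then show "connected_component_of ?Y y z"
      unfolding connected_component_of_def using C yz by blast
  qed
  then have "connected_component_of_set ?Y y = connected_component_of_set ?Y z \<longleftrightarrow>
      connected_component_of_set X y = connected_component_of_set X z" if "y \<in> ?U" "z \<in> ?U" for y z
    using that connected_component_of_set_eq_iff[of y ?Y z] connected_component_of_set_eq_iff[of y X z] by auto
  then have "card (connected_component_of_set ?Y ` ?U) = card (connected_component_of_set X ` ?U)"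
    by (rule card_image_cong_kernel)
  \<comment> \<open>The component of \<open>a\<close> does not disappear: another point of
    \<open>D\<close> represents it.\<close>
  moreover have "connected_component_of_set X ` ?U = connected_component_of_set X ` topspace X"
  proof -
    obtain d where d: "d \<in> D - {a}" using D(5) by blast
    then have "connected_component_of X a d" unfolding connected_component_of_def using D by blast
    then have "connected_component_of_set X a = connected_component_of_set X d" by (rule connected_component_of_setD)
    then have "connected_component_of_set X a \<in> connected_component_of_set X ` ?U" using d DX by blast
    then show ?thesis by blast
  qed
  moreover have "topspace ?Y = ?U" by auto
  ultimately show ?thesis unfolding num_components_def connected_components_of_def by simp
qed

text \<open>A ball around the image of \<open>x\<close>, small enough to lie in the image of
  \<open>O'\<close>, is itself homeomorphic to the plane.\<close>

lemma planar_open_small: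
  assumes U: "openin X U" "x \<in> U" and W: "open (W :: (real \<times> real) set)" "subtopology X U homeomorphic_space top_of_set W"
    and O: "openin X O'" "x \<in> O'"
  obtains D where "planar_open X D" "x \<in> D" "D \<subseteq> O'"
proof -
  obtain f where f: "homeomorphic_map (subtopology X U) (top_of_set W) f"
    using W(2) homeomorphic_space by blast
  obtain g where fg: "homeomorphic_maps (subtopology X U) (top_of_set W) f g"
    using f homeomorphic_map_maps by blast
  have g: "homeomorphic_map (top_of_set W) (subtopology X U) g"
    using fg homeomorphic_map_maps homeomorphic_maps_sym by blast
  have UX: "U \<subseteq> topspace X" using U openin_subset by blast
  have top: "topspace (subtopology X U) = U" using UX by auto
  have fim: "f ` U = W" using homeomorphic_imp_surjective_map[OF f] top by simp
  have gf: "g (f y) = y" if "y \<in> U" for y using fg that top by (auto simp: homeomorphic_maps_def)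
  have "openin (subtopology X U) (U \<inter> O')" using O by (metis inf_commute openin_subtopology_Int)
  then have "openin (top_of_set W) (f ` (U \<inter> O'))"
    using homeomorphic_map_openness_eq[OF f] by blast
  then have "open (f ` (U \<inter> O'))" using W(1) openin_open_eq by blast
  moreover have "f x \<in> f ` (U \<inter> O')" using U O by blast
  ultimately obtain r where r: "r > 0" "ball (f x) r \<subseteq> f ` (U \<inter> O')"
    using open_contains_ball by blast
  define D where "D = g ` ball (f x) r"
  have bW: "ball (f x) r \<subseteq> W" using r fim by blast
  have DU: "D \<subseteq> U \<inter> O'"
  proof
    fix y assume "y \<in> D"
    then obtain z where z: "z \<in> ball (f x) r" "y = g z" by (auto simp: D_def)
    then obtain u where "u \<in> U \<inter> O'" "z = f u" using r by blast
    then show "y \<in> U \<inter> O'" using z gf by auto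
  qed
  have "openin (top_of_set W) (ball (f x) r)" using bW W by (simp add: openin_open_eq)
  then have "openin (subtopology X U) D" unfolding D_def using homeomorphic_map_openness_eq[OF g] by blast
  then have oD: "openin X D" using U(1) by (simp add: openin_open_subtopology)
  have "homeomorphic_map (subtopology (top_of_set W) (ball (f x) r)) (subtopology (subtopology X U) D) g"
    by (rule homeomorphic_map_subtopologies[OF g]) (use bW DU top in \<open>auto simp: D_def\<close>)
  moreover have "subtopology (top_of_set W) (ball (f x) r) = top_of_set (ball (f x) r)"
    "subtopology (subtopology X U) D = subtopology X D"
    using bW DU by (auto simp: subtopology_subtopology Int_absorb1)
  ultimately have 1: "subtopology X D homeomorphic_space top_of_set (ball (f x) r)"
    using homeomorphic_map_imp_homeomorphic_space homeomorphic_space_sym by metis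
  have "ball (f x) r homeomorphic (UNIV :: (real \<times> real) set)"
    using homeomorphic_trans[OF homeomorphic_balls(1)[OF r(1) zero_less_one, of "f x" 0] homeomorphic_ball01_UNIV] .
  then have 2: "top_of_set (ball (f x) r) homeomorphic_space plane"
    using homeomorphic_imp_homeomorphic_space by fastforce
  have "planar_open X D" unfolding planar_open_def using oD homeomorphic_space_trans[OF 1 2] by blast
  moreover have "x \<in> D" unfolding D_def using gf[OF U(2)] r(1) by (metis centre_in_ball imageI)
  ultimately show ?thesis using that DU by blast
qed

lemma planar_open_shrink:
  assumes "planar_open X D" "x \<in> D" "openin X O'" "x \<in> O'"
  obtains D' where "planar_open X D'" "x \<in> D'" "D' \<subseteq> O'"
proof -
  have "openin X D" "subtopology X D homeomorphic_space top_of_set (UNIV :: (real \<times> real) set)"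
    using assms by (auto simp: planar_open_def)
  then show ?thesis using planar_open_small[OF _ assms(2) open_UNIV _ assms(3,4)] that by blast
qed

lemma planar_open_connected:
  assumes D: "planar_open X D" "a \<in> D"
  shows "connectedin X D" "connectedin X (D - {a})" "D - {a} \<noteq> {}"
proof -
  obtain g where g: "homeomorphic_map plane (subtopology X D) g"
    and top: "topspace (subtopology X D) = D"
    by (rule planar_open_obtain[OF D(1)])
  have gim: "range g = D" and ginj: "inj g"
    using homeomorphic_imp_surjective_map[OF g] homeomorphic_imp_injective_map[OF g] top by auto
  have "continuous_map euclidean (subtopology X D) g" using homeomorphic_imp_continuous_map[OF g] .
  then have gc: "continuous_map euclidean X g" by (simp add: continuous_map_in_subtopology)
  obtain y where y: "g y = a" using gim D(2) by blast
  have gD: "g ` (- {y}) = D - {a}"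
    unfolding Compl_eq_Diff_UNIV using image_set_diff[OF ginj, of UNIV "{y}"] gim y by simp
  show "connectedin X D"
    using connectedin_continuous_map_image[OF gc, of UNIV] gim connected_UNIV[where 'a="real \<times> real"] by simp
  have "connected (- {y})" by (rule connected_punctured_universe) simp
  then show "connectedin X (D - {a})"
    using connectedin_continuous_map_image[OF gc, of "- {y}"] gD by simp
  have "y + (1, 1) \<noteq> y" by (simp add: prod_eq_iff)
  then show "D - {a} \<noteq> {}" using gD by blast
qed

text \<open>Accounts for the exponents of \<open>y\<close>: the Krushkal polynomial subtracts the
  number of components of \<open>S\<close>, the Las Vergnas polynomial that of the complement of
  \<open>V\<close>.\<close>

lemma num_components_remove_finite:
  assumes X: "Hausdorff_space X" and charts: "\<And>x. x \<in> topspace X \<Longrightarrow> \<exists>D. planar_open X D \<and> x \<in> D"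
    and "finite W" "W \<subseteq> topspace X"
  shows "num_components (subtopology X (topspace X - W)) = num_components X"
  using assms(3,4)
proof (induction W rule: finite_induct)
  case empty then show ?case by simp
next
  case (insert a W)
  let ?U = "topspace X - W"
  let ?Y = "subtopology X ?U"
  have cl: "closedin X W" using insert X by (intro compactin_imp_closedin finite_imp_compactin) auto
  then have oU: "openin X ?U" by blast
  have a: "a \<in> ?U" using insert by auto
  obtain D0 where "planar_open X D0" "a \<in> D0" using charts a by blast
  then obtain D where D: "planar_open X D" "a \<in> D" "D \<subseteq> ?U"
    by (rule planar_open_shrink[OF _ _ oU a])
  have top: "topspace ?Y = ?U" by auto
  have f1: "openin ?Y D" using D oU by (simp add: openin_open_subtopology planar_open_def)
  have f2: "connectedin ?Y D" "connectedin ?Y (D - {a})" "D - {a} \<noteq> {}"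
    using planar_open_connected[OF D(1,2)] D(3) by (auto simp: connectedin_subtopology)
  have f3: "closedin ?Y {a}"
    using closedin_Hausdorff_singleton[OF Hausdorff_space_subtopology[OF X], of a ?U] a top by simp
  have "num_components (subtopology ?Y (topspace ?Y - {a})) = num_components ?Y"
    by (rule num_components_remove_point[OF f1 D(2) f2 f3])
  moreover have "subtopology ?Y (topspace ?Y - {a}) = subtopology X (topspace X - insert a W)"
    unfolding top subtopology_subtopology by (rule arg_cong[of _ _ "subtopology X"]) auto
  ultimately show ?case using insert by simp
qed

text \<open>A class of vertices with all edges that meet it, and the remaining vertices and edges,
  are disjoint compact sets because edges meet only in vertices. Both are therefore open and closed,
  and no connected set joins two classes.\<close>

theorem num_components_graph:
  assumes X: "Hausdorff_space S" and G: "drawn_graph S V E" and A: "A \<subseteq> E"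
  shows "num_components (subtopology S (V \<union> \<Union>A)) = graph_components V A"
proof -
  have V: "finite V" "V \<subseteq> topspace S" and E: "finite E"
    and disj: "\<And>e e'. e \<in> E \<Longrightarrow> e' \<in> E \<Longrightarrow> e \<noteq> e' \<Longrightarrow> e \<inter> e' \<subseteq> V"
    using G by (auto simp: drawn_graph_def)
  define P where "P = V \<union> \<Union>A"
  let ?Y = "subtopology S P" and ?R = "(adjacency V A)\<^sup>*"
  have PS: "P \<subseteq> topspace S" using drawn_set_compact[OF G A] compactin_subset_topspace unfolding P_def by blast
  have top: "topspace ?Y = P" using PS by auto
  have VP: "V \<subseteq> P" by (auto simp: P_def)
  have edge: "connectedin ?Y e" "e \<inter> V \<noteq> {}" if "e \<in> A" for e
  proof -
    have eE: "e \<in> E" using that A by blast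
    obtain g where g: "continuous_map unit_interval S g" "e = g ` {0..1}" "g 0 \<in> V"
      by (rule drawn_graph_edgeE[OF G eE])
    have "connectedin S e" unfolding g(2)
      by (rule connectedin_continuous_map_image[OF g(1)]) (simp add: connectedin_subtopology)
    moreover have "e \<subseteq> P" using that by (auto simp: P_def)
    ultimately show "connectedin ?Y e" by (simp add: connectedin_subtopology)
    have "g 0 \<in> e" unfolding g(2) by simp
    then show "e \<inter> V \<noteq> {}" using g(3) by blast
  qed
  have comp_edge: "connected_component_of ?Y u v" if "e \<in> A" "u \<in> e" "v \<in> e" for e u v
    using edge(1)[OF that(1)] that unfolding connected_component_of_def by blast
  have symR: "sym ?R" by (intro sym_rtrancl) (auto simp: sym_def adjacency_def)
  have RV: "v \<in> V" if "(u, v) \<in> ?R" "u \<in> V" for u v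
    using that by (induction rule: rtrancl_induct) (auto simp: adjacency_def)
  have comp_R: "connected_component_of ?Y u v" if "(u, v) \<in> ?R" "u \<in> V" for u v
    using that
  proof (induction rule: rtrancl_induct)
    case base then show ?case using VP top by (auto simp: connected_component_of_refl)
  next
    case (step v w)
    then obtain e where "e \<in> A" "v \<in> e" "w \<in> e" by (auto simp: adjacency_def)
    then show ?case using comp_edge step connected_component_of_trans by metis
  qed
  have R_comp: "(u, v) \<in> ?R" if uv: "u \<in> V" "v \<in> V" "connected_component_of ?Y u v" for u v
  proof -
    define Q where "Q = ?R `` {u}"
    have QV: "Q \<subseteq> V" using RV uv by (auto simp: Q_def)
    define B where "B = {e \<in> A. e \<inter> Q \<noteq> {}}"
    have BQ: "e \<inter> V \<subseteq> Q" if "e \<in> B" for e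
    proof
      fix y assume y: "y \<in> e \<inter> V"
      obtain x where x: "x \<in> e" "x \<in> Q" using \<open>e \<in> B\<close> by (auto simp: B_def)
      then have "(x, y) \<in> adjacency V A" using y QV \<open>e \<in> B\<close> by (auto simp: adjacency_def B_def)
      then show "y \<in> Q" using x(2) by (auto simp: Q_def intro: rtrancl_into_rtrancl)
    qed
    have clW: "closedin ?Y (W \<union> \<Union>C)" if "W \<subseteq> V" "C \<subseteq> A" for W C
    proof -
      have "finite C" "finite W" using that A E V finite_subset by metis+
      then have "compactin S W" using that V by (simp add: finite_imp_compactin subset_trans)
      moreover have "compactin S (\<Union>C)"
        by (rule compactin_Union) (use \<open>finite C\<close> drawn_edge_compact[OF G] that A in auto)
      ultimately have "closedin S (W \<union> \<Union>C)" using X compactin_imp_closedin compactin_Un by blast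
      moreover have "W \<union> \<Union>C \<subseteq> P" using that by (auto simp: P_def)
      ultimately show ?thesis by (simp add: closedin_subset_topspace)
    qed
    define Z where "Z = Q \<union> \<Union>B"
    define Z' where "Z' = (V - Q) \<union> \<Union>(A - B)"
    have ZZ: "Z \<union> Z' = P" using QV by (auto simp: Z_def Z'_def P_def B_def)
    have "Z \<inter> Z' = {}"
    proof (rule ccontr)
      assume "Z \<inter> Z' \<noteq> {}"
      then obtain x where x: "x \<in> Z" "x \<in> Z'" by blast
      show False
      proof (cases "x \<in> V")
        case True
        then have "x \<in> Q" using x(1) BQ by (auto simp: Z_def)
        then show False using x(2) by (auto simp: Z'_def B_def)
      next
        case False
        then obtain e e' where e: "e \<in> B" "x \<in> e" "e' \<in> A - B" "x \<in> e'"
          using x QV by (auto simp: Z_def Z'_def)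
        then have "e \<noteq> e'" "e \<in> E" "e' \<in> E" using A by (auto simp: B_def)
        then show False using disj[of e e'] e False by blast
      qed
    qed
    moreover have cZ: "closedin ?Y Z" "closedin ?Y Z'"
      unfolding Z_def Z'_def by (rule clW; use QV in \<open>auto simp: B_def\<close>)+
    ultimately have "Z = topspace ?Y - Z'" using ZZ top by blast
    then have "openin ?Y Z" using cZ(2) by blast
    then have "C \<subseteq> Z \<or> disjnt C Z" if "connectedin ?Y C" for C
      using connectedin_clopen_cases[OF that cZ(1)] by blast
    moreover obtain C where "connectedin ?Y C" "u \<in> C" "v \<in> C"
      using uv(3) unfolding connected_component_of_def by blast
    moreover have "u \<in> Z" by (auto simp: Z_def Q_def)
    ultimately have "v \<in> Z" by (metis disjnt_iff subsetD)
    then have "v \<in> Q" using BQ uv(2) by (auto simp: Z_def)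
    then show ?thesis by (simp add: Q_def)
  qed
  \<comment> \<open>Every edge is connected and has an end in \<open>V\<close>, so the vertices
    represent all components.\<close>
  have "connected_component_of_set ?Y ` P = connected_component_of_set ?Y ` V"
  proof -
    have "connected_component_of_set ?Y x \<in> connected_component_of_set ?Y ` V" if x: "x \<in> P" for x
    proof (cases "x \<in> V")
      case False
      then obtain e where e: "e \<in> A" "x \<in> e" using x by (auto simp: P_def)
      obtain v where v: "v \<in> e" "v \<in> V" using edge(2)[OF e(1)] by blast
      show ?thesis using connected_component_of_setD[OF comp_edge[OF e v(1)]] v(2) by blast
    qed simp
    then show ?thesis using VP by blast
  qed
  then have "num_components ?Y = card (connected_component_of_set ?Y ` V)"
    unfolding num_components_def connected_components_of_def top by (simp only:)
  also have "\<dots> = card ((\<lambda>v. ?R `` {v}) ` V)"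
  proof (rule card_image_cong_kernel)
    fix u v assume uv: "u \<in> V" "v \<in> V"
    have "connected_component_of_set ?Y u = connected_component_of_set ?Y v \<longleftrightarrow> connected_component_of ?Y u v"
      using uv VP top by (intro connected_component_of_set_eq_iff) auto
    also have "\<dots> \<longleftrightarrow> (u, v) \<in> ?R" using R_comp comp_R uv by blast
    also have "\<dots> \<longleftrightarrow> ?R `` {u} = ?R `` {v}"
    proof
      assume "(u, v) \<in> ?R"
      then have "(v, u) \<in> ?R" using symR by (meson symD)
      then show "?R `` {u} = ?R `` {v}" using \<open>(u, v) \<in> ?R\<close> by (auto intro: rtrancl_trans)
    next
      assume "?R `` {u} = ?R `` {v}"
      then show "(u, v) \<in> ?R" by blast
    qed
    finally show "connected_component_of_set ?Y u = connected_component_of_set ?Y v \<longleftrightarrow> ?R `` {u} = ?R `` {v}" .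
  qed
  also have "(\<lambda>v. ?R `` {v}) ` V = V // ?R" by (auto simp: quotient_def)
  finally show ?thesis by (simp add: graph_components_def P_def)
qed

section \<open>Regular neighbourhoods\<close>

lemma closed_surface_charts:
  assumes "closed_surface S" "x \<in> topspace S"
  shows "\<exists>D. planar_open S D \<and> x \<in> D"
proof -
  have "x \<notin> surface_boundary S" using assms by (simp add: closed_surface_def)
  then obtain U and W :: "(real \<times> real) set" where UW: "openin S U" "x \<in> U" "open W"
      "subtopology S U homeomorphic_space top_of_set W"
    using assms(2) unfolding surface_boundary_def by blast
  show ?thesis
    by (rule planar_open_small[OF UW(1,2,3,4,1,2)]) blast
qed

lemma closed_surface_compact_Hausdorff:
  assumes "closed_surface S" shows "compact_space S" "Hausdorff_space S"
  using assms by (auto simp: closed_surface_def surface_with_boundary_def)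

text \<open>A plane chart of \<open>M\<close> followed by one of \<open>S\<close> is an injective
  continuous map of the plane into itself, whose image is open by invariance of domain.\<close>

lemma planar_open_invariance:
  assumes D: "planar_open S D" and D': "planar_open (subtopology S M) D'" "D' \<subseteq> D"
  shows "openin S D'"
proof -
  obtain f where f: "homeomorphic_map (subtopology S D) plane f"
    and top: "topspace (subtopology S D) = D"
    by (rule planar_open_obtain[OF D])
  obtain g' where g': "homeomorphic_map plane (subtopology (subtopology S M) D') g'"
    and DX': "D' \<subseteq> topspace (subtopology S M)" and top': "topspace (subtopology (subtopology S M) D') = D'"
    by (rule planar_open_obtain[OF D'(1)])
  have "D' \<subseteq> M" using DX' by auto
  then have sub: "subtopology (subtopology S M) D' = subtopology S D'"
    by (simp add: subtopology_subset)
  have gim: "range g' = D'" and ginj: "inj g'"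
    using homeomorphic_imp_surjective_map[OF g'] homeomorphic_imp_injective_map[OF g'] top' by auto
  have finj: "inj_on f D" using homeomorphic_imp_injective_map[OF f] top by simp
  have "continuous_map euclidean (subtopology S D) g'"
    using homeomorphic_imp_continuous_map[OF g'] D'(2) gim unfolding sub
    by (auto simp: continuous_map_in_subtopology)
  then have "continuous_map euclidean euclidean (f \<circ> g')"
    using continuous_map_compose homeomorphic_imp_continuous_map[OF f] by blast
  then have "continuous_on UNIV (f \<circ> g')" by simp
  moreover have "inj (f \<circ> g')"
    by (rule comp_inj_on[OF ginj]) (use finj gim D'(2) inj_on_subset in auto)
  ultimately have "open ((f \<circ> g') ` UNIV)" by (intro invariance_of_domain) auto
  then have "open (f ` D')" unfolding image_comp[symmetric] gim .
  then have "openin (subtopology S D) D'"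
    using homeomorphic_map_openness_eq[OF f, of D'] D'(2) top by auto
  moreover have "openin S D" using D by (simp add: planar_open_def)
  ultimately show ?thesis by (rule openin_trans_full)
qed

text \<open>The points with a plane neighbourhood in \<open>M\<close> are the interior ones: a chart
  of \<open>S\<close> can be shrunk into the interior, and conversely invariance of domain makes a
  chart of \<open>M\<close> open in \<open>S\<close>. The intrinsic boundary thus becomes comparable
  for \<open>N\<close> and its complement.\<close>

lemma surface_boundary_subset:
  assumes S: "closed_surface S" and M: "M \<subseteq> topspace S"
  shows "surface_boundary (subtopology S M) = M - S interior_of M"
proof -
  have top: "topspace (subtopology S M) = M" using M by auto
  have "(\<exists>U W. openin (subtopology S M) U \<and> x \<in> U \<and> open (W :: (real \<times> real) set) \<and>
        subtopology (subtopology S M) U homeomorphic_space top_of_set W) \<longleftrightarrow> x \<in> S interior_of M" (is "?L \<longleftrightarrow> ?R")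
    if x: "x \<in> M" for x
  proof
    assume ?R
    obtain D0 where D0: "planar_open S D0" "x \<in> D0" using closed_surface_charts[OF S] M x by blast
    obtain D where D: "planar_open S D" "x \<in> D" "D \<subseteq> S interior_of M"
      by (rule planar_open_shrink[OF D0 openin_interior_of \<open>?R\<close>])
    have DM: "D \<subseteq> M" using D(3) interior_of_subset by fast
    have "openin (subtopology S M) D"
      using D(1) DM by (auto simp: planar_open_def openin_subtopology intro!: exI[of _ D])
    moreover have "subtopology (subtopology S M) D = subtopology S D"
      using DM by (simp add: subtopology_subset)
    ultimately show ?L using D(1,2) unfolding planar_open_def
      by (intro exI[of _ D] exI[of _ UNIV]) auto
  next
    assume ?L
    then obtain U and W :: "(real \<times> real) set" where UW: "openin (subtopology S M) U" "x \<in> U" "open W"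
        "subtopology (subtopology S M) U homeomorphic_space top_of_set W" by blast
    obtain D where D: "planar_open S D" "x \<in> D" using closed_surface_charts[OF S] M x by blast
    have "openin (subtopology S M) (D \<inter> M)" using D(1) by (auto simp: planar_open_def openin_subtopology)
    then obtain D' where D': "planar_open (subtopology S M) D'" "x \<in> D'" "D' \<subseteq> D \<inter> M"
      using planar_open_small[OF UW, of "D \<inter> M"] D(2) x by blast
    have "openin S D'" using planar_open_invariance[OF D(1) D'(1)] D'(3) by blast
    then show ?R using D'(2,3) unfolding interior_of_def by blast
  qed
  then show ?thesis unfolding surface_boundary_def top by blast
qed

locale regular_nbhd =
  fixes S :: "'a topology" and P N B :: "'a set" and h :: "'a \<times> real \<Rightarrow> 'a"
  assumes S: "closed_surface S"
    and N: "N \<subseteq> topspace S" "P \<subseteq> S interior_of N" "surface_with_boundary (subtopology S N)"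
    and B_def: "B = surface_boundary (subtopology S N)"
    and h_cont: "continuous_map (prod_topology (subtopology S B) unit_interval) (subtopology S N) h"
    and h1: "\<And>x. x \<in> B \<Longrightarrow> h (x, 1) = x"
    and h0: "h ` (B \<times> {0}) = P"
    and h_hom: "homeomorphic_map (prod_topology (subtopology S B) (top_of_set {0<..1::real}))
              (subtopology S (N - P)) h"
begin

lemma Hausdorff: "Hausdorff_space S" using closed_surface_compact_Hausdorff[OF S] by simp

lemma compactN: "compactin S N"
  using N by (simp add: compactin_subspace surface_with_boundary_def)

lemma closedN: "closedin S N" using compactN Hausdorff compactin_imp_closedin by blast

lemma B: "B = N - S interior_of N"
  unfolding B_def by (rule surface_boundary_subset[OF S N(1)])

lemma BN: "B \<subseteq> N" "B \<inter> P = {}" "B \<subseteq> topspace S" "P \<subseteq> N"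
  using B N interior_of_subset by fast+

lemma topB: "topspace (subtopology S B) = B" using BN(3) by auto

lemma topNP: "topspace (subtopology S (N - P)) = N - P" using N(1) by auto

lemma h_image: "h ` (B \<times> {0<..1}) = N - P"
  using homeomorphic_imp_surjective_map[OF h_hom] topB topNP by simp

lemma h_inj: "inj_on h (B \<times> {0<..1})"
  using homeomorphic_imp_injective_map[OF h_hom] topB by simp

text \<open>A boundary point \<open>x\<close> is the limit of the points \<open>h (x, t)\<close> as
  \<open>t\<close> tends to 1, and these are interior because \<open>h\<close> is injective on the
  collar. Consequently the interior of the complementary surface is exactly the complement of
  \<open>N\<close>.\<close>

lemma closed_interior: "S closure_of (S interior_of N) = N"
proof
  show "S closure_of (S interior_of N) \<subseteq> N"
    by (rule closure_of_minimal[OF interior_of_subset closedN])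
  show "N \<subseteq> S closure_of (S interior_of N)"
  proof
    fix x assume x: "x \<in> N"
    show "x \<in> S closure_of (S interior_of N)"
    proof (cases "x \<in> B")
      case False
      then have "x \<in> S interior_of N" using x B by blast
      then show ?thesis by (rule subsetD[OF closure_of_subset[OF interior_of_subset_topspace]])
    next
      case True
      let ?p = "\<lambda>t. h (x, t)"
      have "continuous_map unit_interval (prod_topology (subtopology S B) unit_interval) (\<lambda>t. (x, t))"
        using True topB by (simp add: continuous_map_paired del: prod_topology_subtopology_eu)
      from continuous_map_compose[OF this h_cont]
      have p: "continuous_map unit_interval S ?p" by (simp add: o_def continuous_map_in_subtopology)
      show ?thesis
      proof (rule ccontr)
        assume no: "x \<notin> S closure_of (S interior_of N)"
        define O' where "O' = topspace S - S closure_of (S interior_of N)"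
        have "openin S O'" "x \<in> O'" using no x N(1) by (auto simp: O'_def)
        then have "openin unit_interval {t \<in> topspace unit_interval. ?p t \<in> O'}"
          using openin_continuous_map_preimage[OF p] by blast
        moreover have "1 \<in> {t \<in> topspace unit_interval. ?p t \<in> O'}"
          using \<open>x \<in> O'\<close> h1[OF True] by simp
        ultimately have "\<exists>e>0. \<forall>t\<in>{0..1}. dist t 1 < e \<longrightarrow> t \<in> {t \<in> topspace unit_interval. ?p t \<in> O'}"
          unfolding openin_euclidean_subtopology_iff by blast
        then obtain e where e: "e > 0" "\<And>t. t \<in> {0..1} \<Longrightarrow> dist t 1 < e \<Longrightarrow> ?p t \<in> O'"
          by blast
        \<comment> \<open>Positive, so that the point lies on the collar; below 1, so that it is off
          \<open>B\<close>; and within \<open>e\<close> of 1.\<close>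
        define t where "t = max (1/2) (1 - e/2)"
        have t: "0 < t" "t < 1" "dist t 1 < e" using e(1) by (auto simp: t_def dist_real_def max_def)
        then have "?p t \<in> O'" using e(2) by simp
        moreover have "?p t \<in> N - B"
        proof -
          have "?p t \<in> N" using h_image True t by (metis DiffD1 SigmaI greaterThanAtMost_iff imageI less_eq_real_def)
          moreover have "?p t \<notin> B"
          proof
            assume b: "?p t \<in> B"
            then have "h (x, t) = h (?p t, 1)" using h1 by simp
            then have "(x, t) = (?p t, 1)" using h_inj b True t by (auto dest!: inj_onD)
            then show False using t(2) by simp
          qed
          ultimately show ?thesis by blast
        qed
        then have "?p t \<in> S interior_of N" using B by blast
        moreover have "S interior_of N \<subseteq> S closure_of (S interior_of N)"
          by (rule closure_of_subset[OF interior_of_subset_topspace])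
        ultimately show False by (auto simp: O'_def)
      qed
    qed
  qed
qed

section \<open>The common boundary and the two retractions\<close>

definition C where "C = topspace S - S interior_of N"

lemma boundary_C: "surface_boundary (subtopology S C) = B"
proof -
  have "S interior_of C = topspace S - N"
    unfolding C_def by (simp add: interior_of_complement closed_interior)
  then have "surface_boundary (subtopology S C) = C - (topspace S - N)"
    using surface_boundary_subset[OF S, of C] by (simp add: C_def)
  then show ?thesis using B N(1) by (auto simp: C_def)
qed

lemma num_boundary: "num_boundary_components (subtopology S N) = num_boundary_components (subtopology S C)"
proof -
  have "B \<subseteq> C" using B BN(3) by (auto simp: C_def)
  then have "subtopology (subtopology S N) B = subtopology (subtopology S C) B"
    using BN(1) by (simp add: subtopology_subset)
  then show ?thesis
    unfolding num_boundary_components_def boundary_C using B_def by simp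
qed

text \<open>Each point slides down its line of the mapping cylinder, from \<open>h (b, t)\<close> to
  \<open>h (b, (1 - s) * t)\<close>, and reaches \<open>P\<close> at time 1.\<close>

lemma N_equivalent: "subtopology S N homotopy_equivalent_space subtopology S P"
proof -
  let ?I = "unit_interval" and ?N = "subtopology S N" and ?BB = "subtopology S B"
  let ?k = "inv_into (B \<times> {0<..1}) h"
  define F where "F = (\<lambda>(s, x). if x \<in> P then x else h (fst (?k x), (1 - s) * snd (?k x)))"
  have k: "?k (h (b, t)) = (b, t)" if "b \<in> B" "0 < t" "t \<le> 1" for b t
    by (rule inv_into_f_f[OF h_inj]) (use that in auto)
  have topN: "topspace ?N = N" using N by auto
  have h0P: "h (b, 0) \<in> P" if "b \<in> B" for b using h0 that by blast
  have hNP: "h (b, t) \<in> N - P" if "b \<in> B" "0 < t" "t \<le> 1" for b t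
    using h_image that by force
  have Fh: "F (s, h (b, t)) = h (b, (1 - s) * t)" if "b \<in> B" "t \<in> {0..1}" for s b t
  proof (cases "t = 0")
    case True
    then show ?thesis using h0P[OF that(1)] by (simp add: F_def)
  next
    case False
    then show ?thesis using that hNP[of b t] k[of b t] by (simp add: F_def)
  qed
  have sur: "\<exists>b\<in>B. \<exists>t\<in>{0..1}. x = h (b, t)" if x: "x \<in> N" for x
  proof (cases "x \<in> P")
    case True
    then obtain b where "b \<in> B" "x = h (b, 0)" using h0 by auto
    then show ?thesis by (intro bexI[of _ b] bexI[of _ 0]) auto
  next
    case False
    then have "x \<in> h ` (B \<times> {0<..1})" using h_image x by simp
    then obtain b t where "b \<in> B" "t \<in> {0<..1}" "x = h (b, t)" by auto
    then show ?thesis by (intro bexI[of _ b] bexI[of _ t]) auto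
  qed
  let ?BI = "prod_topology ?BB ?I"
  let ?Q = "\<lambda>(s, z). (s, h z)"
  \<comment> \<open>Compactness of the boundary is what makes \<open>?Q\<close> a quotient
    map.\<close>
  have "compactin S B"
  proof -
    have "closedin S B" unfolding B by (intro closedin_diff closedN openin_interior_of)
    then show ?thesis using compactN BN(1) closed_compactin by blast
  qed
  then have "compact_space ?BB" by (simp add: compact_space_subtopology)
  then have cpt: "compact_space (prod_topology ?I ?BI)"
    by (simp add: compact_space_prod_topology compact_space_subtopology del: prod_topology_subtopology_eu)
  have HN: "Hausdorff_space ?N" using Hausdorff Hausdorff_space_subtopology by blast
  have Hd: "Hausdorff_space (prod_topology ?I ?N)"
  proof -
    have "Hausdorff_space ?I" by (rule Hausdorff_space_subtopology) (rule Hausdorff_space_euclidean)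
    then show ?thesis using HN by (simp add: Hausdorff_space_prod_topology)
  qed
  have Qc: "continuous_map (prod_topology ?I ?BI) (prod_topology ?I ?N) ?Q"
    unfolding case_prod_unfold
    by (intro continuous_map_pairedI continuous_map_fst)
      (use continuous_map_compose[OF continuous_map_snd h_cont, of ?I] in \<open>simp add: o_def\<close>)
  \<comment> \<open>\<open>F\<close> is defined by cases, but it is continuous because it becomes so after composition with a
    quotient map.\<close>
  have "quotient_map (prod_topology ?I ?BI) (prod_topology ?I ?N) ?Q"
  proof (rule continuous_imp_quotient_map[OF Qc cpt Hd])
    show "?Q ` topspace (prod_topology ?I ?BI) = topspace (prod_topology ?I ?N)"
    proof
      show "?Q ` topspace (prod_topology ?I ?BI) \<subseteq> topspace (prod_topology ?I ?N)"
        using continuous_map_image_subset_topspace[OF Qc] .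
      show "topspace (prod_topology ?I ?N) \<subseteq> ?Q ` topspace (prod_topology ?I ?BI)"
      proof
        fix z assume "z \<in> topspace (prod_topology ?I ?N)"
        then obtain s x where z: "z = (s, x)" "s \<in> {0..1}" "x \<in> N" using topN by auto
        obtain b t where "b \<in> B" "t \<in> {0..1}" "x = h (b, t)" using sur[OF z(3)] by blast
        then show "z \<in> ?Q ` topspace (prod_topology ?I ?BI)"
          using z topB by (intro image_eqI[of _ _ "(s, (b, t))"]) auto
      qed
    qed
  qed
  moreover have "continuous_map (prod_topology ?I ?BI) ?N (F \<circ> ?Q)"
  proof -
    let ?X = "prod_topology ?I ?BI"
    have c1: "continuous_map ?X euclideanreal fst"
      using continuous_map_fst[of ?I ?BI] by (simp add: continuous_map_in_subtopology del: prod_topology_subtopology_eu)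
    have c2: "continuous_map ?X ?BB (\<lambda>z. fst (snd z))"
      using continuous_map_compose[OF continuous_map_snd[of ?I ?BI] continuous_map_fst] by (simp add: o_def del: prod_topology_subtopology_eu)
    have "continuous_map ?X ?I (\<lambda>z. snd (snd z))"
      using continuous_map_compose[OF continuous_map_snd[of ?I ?BI] continuous_map_snd] by (simp add: o_def del: prod_topology_subtopology_eu)
    then have c3: "continuous_map ?X euclideanreal (\<lambda>z. snd (snd z))" by (simp add: continuous_map_in_subtopology del: prod_topology_subtopology_eu)
    have "continuous_map ?X euclideanreal (\<lambda>z. (1 - fst z) * snd (snd z))"
      by (intro continuous_map_real_mult continuous_map_diff c1 c3) simp
    then have "continuous_map ?X ?I (\<lambda>z. (1 - fst z) * snd (snd z))"
      by (auto simp: continuous_map_in_subtopology intro!: mult_le_one simp del: prod_topology_subtopology_eu)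
    with c2 have "continuous_map ?X ?BI (\<lambda>z. (fst (snd z), (1 - fst z) * snd (snd z)))"
      by (rule continuous_map_pairedI)
    from continuous_map_compose[OF this h_cont]
    have "continuous_map ?X ?N (\<lambda>z. h (fst (snd z), (1 - fst z) * snd (snd z)))" by (simp add: o_def)
    then show ?thesis
    proof (rule continuous_map_eq)
      fix z assume "z \<in> topspace ?X"
      then obtain s b t where "z = (s, (b, t))" "b \<in> B" "t \<in> {0..1}" using topB by auto
      then show "h (fst (snd z), (1 - fst z) * snd (snd z)) = (F \<circ> ?Q) z" using Fh by simp
    qed
  qed
  ultimately have Fc: "continuous_map (prod_topology ?I ?N) ?N F"
    using continuous_compose_quotient_map by blast
  have "?N homotopy_equivalent_space subtopology ?N P"
  proof (rule deformation_homotopy_equivalent[OF Fc])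
    show "F (0, x) = x" if x: "x \<in> topspace ?N" for x
    proof -
      obtain b t where "b \<in> B" "t \<in> {0..1}" "x = h (b, t)" using sur[OF x[unfolded topN]] by blast
      then show ?thesis using Fh[of b t 0] by simp
    qed
    show "F (1, x) \<in> P" if x: "x \<in> topspace ?N" for x
    proof -
      obtain b t where "b \<in> B" "t \<in> {0..1}" "x = h (b, t)" using sur[OF x[unfolded topN]] by blast
      then show ?thesis using Fh[of b t 1] h0P by simp
    qed
    show "F (1, x) = x" if "x \<in> P" for x using that by (simp add: F_def)
    show "P \<subseteq> topspace ?N" using topN BN by simp
  qed
  moreover have "subtopology ?N P = subtopology S P"
    using BN(4) by (simp add: subtopology_subset)
  ultimately show ?thesis by simp
qed

text \<open>The slide goes outwards, from \<open>h (b, t)\<close> to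
  \<open>h (b, (1 - s) * t + s)\<close>, and stops on \<open>B\<close>. With \<open>P\<close>
  absent, \<open>h\<close> has a continuous inverse on the collar, and the homotopy can be pasted
  along \<open>B\<close>, where nothing moves.\<close>

lemma C_equivalent: "subtopology S (topspace S - P) homotopy_equivalent_space subtopology S C"
proof -
  let ?I = "unit_interval" and ?J = "top_of_set {0<..1::real}" and ?BB = "subtopology S B"
  let ?X = "subtopology S (topspace S - P)" and ?M = "subtopology S (N - P)"
  obtain k where hk: "homeomorphic_maps (prod_topology ?BB ?J) ?M h k"
    using h_hom homeomorphic_map_maps by blast
  have kc: "continuous_map ?M (prod_topology ?BB ?J) k"
    and kh: "\<And>b t. b \<in> B \<Longrightarrow> t \<in> {0<..1} \<Longrightarrow> k (h (b, t)) = (b, t)"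
    and hk': "\<And>x. x \<in> N - P \<Longrightarrow> h (k x) = x"
    using hk topB topNP by (auto simp: homeomorphic_maps_def)
  have hc: "continuous_map (prod_topology ?BB ?J) ?M h" using homeomorphic_imp_continuous_map[OF h_hom] .
  have kin: "k x \<in> B \<times> {0<..1}" if "x \<in> N - P" for x
    using continuous_map_image_subset_topspace[OF kc] that topB topNP by auto
  have topX: "topspace ?X = topspace S - P" by auto
  have CP: "C \<inter> P = {}" using N(2) by (auto simp: C_def)
  have CX: "C \<subseteq> topspace S - P" using CP by (auto simp: C_def)
  have NC: "N \<inter> C = B" using B N(1) by (auto simp: C_def)
  have kB: "k x = (x, 1)" if "x \<in> B" for x using kh[of x 1] h1[OF that] that by simp
  let ?f = "\<lambda>(s, x). h (fst (k x), (1 - s) * snd (k x) + s)"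
  define F where "F = (\<lambda>(s, x). if x \<in> N then h (fst (k x), (1 - s) * snd (k x) + s) else x)"
  \<comment> \<open>A convex combination of 1 and a positive \<open>t\<close> stays positive, so the
    slide never meets \<open>P\<close>.\<close>
  have conv: "(1 - s) * t + s \<in> {0<..1}" if "s \<in> {0..1}" "t \<in> {0<..1}" for s t :: real
  proof -
    have "(1 - s) * t \<le> (1 - s) * 1" using that by (intro mult_left_mono) auto
    moreover have "0 < (1 - s) * t + s"
      using that by (cases "s = 0") (auto intro!: add_nonneg_pos)
    ultimately show ?thesis by auto
  qed
  have Fc: "continuous_map (prod_topology ?I ?X) ?X F"
  proof (rule pasting_lemma_closed[where I="UNIV :: bool set" and T="\<lambda>b. {0..1} \<times> (if b then N - P else C)"
          and f="\<lambda>b. if b then ?f else snd"])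
    show "closedin (prod_topology ?I ?X) ({0..1} \<times> (if b then N - P else C))" for b
    proof -
      have "(topspace S - P) \<inter> N = N - P" "(topspace S - P) \<inter> C = C" using N(1) CX by auto
      moreover have "closedin S C" unfolding C_def
        by (rule closedin_diff[OF closedin_topspace openin_interior_of])
      ultimately have "closedin ?X (N - P)" "closedin ?X C"
        using closedN by (metis closedin_subtopology_Int_closed)+
      then show ?thesis by (simp add: closedin_prod_Times_iff)
    qed
    show "continuous_map (subtopology (prod_topology ?I ?X) ({0..1} \<times> (if b then N - P else C))) ?X
        (if b then ?f else snd)" for b
    proof (cases b)
      case True
      have "(topspace S - P) \<inter> (N - P) = N - P" using N(1) by auto
      then have sub: "subtopology (prod_topology ?I ?X) ({0..1} \<times> (N - P)) = prod_topology ?I ?M"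
        by (simp add: subtopology_Times subtopology_subtopology del: prod_topology_subtopology_eu)
      let ?Z = "prod_topology ?I ?M"
      have c1: "continuous_map ?Z euclideanreal fst"
        using continuous_map_fst[of ?I ?M] by (simp add: continuous_map_in_subtopology del: prod_topology_subtopology_eu)
      have ck: "continuous_map ?Z (prod_topology ?BB ?J) (k \<circ> snd)"
        by (rule continuous_map_compose[OF continuous_map_snd kc])
      have c2: "continuous_map ?Z ?BB (\<lambda>z. fst (k (snd z)))"
        using continuous_map_compose[OF ck continuous_map_fst] by (simp add: o_def del: prod_topology_subtopology_eu)
      have "continuous_map ?Z ?J (\<lambda>z. snd (k (snd z)))"
        using continuous_map_compose[OF ck continuous_map_snd] by (simp add: o_def del: prod_topology_subtopology_eu)
      then have c3: "continuous_map ?Z euclideanreal (\<lambda>z. snd (k (snd z)))"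
        by (simp add: continuous_map_in_subtopology del: prod_topology_subtopology_eu)
      have c4: "continuous_map ?Z euclideanreal (\<lambda>z. (1 - fst z) * snd (k (snd z)) + fst z)"
        by (intro continuous_map_add continuous_map_real_mult continuous_map_diff c1 c3) simp
      have "continuous_map ?Z ?J (\<lambda>z. (1 - fst z) * snd (k (snd z)) + fst z)"
        unfolding continuous_map_in_subtopology
      proof (intro conjI c4)
        show "(\<lambda>z. (1 - fst z) * snd (k (snd z)) + fst z) \<in> topspace ?Z \<rightarrow> {0<..1}"
        proof
          fix z assume "z \<in> topspace ?Z"
          then have z: "fst z \<in> {0..1}" "snd z \<in> N - P"
            by (simp_all only: topspace_prod_topology topNP topspace_euclidean_subtopology mem_Times_iff)
          from kin[OF z(2)] have "snd (k (snd z)) \<in> {0<..1}" unfolding mem_Times_iff ..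
          from conv[OF z(1) this] show "(1 - fst z) * snd (k (snd z)) + fst z \<in> {0<..1}" .
        qed
      qed
      with c2 have "continuous_map ?Z (prod_topology ?BB ?J) (\<lambda>z. (fst (k (snd z)), (1 - fst z) * snd (k (snd z)) + fst z))"
        by (rule continuous_map_pairedI)
      from continuous_map_compose[OF this hc]
      have cM: "continuous_map ?Z ?M ?f" by (simp add: o_def case_prod_unfold)
      have "continuous_map ?Z ?X ?f"
        unfolding continuous_map_in_subtopology[of ?Z S]
      proof (intro conjI)
        show "continuous_map ?Z S ?f" using cM unfolding continuous_map_in_subtopology[of ?Z S] by blast
        show "?f \<in> topspace ?Z \<rightarrow> topspace S - P"
        proof
          fix z assume "z \<in> topspace ?Z"
          then have "?f z \<in> topspace ?M" using continuous_map_image_subset_topspace[OF cM] by blast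
          then show "?f z \<in> topspace S - P" unfolding topNP using N(1) by blast
        qed
      qed
      then show ?thesis using True sub by simp
    next
      case False
      then show ?thesis
        using continuous_map_from_subtopology[OF continuous_map_snd[of ?I ?X]] by simp
    qed
    have eq: "?f (s, x) = x" if "x \<in> N - P" "x \<in> C" for s x
    proof -
      have "x \<in> B" using that NC by blast
      then show ?thesis using kB h1 by simp
    qed
    show "(if i then ?f else snd) z = (if j then ?f else snd) z"
      if z: "z \<in> topspace (prod_topology ?I ?X) \<inter> ({0..1} \<times> (if i then N - P else C)) \<inter> ({0..1} \<times> (if j then N - P else C))" for i j z
    proof (cases "i = j")
      case False
      obtain s x where sx: "z = (s, x)" by (cases z)
      have "x \<in> N - P" "x \<in> C" using z False unfolding sx by (auto split: if_splits)
      from eq[OF this] show ?thesis using False unfolding sx by auto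
    qed simp
    show "\<exists>j. j \<in> UNIV \<and> z \<in> {0..1} \<times> (if j then N - P else C) \<and> F z = (if j then ?f else snd) z"
      if "z \<in> topspace (prod_topology ?I ?X)" for z
    proof -
      obtain s x where sx: "z = (s, x)" by (cases z)
      have "s \<in> {0..1}" "x \<in> topspace S - P" using that unfolding sx by auto
      moreover have "x \<in> C" if "x \<notin> N" "x \<in> topspace S" using that interior_of_subset[of S N] by (auto simp: C_def)
      ultimately show ?thesis unfolding sx F_def by (intro exI[of _ "x \<in> N"]) auto
    qed
  qed auto
  have "?X homotopy_equivalent_space subtopology ?X C"
  proof (rule deformation_homotopy_equivalent[OF Fc])
    show "F (0, x) = x" if "x \<in> topspace ?X" for x
      using that hk'[of x] by (simp add: F_def)
    show "F (1, x) \<in> C" if "x \<in> topspace ?X" for x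
    proof (cases "x \<in> N")
      case True
      then have "fst (k x) \<in> B" using kin[of x] that by (auto simp: mem_Times_iff)
      then show ?thesis using True h1 NC by (auto simp: F_def)
    next
      case False
      then show ?thesis using that interior_of_subset[of S N] by (auto simp: F_def C_def)
    qed
    show "F (1, x) = x" if "x \<in> C" for x
    proof (cases "x \<in> N")
      case True
      then have "x \<in> B" using that NC by blast
      then show ?thesis using True kB h1 by (simp add: F_def)
    qed (simp add: F_def)
    show "C \<subseteq> topspace ?X" unfolding topX by (rule CX)
  qed
  moreover have "subtopology ?X C = subtopology S C"
    using CX by (simp add: subtopology_subset)
  ultimately show ?thesis by simp
qed

end

lemma regular_neighbourhood_nbhd:
  assumes "closed_surface S" "regular_neighbourhood S P N"
  shows "\<exists>h. regular_nbhd S P N (surface_boundary (subtopology S N)) h"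
  using assms unfolding regular_neighbourhood_def Let_def regular_nbhd_def by blast

theorem regular_neighbourhood_invariants:
  assumes "closed_surface S" "regular_neighbourhood S P N"
  shows "subtopology S N homotopy_equivalent_space subtopology S P"
    "subtopology S (topspace S - P) homotopy_equivalent_space surface_complement S N"
    "num_boundary_components (subtopology S N) = num_boundary_components (surface_complement S N)"
proof -
  obtain h where "regular_nbhd S P N (surface_boundary (subtopology S N)) h"
    using regular_neighbourhood_nbhd[OF assms] by blast
  then interpret regular_nbhd S P N "surface_boundary (subtopology S N)" h .
  show "subtopology S N homotopy_equivalent_space subtopology S P" by (rule N_equivalent)
  have "subtopology S C = surface_complement S N" by (simp add: C_def surface_complement_def)
  then show "subtopology S (topspace S - P) homotopy_equivalent_space surface_complement S N"
    "num_boundary_components (subtopology S N) = num_boundary_components (surface_complement S N)"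
    using C_equivalent num_boundary by simp_all
qed

section \<open>The two polynomials\<close>

theorem theorem5p3:
  fixes S :: "'a topology" and V :: "'a set" and E :: "'a set set"
    and N :: "'a set set \<Rightarrow> 'a set"
    and x y z w :: "'k::field"
  assumes "closed_surface S"
    and "drawn_graph S V E"
    and "\<And>A. A \<subseteq> E \<Longrightarrow> regular_neighbourhood S (V \<union> \<Union>A) (N A)"
    and "z \<noteq> 0" and "w\<^sup>2 = z"
  shows "las_vergnas S V E x y z =
         w powi (euler_genus (subtopology S (N E)) - euler_genus (surface_complement S (N E))) *
         krushkal S V E N (x - 1) (y - 1) (inverse w) w"
proof -
  note S = closed_surface_compact_Hausdorff[OF assms(1)]
  note charts = closed_surface_charts[OF assms(1)]
  have V: "finite V" "V \<subseteq> topspace S" and E: "finite E" using assms(2) by (auto simp: drawn_graph_def)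
  define c where "c A = int (graph_components V A)" for A
  define \<rho> where "\<rho> A = int (complement_components S V A)" for A
  define d where "d A = euler_genus (subtopology S (N A)) - euler_genus (surface_complement S (N A))" for A
  \<comment> \<open>The part of \<open>d A\<close> that does not depend on \<open>A\<close>; it
    cancels in \<open>d E - d A\<close>.\<close>
  define r where "r = echar (subtopology S (topspace S - V)) {} - int (card V)"
  have comp: "int (num_components (surface_complement S (N A))) = \<rho> A"
    and dA: "d A = 2 * (c A - \<rho> A + int (card A)) + r" if A: "A \<subseteq> E" for A
  proof -
    note inv = regular_neighbourhood_invariants[OF assms(1) assms(3)[OF A]]
    show comp: "int (num_components (surface_complement S (N A))) = \<rho> A"
      using num_components_homotopy_equivalent[OF inv(2)] by (simp add: \<rho>_def complement_components_def)
    have compN: "int (num_components (subtopology S (N A))) = c A"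
      using num_components_homotopy_equivalent[OF inv(1)] num_components_graph[OF S(2) assms(2) A]
      by (simp add: c_def)
    have "surface_euler_char (subtopology S (N A)) = int (card V) - int (card A)"
      using graph_euler[OF S(2) assms(2) A] echar_homotopy_equivalent[OF inv(1)]
      by (simp add: surface_euler_char_echar)
    moreover have "surface_euler_char (surface_complement S (N A))
        = echar (subtopology S (topspace S - V)) {} + int (card A)"
      using surface_graph_complement[OF S charts assms(2) A] echar_homotopy_equivalent[OF inv(2)]
      by (simp add: surface_euler_char_echar)
    ultimately show "d A = 2 * (c A - \<rho> A + int (card A)) + r"
      unfolding d_def euler_genus_def comp compN inv(3) by (simp add: r_def)
  qed
  have comp0: "int (num_components S) = \<rho> {}"
    using num_components_remove_finite[OF S(2) charts V] by (simp add: \<rho>_def complement_components_def)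
  have w: "w \<noteq> 0" using assms(4,5) by auto
  have "(x - 1) powi (c A - c E) * (y - 1) powi (\<rho> A - \<rho> {}) *
         z powi (int (card E) - int (card A) - \<rho> E + \<rho> A + c E - c A)
      = w powi d E * ((x - 1) powi (c A - c E) *
         (y - 1) powi (int (num_components (surface_complement S (N A))) - int (num_components S)) *
         inverse w powi euler_genus (subtopology S (N A)) * w powi euler_genus (surface_complement S (N A)))"
    if "A \<in> Pow E" for A
  proof -
    have A: "A \<subseteq> E" using that by simp
    let ?k = "int (card E) - int (card A) - \<rho> E + \<rho> A + c E - c A"
    \<comment> \<open>Passing to the square root \<open>w\<close> doubles the exponent, which is
      then the difference of the full genera instead of their halves.\<close>
    have "z powi ?k = w powi (2 * ?k)"
      using power_int_mult[of w 2 ?k] assms(5) by (simp only: power_int_numeral)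
    also have "2 * ?k = d E - d A" using dA[OF A] dA[OF order_refl] by simp
    also have "w powi (d E - d A) = w powi d E * (inverse w powi euler_genus (subtopology S (N A)) *
        w powi euler_genus (surface_complement S (N A)))"
      using w by (simp add: d_def power_int_diff power_int_inverse divide_simps)
    finally show ?thesis by (simp add: comp[OF A] comp0 mult_ac)
  qed
  then show ?thesis
    unfolding las_vergnas_def krushkal_def Let_def c_def[symmetric] \<rho>_def[symmetric] d_def[symmetric]
    unfolding sum_distrib_left by (intro sum.cong refl)
qed

end
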